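(* Let $X$ be a finite set and $\mathbf{c}=(c_1,\dots,c_n)$ distinct labels not in $X$. The map assigning to a w-tangle $T\in\mathcal{W}^{X\cup\{\mathbf{c}\}}$ with $$\varphi(T)=\left(\begin{array}{c|cc}\omega & x_{\mathbf{c}} & x_S\\ \hline y_{\mathbf{c}}&\alpha&\theta\\ y_S&\phi&\Xi\end{array}\right)\qquad(S=X)$$ the value $\omega\det(I-\alpha)$ yields an invariant on $\mathcal{W}^{X\cup\{\mathbf{c}\}}_{cl}$; that is, if $T,T'\in\mathcal{W}^{X\cup\{\mathbf{c}\}}$ satisfy $\mathrm{tr}_{\mathbf{c}}(T)=\mathrm{tr}_{\mathbf{c}}(T')$, then the values $\omega\det(I-\alpha)$ computed from $\varphi(T)$ and from $\varphi(T')$ are equal.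
   Context: W-tangles. A w-tangle diagram labelled by a finite set $Y$ is a finite collection of oriented arcs (no closed components), bijectively labelled by $Y$, drawn in the plane with finitely many transverse double points, each virtual, positive or negative, up to planar isotopy, the position of endpoints being immaterial. A w-tangle is an equivalence class modulo R2, R3, the purely virtual moves VR1–VR3, the mixed moves M (arcs having only virtual crossings may be moved across real crossings), and OC (two consecutive overpasses of an arc may be exchanged); R1 is not imposed. $\mathcal{W}^Y$ is the set of w-tangles labelled by $Y$. Operations: $m^{x,y}_z$ connects the head of strand $x$ to the tail of strand $y$ (creating only virtual crossings) and calls the result $z$; $e_x$ adds a crossingless strand $x$; $\sqcup$ is disjoint union; $\sigma^x_z$ relabels. $R_{i,j}^{\pm}$ is the two-strand w-tangle with one real crossing of sign $\pm$ with strand $i$ over strand $j$. Every w-tangle is obtained from a disjoint union of crossings and trivial strands by stitching. $\mathcal{W}^{X\cup\{\mathbf{c}\}}_{cl}$ is the analogous set of w-tangles (same moves) in which the components labelled by $X$ are open and those labelled $c_1,\dots,c_n$ are closed. $\mathrm{tr}_{\mathbf{c}}:\mathcal{W}^{X\cup\{\mathbf{c}\}}\to\mathcal{W}^{X\cup\{\mathbf{c}\}}_{cl}$ closes each component $c_i$ in the trivial way (creating only virtual crossings). $\Gamma$-calculus. An element labelled by $Y$ is a pair $(\omega,M)$ with $\omega\in\mathbb{Q}(t_i:i\in Y)$ and $M$ a $Y\times Y$ matrix over this field (rows $y_i$, columns $x_j$) with $M|_{t_i\to1}=I$. Operations: $e_a$ sends $(\omega,M)$ to $(\omega,(1)\oplus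 M)$; $(\omega_1,M_1)\sqcup(\omega_2,M_2)=(\omega_1\omega_2,M_1\oplus M_2)$; $\sigma^a_b$ renames $x_a,y_a,t_a$ to $x_b,y_b,t_b$; and, if the entries in rows $y_a,y_b,y_S$ and columns $x_a,x_b,x_S$ are $\left(\begin{smallmatrix}\alpha&\beta&\theta\\ \gamma&\delta&\epsilon\\ \phi&\psi&\Xi\end{smallmatrix}\right)$, then $m^{a,b}_c$ produces scalar $(1-\gamma)\omega$ and matrix (rows $y_c,y_S$, columns $x_c,x_S$) $\begin{pmatrix}\beta+\frac{\alpha\delta}{1-\gamma}&\theta+\frac{\alpha\epsilon}{1-\gamma}\\ \psi+\frac{\delta\phi}{1-\gamma}&\Xi+\frac{\phi\epsilon}{1-\gamma}\end{pmatrix}$, with $t_a,t_b\to t_c$ substituted everywhere. The invariant $\varphi$ of w-tangles is the map compatible with all these operations determined by: $\varphi(R_{a,b}^{\pm})$ has scalar part $1$ and matrix part (rows $y_a,y_b$, columns $x_a,x_b$) $\begin{pmatrix}1&1-t_a^{\pm1}\\0&t_a^{\pm1}\end{pmatrix}$. *)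

theory Defs
  imports
    "HOL-Library.Poly_Mapping"
    "HOL-Library.Infinite_Typeclass"
    "HOL-Computational_Algebra.Fraction_Field"
    "HOL-Combinatorics.Orbits"
    "Jordan_Normal_Form.Determinant"
begin

section \<open>Plane diagrams with real and virtual crossings\<close>

text \<open>
  Plane diagrams are considered up to planar isotopy, so they are encoded by their combinatorics.
  Every double point \<open>c\<close> is met by two passages: rotate the picture so that one of the two oriented
  branches heads east and the other one north; these are the passages \<open>(c, East)\<close> and
  \<open>(c, North)\<close>. Hence the pair of velocity vectors (east, north) is a positive basis. A component
  is the sequence of the passages met along it (read cyclically for a closed component), and a
  double point is marked virtual, positive or negative. In a positive crossing the velocities
  (over, under) form a positive basis, so East is the over branch; in a negative one North is.
\<close>

datatype side = East | North

fun opp :: "side \<Rightarrow> side" where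
  "opp East = North"
| "opp North = East"

datatype mark = Virtual | Positive | Negative

type_synonym passage = "nat \<times> side"

text \<open>Labels of open and of closed components; \<open>word\<close> and \<open>mark\<close> carry dummy values elsewhere.\<close>

record 'a diagram =
  opens :: "'a set"
  closeds :: "'a set"
  word :: "'a \<Rightarrow> passage list"
  mark :: "nat \<Rightarrow> mark"

definition labels :: "'a diagram \<Rightarrow> 'a set" where
  "labels D = opens D \<union> closeds D"

definition crossings :: "'a diagram \<Rightarrow> nat set" where
  "crossings D = (\<Union>y\<in>labels D. fst ` set (word D y))"

definition well_formed :: "'a diagram \<Rightarrow> bool" where
  "well_formed D \<longleftrightarrow>
     finite (labels D) \<and> opens D \<inter> closeds D = {} \<and>
     (\<forall>y. y \<notin> labels D \<longrightarrow> word D y = []) \<and>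
     (\<forall>c\<in>crossings D. \<forall>s. (\<Sum>y\<in>labels D. count_list (word D y) (c, s)) = 1) \<and>
     (\<forall>c. c \<notin> crossings D \<longrightarrow> mark D c = Virtual)"

definition over :: "'a diagram \<Rightarrow> passage \<Rightarrow> bool" where
  "over D p \<longleftrightarrow> (mark D (fst p) = Positive \<and> snd p = East) \<or> (mark D (fst p) = Negative \<and> snd p = North)"

definition under :: "'a diagram \<Rightarrow> passage \<Rightarrow> bool" where
  "under D p \<longleftrightarrow> (mark D (fst p) = Positive \<and> snd p = North) \<or> (mark D (fst p) = Negative \<and> snd p = East)"

definition virtual :: "'a diagram \<Rightarrow> nat \<Rightarrow> bool" where
  "virtual D c \<longleftrightarrow> mark D c = Virtual"

subsection \<open>Planarity\<close>

text \<open>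
  The underlying graph has the double points as vertices and an edge for each pair of consecutive
  passages. The cyclic order of the four half-edges at a vertex is known, so the faces are the
  orbits of the usual face permutation, and planarity is Euler's formula for every connected
  component. Half-edges leading to an end point of an open component are fixed points of the edge
  involution: this amounts to contracting them, which does not affect the Euler characteristic.
  Components without double points never obstruct planarity and do not enter the count.
\<close>

definition follows :: "'a diagram \<Rightarrow> passage \<Rightarrow> passage \<Rightarrow> bool" where
  "follows D p q \<longleftrightarrow>
     (\<exists>y\<in>labels D. \<exists>u v. word D y = u @ [p, q] @ v) \<or>
     (\<exists>y\<in>closeds D. word D y \<noteq> [] \<and> p = last (word D y) \<and> q = hd (word D y))"

datatype direction = In | Out

type_synonym half_edge = "passage \<times> direction"

text \<open>Counterclockwise rotation about a double point.\<close>

fun rot :: "half_edge \<Rightarrow> half_edge" where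
  "rot ((c, East), Out) = ((c, North), Out)"
| "rot ((c, North), Out) = ((c, East), In)"
| "rot ((c, East), In) = ((c, North), In)"
| "rot ((c, North), In) = ((c, East), Out)"

fun glue :: "'a diagram \<Rightarrow> half_edge \<Rightarrow> half_edge" where
  "glue D (p, Out) = (if \<exists>q. follows D p q then (THE q. follows D p q, In) else (p, Out))"
| "glue D (q, In) = (if \<exists>p. follows D p q then (THE p. follows D p q, Out) else (q, In))"

definition faces :: "'a diagram \<Rightarrow> half_edge set set" where
  "faces D = (\<lambda>h. orbit (rot \<circ> glue D) h) ` {h. fst (fst h) \<in> crossings D}"

definition edges :: "'a diagram \<Rightarrow> (passage \<times> passage) set" where
  "edges D = {(p, q). follows D p q}"

definition connected_parts :: "'a diagram \<Rightarrow> nat set set" where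
  "connected_parts D =
     crossings D // ({(c, d). \<exists>s t. follows D (c, s) (d, t) \<or> follows D (d, t) (c, s)}\<^sup>*)"

definition planar :: "'a diagram \<Rightarrow> bool" where
  "planar D \<longleftrightarrow> card (crossings D) + card (faces D) = card (edges D) + 2 * card (connected_parts D)"

definition is_diagram :: "'a diagram \<Rightarrow> bool" where
  "is_diagram D \<longleftrightarrow> well_formed D \<and> planar D"

subsection \<open>Moves\<close>

text \<open>
  A local move replaces the subwords \<open>us\<close>, which sit in the holes \<open>Inr 0, Inr 1, \<dots>\<close> of a common
  template \<open>W\<close>, by the subwords \<open>vs\<close>.
\<close>

definition fill :: "passage list list \<Rightarrow> (passage + nat) list \<Rightarrow> passage list" where
  "fill us w = concat (map (case_sum (\<lambda>p. [p]) (\<lambda>i. us ! i)) w)"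

definition local_move :: "passage list list \<Rightarrow> passage list list \<Rightarrow> 'a diagram \<Rightarrow> 'a diagram \<Rightarrow> bool" where
  "local_move us vs D D' \<longleftrightarrow>
     opens D' = opens D \<and> closeds D' = closeds D \<and>
     (\<exists>W. (\<forall>i<length us. (\<Sum>y\<in>labels D. count_list (W y) (Inr i)) = 1) \<and>
          (\<forall>y. \<forall>i. Inr i \<in> set (W y) \<longrightarrow> y \<in> labels D \<and> i < length us) \<and>
          (\<forall>y. word D y = fill us (W y) \<and> word D' y = fill vs (W y))) \<and>
     (\<forall>c\<in>crossings D \<inter> crossings D'. mark D' c = mark D c)"

text \<open>
  A bigon with corners \<open>p\<close>, \<open>q\<close>; the two branches run in parallel or in opposite directions.
\<close>

definition bigon :: "bool \<Rightarrow> side \<Rightarrow> nat \<Rightarrow> nat \<Rightarrow> passage list list" where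
  "bigon par s p q =
     [[(p, s), (q, opp s)],
      if par then [(p, opp s), (q, s)] else [(q, s), (p, opp s)]]"

text \<open>
  One side of a Reidemeister move of type three, with the crossings \<open>p\<close> (branches 1, 2),
  \<open>q\<close> (branches 1, 3) and \<open>r\<close> (branches 2, 3). If all three branches are directed upwards,
  branch 1 starting on the left and branch 3 on the right, then a branch with smaller number heads
  east where it meets one with larger number. Reversing a branch (orientation bits \<open>o1\<close>, \<open>o2\<close>,
  \<open>o3\<close>) reverses its word and exchanges East and North at its crossings. The move reverses the
  three words.
\<close>

definition side_of :: "bool \<Rightarrow> bool \<Rightarrow> side" where
  "side_of o1 o2 = (if o1 = o2 then East else North)"

definition directed :: "bool \<Rightarrow> 'b list \<Rightarrow> 'b list" where
  "directed b w = (if b then w else rev w)"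

definition triangle :: "bool \<Rightarrow> bool \<Rightarrow> bool \<Rightarrow> nat \<Rightarrow> nat \<Rightarrow> nat \<Rightarrow> passage list list" where
  "triangle o1 o2 o3 p q r =
     [directed o1 [(p, side_of o1 o2), (q, side_of o1 o3)],
      directed o2 [(p, opp (side_of o1 o2)), (r, side_of o2 o3)],
      directed o3 [(q, opp (side_of o1 o3)), (r, opp (side_of o2 o3))]]"

definition erase :: "nat set \<Rightarrow> passage list \<Rightarrow> passage list" where
  "erase N w = filter (\<lambda>p. fst p \<notin> N) w"

text \<open>
  \<open>rename\<close> and \<open>rotate\<close> only change the encoding of a diagram. \<open>R2\<close>, \<open>R3\<close>, \<open>VR1\<close>, \<open>VR2\<close>, \<open>VR3\<close>,
  \<open>M\<close>, \<open>OC\<close> are the moves in the usual sense, in all orientations. \<open>endpoint\<close> expresses that the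
  position of end points is immaterial: an end point may be pulled back through a virtual crossing.
\<close>

inductive move :: "'a diagram \<Rightarrow> 'a diagram \<Rightarrow> bool" where
  rename:
    "\<lbrakk>inj_on f (crossings D); opens D' = opens D; closeds D' = closeds D;
      \<forall>y. word D' y = map (map_prod f id) (word D y);
      \<forall>c\<in>crossings D. mark D' (f c) = mark D c\<rbrakk> \<Longrightarrow> move D D'"
| rotate:
    "\<lbrakk>c \<in> closeds D; word D c = u @ v\<rbrakk> \<Longrightarrow> move D (D\<lparr>word := (word D)(c := v @ u)\<rparr>)"
| R2:
    "\<lbrakk>local_move (bigon par s p q) [[], []] D D';
      {mark D p, mark D q} = {Positive, Negative}\<rbrakk> \<Longrightarrow> move D D'"
| R3:
    "\<lbrakk>F = triangle o1 o2 o3 p q r; local_move F (map rev F) D D';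
      i < 3; \<forall>x\<in>set (F ! i). over D x;
      j < 3; \<forall>x\<in>set (F ! j). under D x;
      \<not> virtual D p; \<not> virtual D q; \<not> virtual D r\<rbrakk> \<Longrightarrow> move D D'"
| VR1:
    "\<lbrakk>local_move [[(p, s), (p, opp s)]] [[]] D D'; virtual D p\<rbrakk> \<Longrightarrow> move D D'"
| VR2:
    "\<lbrakk>local_move (bigon par s p q) [[], []] D D'; virtual D p; virtual D q\<rbrakk> \<Longrightarrow> move D D'"
| VR3:
    "\<lbrakk>F = triangle o1 o2 o3 p q r; local_move F (map rev F) D D';
      virtual D p; virtual D q; virtual D r\<rbrakk> \<Longrightarrow> move D D'"
| M:
    "\<lbrakk>F = triangle o1 o2 o3 p q r; local_move F (map rev F) D D';
      i < 3; \<forall>x\<in>set (F ! i). virtual D (fst x);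
      c \<in> {p, q, r} - fst ` set (F ! i); \<not> virtual D c\<rbrakk> \<Longrightarrow> move D D'"
| OC:
    "\<lbrakk>F = triangle o1 o2 o3 p q r; local_move F (map rev F) D D';
      i < 3; \<forall>x\<in>set (F ! i). over D x;
      c \<in> {p, q, r} - fst ` set (F ! i); virtual D c\<rbrakk> \<Longrightarrow> move D D'"
| endpoint:
    "\<lbrakk>y \<in> opens D; (\<exists>w. word D y = w @ [(p, s)]) \<or> (\<exists>w. word D y = (p, s) # w); virtual D p;
      opens D' = opens D; closeds D' = closeds D;
      \<forall>y. word D' y = erase {p} (word D y);
      \<forall>c\<in>crossings D - {p}. mark D' c = mark D c\<rbrakk> \<Longrightarrow> move D D'"

definition equivalent :: "('a diagram \<times> 'a diagram) set" where
  "equivalent =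
     {(D, D'). is_diagram D \<and> is_diagram D' \<and> (move D D' \<or> move D' D)}\<^sup>*"

definition tangle_of :: "'a diagram \<Rightarrow> 'a diagram set" where
  "tangle_of D = equivalent `` {D}"

section \<open>W-tangles and their operations\<close>

definition wtangles_cl :: "'a set \<Rightarrow> 'a set \<Rightarrow> 'a diagram set set" where
  "wtangles_cl X C = {D. is_diagram D \<and> opens D = X \<and> closeds D = C} // equivalent"

definition wtangles :: "'a set \<Rightarrow> 'a diagram set set" where
  "wtangles Y = wtangles_cl Y {}"

text \<open>\<open>crossing_diagram m a b\<close> with \<open>m\<close> positive or negative is the crossing of sign \<open>m\<close> with
  strand \<open>a\<close> over strand \<open>b\<close>.\<close>

definition crossing_diagram :: "mark \<Rightarrow> 'a \<Rightarrow> 'a \<Rightarrow> 'a diagram" where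
  "crossing_diagram m a b =
     (let s = (if m = Positive then East else North) in
      \<lparr>opens = {a, b}, closeds = {},
       word = (\<lambda>_. [])(a := [(0, s)], b := [(0, opp s)]),
       mark = (\<lambda>_. Virtual)(0 := m)\<rparr>)"

definition add_strand :: "'a \<Rightarrow> 'a diagram \<Rightarrow> 'a diagram" where
  "add_strand x D = D\<lparr>opens := insert x (opens D)\<rparr>"

definition relabel :: "'a \<Rightarrow> 'a \<Rightarrow> 'a diagram \<Rightarrow> 'a diagram" where
  "relabel x z D = D\<lparr>opens := insert z (opens D - {x}), word := (word D)(x := [], z := word D x)\<rparr>"

text \<open>To be used for diagrams with disjoint label sets and disjoint sets of crossings.\<close>

definition juxtapose :: "'a diagram \<Rightarrow> 'a diagram \<Rightarrow> 'a diagram" where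
  "juxtapose D E =
     \<lparr>opens = opens D \<union> opens E, closeds = closeds D \<union> closeds E,
      word = (\<lambda>y. if y \<in> labels D then word D y else word E y),
      mark = (\<lambda>c. if c \<in> crossings D then mark D c else mark E c)\<rparr>"

text \<open>
  In stitching and closing, the new arcs (the subwords \<open>v\<close>) may be drawn in many ways, so these
  operations are relations between diagrams. All new double points are virtual and lie on the new
  arcs; erasing them gives back the old diagram.
\<close>

definition new_crossings :: "'a diagram \<Rightarrow> 'a diagram \<Rightarrow> nat set" where
  "new_crossings D D' = crossings D' - crossings D"

definition only_virtual_new :: "'a diagram \<Rightarrow> 'a diagram \<Rightarrow> bool" where
  "only_virtual_new D D' \<longleftrightarrow>
     (\<forall>c\<in>crossings D. mark D' c = mark D c) \<and> (\<forall>c\<in>new_crossings D D'. virtual D' c)"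

definition stitch_diagram :: "'a \<Rightarrow> 'a \<Rightarrow> 'a \<Rightarrow> 'a diagram \<Rightarrow> 'a diagram \<Rightarrow> bool" where
  "stitch_diagram x y z D D' \<longleftrightarrow>
     (let N = new_crossings D D' in
      opens D' = insert z (opens D - {x, y}) \<and> closeds D' = closeds D \<and> only_virtual_new D D' \<and>
      (\<exists>u v w. word D' z = u @ v @ w \<and> erase N u = word D x \<and> erase N w = word D y \<and>
               fst ` set v = N) \<and>
      (\<forall>s\<in>labels D - {x, y}. erase N (word D' s) = word D s))"

definition close_diagram :: "'a list \<Rightarrow> 'a diagram \<Rightarrow> 'a diagram \<Rightarrow> bool" where
  "close_diagram cs D D' \<longleftrightarrow>
     (let N = new_crossings D D' in
      opens D' = opens D - set cs \<and> closeds D' = closeds D \<union> set cs \<and> only_virtual_new D D' \<and>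
      (\<exists>u v. (\<forall>c\<in>set cs. word D' c = u c @ v c \<and> erase N (u c) = word D c) \<and>
             (\<Union>c\<in>set cs. fst ` set (v c)) = N) \<and>
      (\<forall>s\<in>labels D - set cs. erase N (word D' s) = word D s))"

text \<open>
  The graphs of the operations on w-tangles: \<open>is_stitch x y z T T'\<close> means that \<open>T'\<close> is the result
  of connecting the head of \<open>x\<close> to the tail of \<open>y\<close> in \<open>T\<close> and calling the result \<open>z\<close>, and
  \<open>is_trace cs T U\<close> means that \<open>U\<close> is the trivial closure of the components \<open>cs\<close> of \<open>T\<close>.
\<close>

definition is_stitch :: "'a \<Rightarrow> 'a \<Rightarrow> 'a \<Rightarrow> 'a diagram set \<Rightarrow> 'a diagram set \<Rightarrow> bool" where
  "is_stitch x y z T T' \<longleftrightarrow> (\<exists>D\<in>T. \<exists>D'\<in>T'. stitch_diagram x y z D D')"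

definition is_union :: "'a diagram set \<Rightarrow> 'a diagram set \<Rightarrow> 'a diagram set \<Rightarrow> bool" where
  "is_union S T U \<longleftrightarrow> (\<exists>D\<in>S. \<exists>E\<in>T. crossings D \<inter> crossings E = {} \<and> juxtapose D E \<in> U)"

definition is_trace :: "'a list \<Rightarrow> 'a diagram set \<Rightarrow> 'a diagram set \<Rightarrow> bool" where
  "is_trace cs T U \<longleftrightarrow> (\<exists>D\<in>T. \<exists>C\<in>U. close_diagram cs D C)"

section \<open>Rational functions in the variables t\<close>

text \<open>Finitely supported exponent vectors carry the coefficients. The linear order on the labels is
  only needed for the library's proof that these polynomials form an integral domain.\<close>

type_synonym 'a mpoly = "('a \<Rightarrow>\<^sub>0 nat) \<Rightarrow>\<^sub>0 rat"

type_synonym 'a ratfun = "'a mpoly fract"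

definition var :: "'a \<Rightarrow> 'a mpoly" where
  "var i = Poly_Mapping.single (Poly_Mapping.single i 1) 1"

definition tvar :: "'a::linorder \<Rightarrow> 'a ratfun" where
  "tvar i = Fraction_Field.Fract (var i) 1"

definition vars :: "'a mpoly \<Rightarrow> 'a set" where
  "vars p = (\<Union>m\<in>Poly_Mapping.keys p. Poly_Mapping.keys m)"

definition ratfuns :: "'a::linorder set \<Rightarrow> 'a ratfun set" where
  "ratfuns Y = {f. \<exists>p q. q \<noteq> 0 \<and> f = Fraction_Field.Fract p q \<and> vars p \<subseteq> Y \<and> vars q \<subseteq> Y}"

definition poly_subst :: "('a \<Rightarrow> 'a mpoly) \<Rightarrow> 'a mpoly \<Rightarrow> 'a mpoly" where
  "poly_subst \<sigma> p =
     (\<Sum>m\<in>Poly_Mapping.keys p. Poly_Mapping.single 0 (Poly_Mapping.lookup p m) *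
        (\<Prod>i\<in>Poly_Mapping.keys m. \<sigma> i ^ Poly_Mapping.lookup m i))"

text \<open>Substitution into a rational function is partial: \<open>subst_to \<sigma> f g\<close> means that it is defined
  for \<open>f\<close>, i.e. that \<open>f\<close> is a quotient whose denominator does not become zero, with value \<open>g\<close>.\<close>

definition subst_to :: "('a::linorder \<Rightarrow> 'a mpoly) \<Rightarrow> 'a ratfun \<Rightarrow> 'a ratfun \<Rightarrow> bool" where
  "subst_to \<sigma> f g \<longleftrightarrow>
     (\<exists>p q. poly_subst \<sigma> q \<noteq> 0 \<and> f = Fraction_Field.Fract p q \<and>
            g = Fraction_Field.Fract (poly_subst \<sigma> p) (poly_subst \<sigma> q))"

section \<open>Gamma calculus\<close>

text \<open>In \<open>(\<omega>, M)\<close>, the entry of \<open>M\<close> in row \<open>y\<^sub>i\<close> and column \<open>x\<^sub>j\<close> is \<open>M i j\<close>; it is zero if one of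
  \<open>i\<close>, \<open>j\<close> is not a label.\<close>

type_synonym 'a gamma = "'a ratfun \<times> ('a \<Rightarrow> 'a \<Rightarrow> 'a ratfun)"

definition gammas :: "'a::linorder set \<Rightarrow> 'a gamma set" where
  "gammas Y = {(\<omega>, M).
     \<omega> \<in> ratfuns Y \<and>
     (\<forall>i\<in>Y. \<forall>j\<in>Y. M i j \<in> ratfuns Y \<and> subst_to (\<lambda>_. 1) (M i j) (if i = j then 1 else 0)) \<and>
     (\<forall>i j. i \<notin> Y \<or> j \<notin> Y \<longrightarrow> M i j = 0)}"

definition gamma_crossing :: "mark \<Rightarrow> 'a::linorder \<Rightarrow> 'a \<Rightarrow> 'a gamma" where
  "gamma_crossing m a b =
     (let t = (if m = Positive then tvar a else inverse (tvar a)) in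
      (1, \<lambda>i j. if (i, j) = (a, a) then 1
                else if (i, j) = (a, b) then 1 - t
                else if (i, j) = (b, b) then t
                else 0))"

definition gamma_add :: "'a::linorder \<Rightarrow> 'a gamma \<Rightarrow> 'a gamma" where
  "gamma_add a = (\<lambda>(\<omega>, M). (\<omega>, \<lambda>i j. if i = a \<and> j = a then 1 else M i j))"

definition gamma_union :: "'a::linorder gamma \<Rightarrow> 'a gamma \<Rightarrow> 'a gamma" where
  "gamma_union = (\<lambda>(\<omega>\<^sub>1, M\<^sub>1) (\<omega>\<^sub>2, M\<^sub>2). (\<omega>\<^sub>1 * \<omega>\<^sub>2, \<lambda>i j. M\<^sub>1 i j + M\<^sub>2 i j))"

definition is_gamma_relabel :: "'a::linorder set \<Rightarrow> 'a \<Rightarrow> 'a \<Rightarrow> 'a gamma \<Rightarrow> 'a gamma \<Rightarrow> bool" where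
  "is_gamma_relabel Y a b = (\<lambda>(\<omega>, M) (\<omega>', M').
     (let \<sigma> = var(a := var b); \<rho> = id(a := b) in
      subst_to \<sigma> \<omega> \<omega>' \<and>
      (\<forall>i\<in>Y. \<forall>j\<in>Y. subst_to \<sigma> (M i j) (M' (\<rho> i) (\<rho> j))) \<and>
      (\<forall>i j. i \<notin> \<rho> ` Y \<or> j \<notin> \<rho> ` Y \<longrightarrow> M' i j = 0)))"

text \<open>
  The matrix before the substitution has the entries
  \<open>\<beta> + \<alpha>\<delta>/(1-\<gamma>)\<close>, \<open>\<theta> + \<alpha>\<epsilon>/(1-\<gamma>)\<close>, \<open>\<psi> + \<phi>\<delta>/(1-\<gamma>)\<close>, \<open>\<Xi> + \<phi>\<epsilon>/(1-\<gamma>)\<close>.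
  These are instances of one formula when \<open>row\<close> and \<open>col\<close> send \<open>c\<close> to \<open>a\<close> and \<open>b\<close>.
\<close>

definition is_gamma_stitch :: "'a::linorder set \<Rightarrow> 'a \<Rightarrow> 'a \<Rightarrow> 'a \<Rightarrow> 'a gamma \<Rightarrow> 'a gamma \<Rightarrow> bool" where
  "is_gamma_stitch Y a b c = (\<lambda>(\<omega>, M) (\<omega>', M').
     (let Y' = insert c (Y - {a, b}); \<sigma> = var(a := var c, b := var c);
          row = id(c := a); col = id(c := b) in
      subst_to \<sigma> ((1 - M b a) * \<omega>) \<omega>' \<and>
      (\<forall>i\<in>Y'. \<forall>j\<in>Y'.
         subst_to \<sigma> (M (row i) (col j) + M (row i) a * M b (col j) / (1 - M b a)) (M' i j)) \<and>
      (\<forall>i j. i \<notin> Y' \<or> j \<notin> Y' \<longrightarrow> M' i j = 0)))"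

text \<open>\<open>\<omega> det (I - \<alpha>)\<close> where \<open>\<alpha>\<close> is the block of \<open>M\<close> with rows and columns \<open>cs\<close>.\<close>

definition closure_value :: "'a::linorder list \<Rightarrow> 'a gamma \<Rightarrow> 'a ratfun" where
  "closure_value cs = (\<lambda>(\<omega>, M).
     (let n = length cs; \<alpha> = mat n n (\<lambda>(i, j). M (cs ! i) (cs ! j)) in
      \<omega> * det (1\<^sub>m n - \<alpha>)))"

text \<open>The properties that determine the invariant. The class \<open>infinite\<close> provides enough labels to build
  every w-tangle from crossings and trivial strands.\<close>

definition gamma_invariant :: "('a::{linorder,infinite} diagram set \<Rightarrow> 'a gamma) \<Rightarrow> bool" where
  "gamma_invariant \<phi> \<longleftrightarrow>
     (\<forall>Y. finite Y \<longrightarrow> (\<forall>T\<in>wtangles Y. \<phi> T \<in> gammas Y)) \<and>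
     (\<forall>a b. \<forall>m\<in>{Positive, Negative}. a \<noteq> b \<longrightarrow>
        \<phi> (tangle_of (crossing_diagram m a b)) = gamma_crossing m a b) \<and>
     (\<forall>x D. is_diagram D \<longrightarrow> closeds D = {} \<longrightarrow> x \<notin> opens D \<longrightarrow>
        \<phi> (tangle_of (add_strand x D)) = gamma_add x (\<phi> (tangle_of D))) \<and>
     (\<forall>Y Z. \<forall>S\<in>wtangles Y. \<forall>T\<in>wtangles Z. \<forall>U\<in>wtangles (Y \<union> Z).
        Y \<inter> Z = {} \<longrightarrow> is_union S T U \<longrightarrow> \<phi> U = gamma_union (\<phi> S) (\<phi> T)) \<and>
     (\<forall>x z D. is_diagram D \<longrightarrow> closeds D = {} \<longrightarrow> x \<in> opens D \<longrightarrow> z \<notin> opens D - {x} \<longrightarrow>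
        is_gamma_relabel (opens D) x z (\<phi> (tangle_of D)) (\<phi> (tangle_of (relabel x z D)))) \<and>
     (\<forall>Y x y z. \<forall>T\<in>wtangles Y. \<forall>T'\<in>wtangles (insert z (Y - {x, y})).
        x \<in> Y \<longrightarrow> y \<in> Y \<longrightarrow> x \<noteq> y \<longrightarrow> z \<notin> Y - {x, y} \<longrightarrow> is_stitch x y z T T' \<longrightarrow>
        is_gamma_stitch Y x y z (\<phi> T) (\<phi> T'))"

end

theory Submission
  imports Defs
begin

text \<open>
  Put the crossing matrices of all real crossings of a diagram into one matrix \<open>K\<close>, and let \<open>S\<close> say
  which passage follows which one. Repeated stitching is Gaussian elimination in \<open>I - K S\<close>: by Schur
  complements, \<open>\<omega> det (I - M Z)\<close> is \<open>det (I - K S')\<close>, where \<open>S'\<close> also connects heads with tails as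
  prescribed by \<open>Z\<close>. To apply this to \<open>\<phi>\<close>, a plane diagram is cut into single crossings; planarity
  survives, since removing an edge cannot lower the Euler characteristic and this is at most that of
  a plane graph. For \<open>Z\<close> the identity on \<open>cs\<close> the determinant depends on the closed diagram only. As
  virtual passages do not enter it, only R2, R3 and OC have to be checked, and there both sides have
  the same matrix after the passages inside the move are stitched together.
\<close>

section \<open>Determinants of closed tangles\<close>

text \<open>The hypothesis relates the closed tangles only: T and T' themselves need not be
  connected by moves. So the value has to be recognised as a function of the closed diagram, and det
  (I - K S') is one, since it does not depend on where a closed component was cut open. About \<phi>
  nothing is known except its behaviour under the operations, and these concern classes of plane
  diagrams; hence every intermediate diagram of the cutting must be shown planar before a property
  of \<phi> may be used. Cutting a strand introduces a second variable, so the determinants before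
  and after a cut agree only once the two variables are identified; the comparison therefore runs
  through the partial substitution \<open>subst_to\<close>, whose values are unique. The pivots 1 -
  \<gamma> do not vanish because M becomes the identity at t = 1. Finally, Z must be arbitrary in
  the induction, although only the identity on cs matters at the end: cutting a strand that Z closes
  up changes Z.\<close>

definition fdet :: "'n set \<Rightarrow> ('n \<Rightarrow> 'n \<Rightarrow> 'f::comm_ring_1) \<Rightarrow> 'f" where
  "fdet V N = (let xs = (SOME xs. set xs = V \<and> distinct xs); n = length xs
               in det (mat n n (\<lambda>(i, j). N (xs ! i) (xs ! j))))"

text \<open>Two enumerations of the same set differ by a permutation that acts on rows and columns
  alike, so its sign enters twice and cancels. This makes the choice in \<open>fdet\<close>
  immaterial.\<close>

lemma det_reindex_eq:
  assumes "distinct xs" "distinct ys" "set xs = set ys"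
  shows "det (mat (length xs) (length xs) (\<lambda>(i, j). N (xs ! i) (xs ! j))) =
         det (mat (length ys) (length ys) (\<lambda>(i, j). (N (ys ! i) (ys ! j) :: 'f::comm_ring_1)))"
proof -
  let ?n = "length xs"
  have len: "length ys = ?n"
    using assms by (metis distinct_card)
  have "mset xs = mset ys"
    using assms by (simp add: set_eq_iff_mset_eq_distinct)
  then obtain \<pi> where \<pi>: "\<pi> permutes {..<length ys}" "permute_list \<pi> ys = xs"
    using mset_eq_permutation by metis
  have perm: "\<pi> permutes {0..<?n}"
    using \<pi>(1) len by (simp add: atLeast0LessThan)
  have nth: "xs ! i = ys ! \<pi> i" if "i < ?n" for i
    using permute_list_nth[OF \<pi>(1), of i] \<pi>(2) that len by simp
  have lt: "\<pi> i < ?n" if "i < ?n" for i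
    using permutes_in_image[OF perm, of i] that by simp
  define A where "A = mat ?n ?n (\<lambda>(i, j). N (ys ! i) (ys ! j))"
  define B where "B = mat ?n ?n (\<lambda>(i, j). A $$ (\<pi> i, j))"
  have A: "A \<in> carrier_mat ?n ?n" and B: "B \<in> carrier_mat ?n ?n"
    by (simp_all add: A_def B_def)
  have "mat ?n ?n (\<lambda>(i, j). N (xs ! i) (xs ! j)) = (mat ?n ?n (\<lambda>(i, j). (B\<^sup>T) $$ (\<pi> i, j)))\<^sup>T"
    by (rule eq_matI) (auto simp: A_def B_def nth lt)
  then have "det (mat ?n ?n (\<lambda>(i, j). N (xs ! i) (xs ! j))) = signof \<pi> * det B"
    using det_permute_rows[OF _ perm, of "B\<^sup>T"] B det_transpose[OF B]
    by (simp add: det_transpose[of _ ?n])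
  also have "\<dots> = signof \<pi> * (signof \<pi> * det A)"
    unfolding B_def by (subst det_permute_rows[OF A perm]) simp
  also have "\<dots> = det A"
    by (simp add: sign_def)
  finally show ?thesis
    by (simp add: A_def len)
qed

lemma fdet_list:
  assumes "distinct xs" "set xs = V" "length xs = n"
  shows "fdet V N = det (mat n n (\<lambda>(i, j). N (xs ! i) (xs ! j)))"
proof -
  define ys where "ys = (SOME ys. set ys = V \<and> distinct ys)"
  have "set ys = V \<and> distinct ys"
    unfolding ys_def by (rule someI[of _ xs]) (use assms in auto)
  then show ?thesis
    unfolding fdet_def Let_def ys_def[symmetric]
    using det_reindex_eq[of ys xs N] assms by auto
qed

lemma fdet_empty [simp]: "fdet {} N = 1"
  by (simp add: fdet_list[of "[]" "{}" 0])

lemma fdet_cong: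
  assumes "finite V" "\<And>i j. i \<in> V \<Longrightarrow> j \<in> V \<Longrightarrow> N i j = N' i j"
  shows "fdet V N = fdet V N'"
proof -
  obtain xs where xs: "set xs = V" "distinct xs"
    using assms(1) finite_distinct_list by blast
  show ?thesis
    unfolding fdet_list[OF xs(2,1) refl]
    by (rule arg_cong[of _ _ det], rule eq_matI) (use assms xs in auto)
qed

lemma fdet_image:
  assumes "finite V" "inj_on g V"
  shows "fdet (g ` V) N = fdet V (\<lambda>i j. N (g i) (g j))"
proof -
  obtain xs where xs: "set xs = V" "distinct xs"
    using assms(1) finite_distinct_list by blast
  have "distinct (map g xs)" "set (map g xs) = g ` V"
    using xs assms by (auto simp: distinct_map)
  then show ?thesis
    unfolding fdet_list[OF xs(2,1) refl] fdet_list[OF \<open>distinct (map g xs)\<close> _ refl, of "g ` V"]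
    by (subst fdet_list[of "map g xs" _ "length xs"])
       (auto intro!: arg_cong[of _ _ det] eq_matI)
qed

text \<open>With \<open>b\<close> listed first, the matrix is a unipotent lower block triangular
  matrix times an upper block triangular one whose diagonal blocks are \<open>N b b\<close> and the
  Schur complement. Stitching, the deletion of trivial nodes and the final reduction to the closed
  labels all rest on this step.\<close>

lemma fdet_schur:
  fixes N :: "'n \<Rightarrow> 'n \<Rightarrow> 'f::field"
  assumes "finite V" "b \<in> V" "N b b \<noteq> 0"
  shows "fdet V N = N b b * fdet (V - {b}) (\<lambda>i j. N i j - N i b * N b j / N b b)"
proof -
  obtain ys where ys: "set ys = V - {b}" "distinct ys"
    using assms(1) finite_distinct_list[of "V - {b}"] by auto
  let ?n = "length ys"
  define c where "c = mat ?n 1 (\<lambda>(i, _). N (ys ! i) b / N b b)"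
  define r where "r = mat 1 ?n (\<lambda>(_, j). N b (ys ! j))"
  define p where "p = mat 1 1 (\<lambda>_. N b b)"
  define A where "A = mat ?n ?n (\<lambda>(i, j). N (ys ! i) (ys ! j) - N (ys ! i) b * N b (ys ! j) / N b b)"
  define L where "L = four_block_mat (1\<^sub>m 1) (0\<^sub>m 1 ?n) c (1\<^sub>m ?n)"
  define R where "R = four_block_mat p r (0\<^sub>m ?n 1) A"
  have carr: "c \<in> carrier_mat ?n 1" "r \<in> carrier_mat 1 ?n" "p \<in> carrier_mat 1 1"
      "A \<in> carrier_mat ?n ?n"
    by (simp_all add: c_def r_def p_def A_def)
  have "mat (Suc ?n) (Suc ?n) (\<lambda>(i, j). N ((b # ys) ! i) ((b # ys) ! j)) =
        four_block_mat p r (c * p) (c * r + A)"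
    by (rule eq_matI)
       (use assms in \<open>auto simp: c_def r_def p_def A_def scalar_prod_def nth_Cons split: nat.splits\<close>)
  also have "\<dots> = L * R"
    unfolding L_def R_def
    by (subst mult_four_block_mat[of _ 1 1 _ ?n _ ?n _ _ 1 _ ?n]) (use carr in auto)
  finally have "fdet V N = det (L * R)"
    using ys assms(2) by (subst fdet_list[of "b # ys" V "Suc ?n"]) auto
  also have "\<dots> = det L * det R"
    by (rule det_mult[of _ "1 + ?n"]) (use carr in \<open>auto simp: L_def R_def\<close>)
  also have "det L = 1"
    unfolding L_def by (subst det_four_block_mat_upper_right_zero[of _ 1 _ ?n]) (use carr in auto)
  also have "det R = det p * det A"
    unfolding R_def by (rule det_four_block_mat_lower_left_zero_col) (use carr in auto)
  also have "det p = N b b"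
    by (simp add: p_def det_single)
  also have "det A = fdet (V - {b}) (\<lambda>i j. N i j - N i b * N b j / N b b)"
    unfolding A_def fdet_list[OF ys(2,1) refl] ..
  finally show ?thesis by simp
qed

text \<open>\<open>K\<close> is the matrix of a tangle, \<open>S k j\<close> the weight with which head \<open>k\<close> is joined to tail \<open>j\<close>.\<close>

definition closing_det :: "'n set \<Rightarrow> ('n \<Rightarrow> 'n \<Rightarrow> 'f::field) \<Rightarrow> ('n \<Rightarrow> 'n \<Rightarrow> 'f) \<Rightarrow> 'f" where
  "closing_det V K S = fdet V (\<lambda>i j. of_bool (i = j) - (\<Sum>k\<in>V. K i k * S k j))"

lemma closing_det_cong:
  assumes "finite V"
    and "\<And>i j. i \<in> V \<Longrightarrow> j \<in> V \<Longrightarrow> K i j = K' i j"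
    and "\<And>i j. i \<in> V \<Longrightarrow> j \<in> V \<Longrightarrow> S i j = S' i j"
  shows "closing_det V K S = closing_det V K' S'"
  unfolding closing_det_def by (rule fdet_cong) (use assms in \<open>auto intro!: sum.cong\<close>)

lemma closing_det_image:
  assumes "finite V" "inj_on g V"
  shows "closing_det (g ` V) K S = closing_det V (\<lambda>i j. K (g i) (g j)) (\<lambda>i j. S (g i) (g j))"
  unfolding closing_det_def fdet_image[OF assms]
  by (rule fdet_cong) (use assms in \<open>auto simp: sum.reindex inj_on_eq_iff\<close>)

text \<open>Row \<open>b\<close> (the tail) and column \<open>a\<close> (the head) disappear, so the
  joined strand has row \<open>a\<close> and column \<open>b\<close> of \<open>K\<close>; it is
  named \<open>a\<close>, whence the renaming of columns. The pivot is 1 - \<gamma> with \<gamma> =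
  \<open>K b a\<close>, and the Schur complement is exactly the stitching formula of
  Gamma-calculus.\<close>

lemma closing_det_stitch:
  fixes K :: "'n \<Rightarrow> 'n \<Rightarrow> 'f::field"
  assumes "finite V" "a \<in> V" "b \<in> V" "a \<noteq> b"
    and "S a b = 1" "\<And>j. j \<in> V \<Longrightarrow> j \<noteq> b \<Longrightarrow> S a j = 0" "\<And>i. i \<in> V \<Longrightarrow> i \<noteq> a \<Longrightarrow> S i b = 0"
    and "K b a \<noteq> 1"
  shows "closing_det V K S = (1 - K b a) *
    closing_det (V - {b}) (\<lambda>i j. K i ((id(a := b)) j) + K i a * K b ((id(a := b)) j) / (1 - K b a))
                          (\<lambda>i j. S ((id(a := b)) i) j)"
proof -
  let ?c = "id(a := b)"
  let ?N = "\<lambda>i j. of_bool (i = j) - (\<Sum>k\<in>V. K i k * S k j)"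
  have col: "?N i b = of_bool (i = b) - K i a" for i
  proof -
    have "(\<Sum>k\<in>V. K i k * S k b) = (\<Sum>k\<in>{a}. K i k * S k b)"
      by (rule sum.mono_neutral_right) (use assms in auto)
    then show ?thesis using assms by simp
  qed
  \<comment> \<open>Head \<open>a\<close> is joined to \<open>b\<close> alone, so its column drops
    out. The remaining heads \<open>V - {a}\<close> are listed as an image of
    \<open>V - {b}\<close>, with \<open>b\<close> as the image of \<open>a\<close>.\<close>
  have row: "(\<Sum>k\<in>V. K i k * S k j) = (\<Sum>k\<in>V - {b}. K i (?c k) * S (?c k) j)"
    if "j \<in> V - {b}" for i j
  proof -
    have "(\<Sum>k\<in>V. K i k * S k j) = (\<Sum>k\<in>V - {a}. K i k * S k j)"
      by (rule sum.mono_neutral_right) (use assms that in auto)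
    also have "\<dots> = (\<Sum>k\<in>?c ` (V - {b}). K i k * S k j)"
      by (rule sum.cong) (use assms in \<open>auto simp: image_def\<close>)
    also have "\<dots> = (\<Sum>k\<in>V - {b}. K i (?c k) * S (?c k) j)"
      by (rule sum.reindex_cong[of ?c]) (auto simp: inj_on_def)
    finally show ?thesis .
  qed
  have nz: "?N b b \<noteq> 0" using col assms by simp
  have "fdet V ?N = ?N b b * fdet (V - {b}) (\<lambda>i j. ?N i j - ?N i b * ?N b j / ?N b b)"
    by (rule fdet_schur) (use assms nz in auto)
  also have "fdet (V - {b}) (\<lambda>i j. ?N i j - ?N i b * ?N b j / ?N b b) = fdet (V - {b})
      (\<lambda>i j. of_bool (i = j) -
         (\<Sum>k\<in>V - {b}. (K i (?c k) + K i a * K b (?c k) / (1 - K b a)) * S (?c k) j))"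
    (is "fdet _ ?L = fdet _ ?R")
  proof (rule fdet_cong)
    fix i j assume ij: "i \<in> V - {b}" "j \<in> V - {b}"
    have "(\<Sum>k\<in>V - {b}. (K i (?c k) + K i a * K b (?c k) / (1 - K b a)) * S (?c k) j) =
      (\<Sum>k\<in>V - {b}. K i (?c k) * S (?c k) j) +
       K i a / (1 - K b a) * (\<Sum>k\<in>V - {b}. K b (?c k) * S (?c k) j)"
      by (simp add: sum.distrib sum_distrib_left sum_negf algebra_simps del: id_apply fun_upd_apply)
    then show "?L i j = ?R i j"
      unfolding col row[OF ij(2)] using ij by (auto simp: algebra_simps)
  qed (use assms in auto)
  finally show ?thesis
    unfolding closing_det_def col by simp
qed

text \<open>Strand \<open>b\<close> is trivial, so whatever is joined to its tail passes on to
  whatever its head is joined to. As \<open>b\<close> is not closed on itself, the pivot is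
  1.\<close>

lemma closing_det_eliminate:
  fixes K :: "'n \<Rightarrow> 'n \<Rightarrow> 'f::field"
  assumes "finite V" "b \<in> V" "K b b = 1" "S b b = 0"
    and "\<And>j. j \<in> V \<Longrightarrow> j \<noteq> b \<Longrightarrow> K b j = 0" "\<And>i. i \<in> V \<Longrightarrow> i \<noteq> b \<Longrightarrow> K i b = 0"
  shows "closing_det V K S = closing_det (V - {b}) K (\<lambda>i j. S i j + S i b * S b j)"
proof -
  let ?N = "\<lambda>i j. of_bool (i = j) - (\<Sum>k\<in>V. K i k * S k j)"
  have row: "(\<Sum>k\<in>V. K b k * S k j) = S b j" for j
  proof -
    have "(\<Sum>k\<in>V. K b k * S k j) = (\<Sum>k\<in>{b}. K b k * S k j)"
      by (rule sum.mono_neutral_right) (use assms in auto)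
    then show ?thesis using assms by simp
  qed
  have inner: "(\<Sum>k\<in>V. K i k * S k j) = (\<Sum>k\<in>V - {b}. K i k * S k j)" if "i \<in> V - {b}" for i j
    by (rule sum.mono_neutral_right) (use assms that in auto)
  have "fdet V ?N = ?N b b * fdet (V - {b}) (\<lambda>i j. ?N i j - ?N i b * ?N b j / ?N b b)"
    by (rule fdet_schur) (use assms row in auto)
  also have "?N b b = 1" using row assms by simp
  also have "fdet (V - {b}) (\<lambda>i j. ?N i j - ?N i b * ?N b j / 1) =
      fdet (V - {b}) (\<lambda>i j. of_bool (i = j) - (\<Sum>k\<in>V - {b}. K i k * (S k j + S k b * S b j)))"
    by (rule fdet_cong)
       (use assms in \<open>auto simp: row inner sum.distrib sum_distrib_left sum_negf algebra_simps\<close>)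
  finally show ?thesis
    unfolding closing_det_def by simp
qed

section \<open>Words of nodes\<close>

definition pairs :: "'n list \<Rightarrow> ('n \<times> 'n) set" where
  "pairs xs = set (zip xs (tl xs))"

definition nodes :: "'y set \<Rightarrow> ('y \<Rightarrow> 'n list) \<Rightarrow> 'n set" where
  "nodes Y L = (\<Union>y\<in>Y. set (L y))"

text \<open>\<open>(y, y') \<in> Z\<close> means that the head of word \<open>y\<close> is joined to the tail of word \<open>y'\<close>.\<close>

definition joints :: "'y set \<Rightarrow> ('y \<Rightarrow> 'n list) \<Rightarrow> ('y \<times> 'y) set \<Rightarrow> ('n \<times> 'n) set" where
  "joints Y L Z = (\<Union>y\<in>Y. pairs (L y)) \<union> {(last (L y), hd (L y')) |y y'. y \<in> Y \<and> y' \<in> Y \<and> (y, y') \<in> Z}"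

text \<open>The matrix \<open>K\<close> is a free parameter and not tied to a diagram, because
  stitching shortens the words at the price of changing \<open>K\<close>.\<close>

definition word_det :: "'y set \<Rightarrow> ('y \<Rightarrow> 'n list) \<Rightarrow> ('y \<times> 'y) set \<Rightarrow> ('n \<Rightarrow> 'n \<Rightarrow> 'f::field) \<Rightarrow> 'f" where
  "word_det Y L Z K = closing_det (nodes Y L) K (\<lambda>i j. of_bool ((i, j) \<in> joints Y L Z))"

text \<open>Nonempty words give \<open>hd\<close> and \<open>last\<close> in \<open>joints\<close> a
  meaning; distinctness and disjointness make the consecutive pairs a partial injection on the
  nodes.\<close>

definition strands :: "'y set \<Rightarrow> ('y \<Rightarrow> 'n list) \<Rightarrow> bool" where
  "strands Y L \<longleftrightarrow> finite Y \<and> (\<forall>y\<in>Y. L y \<noteq> [] \<and> distinct (L y)) \<and>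
     (\<forall>y\<in>Y. \<forall>y'\<in>Y. y \<noteq> y' \<longrightarrow> set (L y) \<inter> set (L y') = {})"

lemma pairs_simps [simp]:
  "pairs [] = {}" "pairs [a] = {}" "pairs (a # b # xs) = insert (a, b) (pairs (b # xs))"
  by (simp_all add: pairs_def)

lemma pairs_Cons: "pairs (a # xs) = (if xs = [] then {} else insert (a, hd xs) (pairs xs))"
  by (cases xs) auto

lemma pairs_append:
  "pairs (xs @ ys) = pairs xs \<union> pairs ys \<union> (if xs = [] \<or> ys = [] then {} else {(last xs, hd ys)})"
  by (induction xs) (auto simp: pairs_Cons)

lemma pairs_subset: "(a, b) \<in> pairs xs \<Longrightarrow> a \<in> set xs \<and> b \<in> set xs"
  by (induction xs) (auto simp: pairs_Cons split: if_splits)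

lemma pairs_split: "(a, b) \<in> pairs xs \<longleftrightarrow> (\<exists>u v. xs = u @ [a, b] @ v)"
proof
  assume "(a, b) \<in> pairs xs"
  then show "\<exists>u v. xs = u @ [a, b] @ v"
  proof (induction xs)
    case (Cons x xs)
    then consider "xs \<noteq> []" "a = x" "b = hd xs" | "(a, b) \<in> pairs xs"
      by (auto simp: pairs_Cons split: if_splits)
    then show ?case
    proof cases
      case 1
      then have "x # xs = [] @ [a, b] @ tl xs" by simp
      then show ?thesis by blast
    next
      case 2
      with Cons.IH obtain u v where "xs = u @ [a, b] @ v" by blast
      then have "x # xs = (x # u) @ [a, b] @ v" by simp
      then show ?thesis by blast
    qed
  qed simp
qed (auto simp: pairs_append)

lemma pairs_hd_last:
  assumes "distinct xs" "(a, b) \<in> pairs xs"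
  shows "a \<noteq> last xs" "b \<noteq> hd xs"
  using assms by (auto simp: pairs_split hd_append split: if_splits)

lemma pairs_functional:
  assumes "distinct xs" "(a, b) \<in> pairs xs"
  shows "(a, c) \<in> pairs xs \<Longrightarrow> c = b" "(c, b) \<in> pairs xs \<Longrightarrow> c = a"
  using assms
  by (induction xs) (auto simp: pairs_Cons split: if_splits dest: pairs_subset pairs_hd_last)

lemma pairs_map: "pairs (map g xs) = map_prod g g ` pairs xs"
  by (induction xs) (auto simp: pairs_Cons hd_map)

lemma finite_nodes: "strands Y L \<Longrightarrow> finite (nodes Y L)"
  by (auto simp: strands_def nodes_def)

lemma strands_unique:
  "strands Y L \<Longrightarrow> y \<in> Y \<Longrightarrow> y' \<in> Y \<Longrightarrow> a \<in> set (L y) \<Longrightarrow> a \<in> set (L y') \<Longrightarrow> y = y'"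
  unfolding strands_def by blast

lemma strandsD:
  assumes "strands Y L" "y \<in> Y"
  shows "L y \<noteq> []" "distinct (L y)" "hd (L y) \<in> set (L y)" "last (L y) \<in> set (L y)"
  using assms by (auto simp: strands_def)

text \<open>Inside a word, \<open>a\<close> is not the last node and \<open>b\<close> is not the
  first one, so no joint coming from \<open>Z\<close> leaves \<open>a\<close> or enters
  \<open>b\<close>. This yields the zero pattern of \<open>S\<close> that
  \<open>closing_det_stitch\<close> asks for.\<close>

lemma joints_from_pair:
  assumes "strands Y L" "y \<in> Y" "(a, b) \<in> pairs (L y)"
  shows "(a, c) \<in> joints Y L Z \<longleftrightarrow> c = b" "(c, b) \<in> joints Y L Z \<longleftrightarrow> c = a"
proof -
  note in_y = pairs_subset[OF assms(3)]
  note uniq = strands_unique[OF assms(1,2)]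
  note D = strandsD[OF assms(1)]
  show "(a, c) \<in> joints Y L Z \<longleftrightarrow> c = b"
  proof
    assume "(a, c) \<in> joints Y L Z"
    then consider y' where "y' \<in> Y" "(a, c) \<in> pairs (L y')"
      | y' where "y' \<in> Y" "a = last (L y')"
      unfolding joints_def by blast
    then show "c = b"
    proof cases
      case 1
      then have "y = y'" using uniq in_y pairs_subset by metis
      then show ?thesis using pairs_functional(1)[OF D(2)[OF assms(2)] assms(3)] 1 by simp
    next
      case 2
      then have "y = y'" using uniq in_y D(4) by metis
      then show ?thesis using pairs_hd_last(1)[OF D(2)[OF assms(2)] assms(3)] 2 by simp
    qed
  qed (use assms in \<open>auto simp: joints_def\<close>)
  show "(c, b) \<in> joints Y L Z \<longleftrightarrow> c = a"
  proof
    assume "(c, b) \<in> joints Y L Z"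
    then consider y' where "y' \<in> Y" "(c, b) \<in> pairs (L y')"
      | y' where "y' \<in> Y" "b = hd (L y')"
      unfolding joints_def by blast
    then show "c = a"
    proof cases
      case 1
      then have "y = y'" using uniq in_y pairs_subset by metis
      then show ?thesis using pairs_functional(2)[OF D(2)[OF assms(2)] assms(3)] 1 by simp
    next
      case 2
      then have "y = y'" using uniq in_y D(3) by metis
      then show ?thesis using pairs_hd_last(2)[OF D(2)[OF assms(2)] assms(3)] 2 by simp
    qed
  qed (use assms in \<open>auto simp: joints_def\<close>)
qed

lemma strands_update:
  assumes "strands Y L" "w \<noteq> []" "distinct w" "z \<in> Y" "set w \<subseteq> set (L z)"
  shows "strands Y (L(z := w))"
  using assms unfolding strands_def by (auto; blast)

lemma nodes_at: "z \<in> Y \<Longrightarrow> nodes Y L = (\<Union>y\<in>Y - {z}. set (L y)) \<union> set (L z)"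
  unfolding nodes_def by blast

lemma nodes_update: "z \<in> Y \<Longrightarrow> nodes Y (L(z := w)) = (\<Union>y\<in>Y - {z}. set (L y)) \<union> set w"
  by (auto simp: nodes_at)

lemma nodes_remove:
  assumes "strands Y L" "z \<in> Y" "L z = U @ b # W"
  shows "nodes Y (L(z := U @ W)) = nodes Y L - {b}"
proof -
  have "b \<notin> set (L y)" if "y \<in> Y" "y \<noteq> z" for y
    using strands_unique[OF assms(1) that(1) assms(2), of b] assms(3) that by auto
  moreover have "b \<notin> set U \<union> set W"
    using strandsD(2)[OF assms(1,2)] assms(3) by auto
  ultimately show ?thesis
    unfolding nodes_update[OF assms(2)] nodes_at[OF assms(2)] assms(3) by auto
qed

lemma joints_at:
  assumes "z \<in> Y"
  shows "joints Y L Z = (\<Union>y\<in>Y - {z}. pairs (L y)) \<union> pairs (L z) \<union>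
     {(last (L y), hd (L y')) |y y'. y \<in> Y \<and> y' \<in> Y \<and> (y, y') \<in> Z}"
  using assms unfolding joints_def by blast

lemma joints_update:
  assumes "z \<in> Y"
  shows "joints Y (L(z := w)) Z = (\<Union>y\<in>Y - {z}. pairs (L y)) \<union> pairs w \<union>
     {(last ((L(z := w)) y), hd ((L(z := w)) y')) |y y'. y \<in> Y \<and> y' \<in> Y \<and> (y, y') \<in> Z}"
  unfolding joints_at[OF assms] by (simp add: fun_upd_def)

text \<open>The merged node keeps the tail of \<open>a\<close> and takes over the head of
  \<open>b\<close>: joints into it are those into \<open>a\<close>, joints out of it those out of
  \<open>b\<close>. Therefore only the first index is renamed.\<close>

lemma joints_merge:
  assumes st: "strands Y L" and z: "z \<in> Y" and L: "L z = U @ [a, b] @ W"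
    and ij: "i \<noteq> b" "j \<noteq> b"
  shows "(i, j) \<in> joints Y (L(z := U @ [a] @ W)) Z \<longleftrightarrow> ((id(a := b)) i, j) \<in> joints Y L Z"
proof -
  have dist: "distinct (U @ [a, b] @ W)"
    using strandsD(2)[OF st z] L by simp
  have other: "{a, b} \<inter> set (L y) = {}" if "y \<in> Y" "y \<noteq> z" for y
    using strands_unique[OF st that(1) z] L that by auto
  then have other_pairs: "(i, j) \<in> pairs (L y) \<longleftrightarrow> ((id(a := b)) i, j) \<in> pairs (L y)"
    if "y \<in> Y" "y \<noteq> z" for y
    using that by (auto dest: pairs_subset)
  have z_pairs: "(i, j) \<in> pairs (U @ [a] @ W) \<longleftrightarrow> ((id(a := b)) i, j) \<in> pairs (L z)"
    using dist ij by (auto simp: L pairs_append pairs_Cons dest: pairs_subset split: if_splits)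
  have hds: "hd ((L(z := U @ [a] @ W)) y) = hd (L y)" for y
    using L by (simp add: hd_append)
  have lasts: "last ((L(z := U @ [a] @ W)) y) = i \<longleftrightarrow> last (L y) = (id(a := b)) i" if "y \<in> Y" for y
  proof (cases "y = z")
    case True
    then show ?thesis
      using dist ij by (auto simp: L)
  next
    case False
    then have "last (L y) \<notin> {a, b}"
      using other[OF that] strandsD(4)[OF st that] by auto
    then show ?thesis using False by auto
  qed
  have "(i, j) \<in> joints Y (L(z := U @ [a] @ W)) Z \<longleftrightarrow>
     (\<exists>y\<in>Y - {z}. (i, j) \<in> pairs (L y)) \<or> (i, j) \<in> pairs (U @ [a] @ W) \<or>
     (\<exists>y\<in>Y. \<exists>y'\<in>Y. (y, y') \<in> Z \<and> last ((L(z := U @ [a] @ W)) y) = i \<and> hd ((L(z := U @ [a] @ W)) y') = j)"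
    unfolding joints_update[OF z] by (auto simp del: fun_upd_apply)
  also have "\<dots> \<longleftrightarrow> (\<exists>y\<in>Y - {z}. ((id(a := b)) i, j) \<in> pairs (L y)) \<or> ((id(a := b)) i, j) \<in> pairs (L z) \<or>
     (\<exists>y\<in>Y. \<exists>y'\<in>Y. (y, y') \<in> Z \<and> last (L y) = (id(a := b)) i \<and> hd (L y') = j)"
    using other_pairs z_pairs lasts hds by (simp del: fun_upd_apply)
  also have "\<dots> \<longleftrightarrow> ((id(a := b)) i, j) \<in> joints Y L Z"
    unfolding joints_at[OF z] by (auto simp del: fun_upd_apply id_apply; metis)
  finally show ?thesis .
qed

lemma word_det_cong:
  assumes "strands Y L" "\<And>i j. i \<in> nodes Y L \<Longrightarrow> j \<in> nodes Y L \<Longrightarrow> K i j = K' i j"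
  shows "word_det Y L Z K = word_det Y L Z K'"
  unfolding word_det_def by (rule closing_det_cong) (use assms finite_nodes in auto)

text \<open>The condition \<open>K b a = 0\<close> makes the pivot 1, so merging two neighbours
  costs neither a factor nor a denominator.\<close>

lemma word_det_stitch:
  fixes K :: "'n \<Rightarrow> 'n \<Rightarrow> 'f::field"
  assumes st: "strands Y L" and z: "z \<in> Y" and L: "L z = U @ [a, b] @ W" and K: "K b a = 0"
  shows "word_det Y L Z K = word_det Y (L(z := U @ [a] @ W)) Z
           (\<lambda>i j. K i ((id(a := b)) j) + K i a * K b ((id(a := b)) j))"
proof -
  have dist: "distinct (U @ [a, b] @ W)"
    using strandsD(2)[OF st z] L by simp
  have ab: "(a, b) \<in> pairs (L z)" by (simp add: L pairs_append)
  note J = joints_from_pair[OF st z ab]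
  have V: "nodes Y (L(z := U @ [a] @ W)) = nodes Y L - {b}"
    using nodes_remove[OF st z, of "U @ [a]" b W] L by simp
  have in_V: "a \<in> nodes Y L" "b \<in> nodes Y L"
    by (simp_all add: nodes_at[OF z] L)
  have "word_det Y L Z K = closing_det (nodes Y L - {b})
      (\<lambda>i j. K i ((id(a := b)) j) + K i a * K b ((id(a := b)) j))
      (\<lambda>i j. of_bool (((id(a := b)) i, j) \<in> joints Y L Z))"
    unfolding word_det_def
    using closing_det_stitch[OF finite_nodes[OF st] in_V, of "\<lambda>i j. of_bool ((i, j) \<in> joints Y L Z)" K]
      dist J K by (simp del: fun_upd_apply)
  also have "\<dots> = word_det Y (L(z := U @ [a] @ W)) Z
           (\<lambda>i j. K i ((id(a := b)) j) + K i a * K b ((id(a := b)) j))"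
    unfolding word_det_def V
    by (rule closing_det_cong)
       (use finite_nodes[OF st] joints_merge[OF st z L] in \<open>auto simp del: fun_upd_apply\<close>)
  finally show ?thesis .
qed

text \<open>Dropping \<open>b\<close> connects what precedes it to what follows it. A direct joint
  and one through \<open>b\<close> never coexist: if \<open>U\<close> is nonempty, \<open>i\<close>
  is its last node and leads to \<open>b\<close> only; otherwise \<open>W\<close> is nonempty and
  its first node is entered from \<open>b\<close> only. Hence the sum of the two indicators is again
  an indicator.\<close>

lemma joints_delete:
  assumes st: "strands Y L" and z: "z \<in> Y" and L: "L z = U @ [b] @ W" and ne: "U @ W \<noteq> []"
  shows "i \<noteq> b \<Longrightarrow> j \<noteq> b \<Longrightarrow> (i, j) \<in> joints Y (L(z := U @ W)) Z \<longleftrightarrow>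
     (i, j) \<in> joints Y L Z \<or> (i, b) \<in> joints Y L Z \<and> (b, j) \<in> joints Y L Z"
    and "i \<noteq> b \<Longrightarrow> j \<noteq> b \<Longrightarrow> (i, b) \<in> joints Y L Z \<Longrightarrow> (b, j) \<in> joints Y L Z \<Longrightarrow> (i, j) \<notin> joints Y L Z"
    and "(b, b) \<notin> joints Y L Z"
proof -
  let ?L = "L(z := U @ W)"
  have dist: "distinct (U @ [b] @ W)"
    using strandsD(2)[OF st z] L by simp
  have other: "b \<notin> set (L y)" if "y \<in> Y" "y \<noteq> z" for y
    using strands_unique[OF st that(1) z] L that by auto
  have split': "(i, j) \<in> joints Y ?L Z \<longleftrightarrow>
     (\<exists>y\<in>Y - {z}. (i, j) \<in> pairs (L y)) \<or> (i, j) \<in> pairs (U @ W) \<or>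
     (\<exists>y\<in>Y. \<exists>y'\<in>Y. (y, y') \<in> Z \<and> last (?L y) = i \<and> hd (?L y') = j)"
    unfolding joints_update[OF z] by (auto simp del: fun_upd_apply)
  have split: "(i, j) \<in> joints Y L Z \<longleftrightarrow>
     (\<exists>y\<in>Y - {z}. (i, j) \<in> pairs (L y)) \<or> (i, j) \<in> pairs (U @ [b] @ W) \<or>
     (\<exists>y\<in>Y. \<exists>y'\<in>Y. (y, y') \<in> Z \<and> last (L y) = i \<and> hd (L y') = j)" for i j
    unfolding joints_at[OF z] L by auto
  have from_b: "(b, j) \<in> joints Y L Z \<longleftrightarrow>
      (if W = [] then \<exists>y'\<in>Y. (z, y') \<in> Z \<and> hd (L y') = j else j = hd W)" for j
  proof (cases "W = []")
    case False
    then have "(b, hd W) \<in> pairs (L z)" by (simp add: L pairs_append pairs_Cons)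
    then show ?thesis using joints_from_pair(1)[OF st z] False by simp
  next
    case True
    have "(b, j) \<notin> pairs (L z)"
      using dist True by (auto simp: L pairs_append dest: pairs_subset)
    moreover have "(b, j) \<notin> pairs (L y)" if "y \<in> Y" "y \<noteq> z" for y
      using other[OF that] by (auto dest: pairs_subset)
    moreover have "last (L y) = b \<longleftrightarrow> y = z" if "y \<in> Y" for y
      using other[OF that] strandsD(4)[OF st that] True L by auto
    ultimately show ?thesis
      unfolding split using True L z by auto
  qed
  have to_b: "(i, b) \<in> joints Y L Z \<longleftrightarrow>
      (if U = [] then \<exists>y\<in>Y. (y, z) \<in> Z \<and> last (L y) = i else i = last U)" for i
  proof (cases "U = []")
    case False
    then have "(last U, b) \<in> pairs (L z)" by (simp add: L pairs_append)
    then show ?thesis using joints_from_pair(2)[OF st z] False by simp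
  next
    case True
    have "(i, b) \<notin> pairs (L z)"
      using dist True by (auto simp: L pairs_Cons dest: pairs_subset)
    moreover have "(i, b) \<notin> pairs (L y)" if "y \<in> Y" "y \<noteq> z" for y
      using other[OF that] by (auto dest: pairs_subset)
    moreover have "hd (L y) = b \<longleftrightarrow> y = z" if "y \<in> Y" for y
      using other[OF that] strandsD(3)[OF st that] True L by auto
    ultimately show ?thesis
      unfolding split using True L z by auto
  qed
  show "(b, b) \<notin> joints Y L Z"
    using from_b[of b] to_b[of b] ne dist by (auto split: if_splits)
  show "(i, j) \<notin> joints Y L Z"
    if "i \<noteq> b" "j \<noteq> b" "(i, b) \<in> joints Y L Z" "(b, j) \<in> joints Y L Z"
  proof (cases "U = []")
    case False
    then have "(last U, b) \<in> pairs (L z)" by (simp add: L pairs_append)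
    from joints_from_pair(1)[OF st z this] show ?thesis
      using to_b[of i] False that by simp
  next
    case True
    then have "(b, hd W) \<in> pairs (L z)" using ne by (simp add: L pairs_Cons)
    from joints_from_pair(2)[OF st z this] show ?thesis
      using from_b[of j] True ne that by simp
  qed
  assume ij: "i \<noteq> b" "j \<noteq> b"
  have lasts: "last (?L y) = i \<longleftrightarrow> (if W = [] \<and> y = z then last U = i else last (L y) = i)" for y
    using ne L by auto
  have hds: "hd (?L y) = j \<longleftrightarrow> (if U = [] \<and> y = z then hd W = j else hd (L y) = j)" for y
    using ne L by (auto simp: hd_append)
  have z_pairs: "(i, j) \<in> pairs (U @ W) \<longleftrightarrow>
      (i, j) \<in> pairs (U @ [b] @ W) \<or> U \<noteq> [] \<and> W \<noteq> [] \<and> i = last U \<and> j = hd W"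
    using ij by (auto simp: pairs_append pairs_Cons)
  have hd_z: "U = [] \<Longrightarrow> hd (L z) = b" and last_z: "W = [] \<Longrightarrow> last (L z) = b"
    using L by auto
  show "(i, j) \<in> joints Y ?L Z \<longleftrightarrow>
     (i, j) \<in> joints Y L Z \<or> (i, b) \<in> joints Y L Z \<and> (b, j) \<in> joints Y L Z"
    unfolding split' split[of i j] lasts hds z_pairs from_b to_b
    using ij ne z hd_z last_z by (cases "U = []"; cases "W = []") auto
qed

text \<open>A node with unit row and unit column is a trivial strand. This removes the start nodes
  \<open>Inl y\<close> and, in the second Reidemeister move, what is left of a bigon after
  stitching.\<close>

lemma word_det_delete:
  fixes K :: "'n \<Rightarrow> 'n \<Rightarrow> 'f::field"
  assumes st: "strands Y L" and z: "z \<in> Y" and L: "L z = U @ [b] @ W" and ne: "U @ W \<noteq> []"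
    and K: "K b b = 1" "\<And>j. j \<in> nodes Y L \<Longrightarrow> j \<noteq> b \<Longrightarrow> K b j = 0"
      "\<And>i. i \<in> nodes Y L \<Longrightarrow> i \<noteq> b \<Longrightarrow> K i b = 0"
  shows "word_det Y L Z K = word_det Y (L(z := U @ W)) Z K"
proof -
  have V: "nodes Y (L(z := U @ W)) = nodes Y L - {b}"
    using nodes_remove[OF st z] L by simp
  note J = joints_delete(1,2)[OF st z L ne]
  have "b \<in> nodes Y L" by (simp add: nodes_at[OF z] L)
  moreover have "(b, b) \<notin> joints Y L Z" by (rule joints_delete(3)[OF st z L ne])
  ultimately have "word_det Y L Z K = closing_det (nodes Y L - {b}) K
      (\<lambda>i j. of_bool ((i, j) \<in> joints Y L Z) +
         of_bool ((i, b) \<in> joints Y L Z) * of_bool ((b, j) \<in> joints Y L Z))"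
    unfolding word_det_def
    using K finite_nodes[OF st] by (intro closing_det_eliminate) auto
  also have "\<dots> = word_det Y (L(z := U @ W)) Z K"
    unfolding word_det_def V
  proof (rule closing_det_cong)
    fix i j assume "i \<in> nodes Y L - {b}" "j \<in> nodes Y L - {b}"
    then have "i \<noteq> b" "j \<noteq> b" by auto
    from J(1)[OF this] J(2)[OF this] show "of_bool ((i, j) \<in> joints Y L Z) +
         of_bool ((i, b) \<in> joints Y L Z) * of_bool ((b, j) \<in> joints Y L Z) =
         (of_bool ((i, j) \<in> joints Y (L(z := U @ W)) Z) :: 'f)"
      by auto
  qed (use finite_nodes[OF st] in auto)
  finally show ?thesis .
qed

lemma Collect_pairs_image:
  "{(f y, g y') |y y'. y \<in> A \<and> y' \<in> B \<and> (y, y') \<in> Z} = map_prod f g ` (Z \<inter> A \<times> B)"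
proof (intro equalityI subsetI)
  fix e assume "e \<in> {(f y, g y') |y y'. y \<in> A \<and> y' \<in> B \<and> (y, y') \<in> Z}"
  then obtain y y' where "e = map_prod f g (y, y')" "(y, y') \<in> Z \<inter> A \<times> B" by auto
  then show "e \<in> map_prod f g ` (Z \<inter> A \<times> B)" by blast
qed auto

lemma Int_Times_unique_pair:
  assumes "z \<in> Y" "y \<in> Y" "(z, y) \<in> Z"
    and "\<And>k. k \<in> Y \<Longrightarrow> (k, y) \<in> Z \<Longrightarrow> k = z" "\<And>j. j \<in> Y \<Longrightarrow> (z, j) \<in> Z \<Longrightarrow> j = y"
  shows "Z \<inter> Y \<times> Y = insert (z, y) (Z \<inter> (Y - {z}) \<times> (Y - {y}))"
proof (intro equalityI subsetI)
  fix e assume e: "e \<in> Z \<inter> Y \<times> Y"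
  obtain k j where kj: "e = (k, j)" by (cases e)
  then have in_Y: "k \<in> Y" "j \<in> Y" "(k, j) \<in> Z" using e by auto
  have "k = z \<longleftrightarrow> j = y"
    using in_Y assms(4)[of k] assms(5)[of j] by blast
  then show "e \<in> insert (z, y) (Z \<inter> (Y - {z}) \<times> (Y - {y}))"
    using in_Y unfolding kj by blast
next
  fix e assume "e \<in> insert (z, y) (Z \<inter> (Y - {z}) \<times> (Y - {y}))"
  then show "e \<in> Z \<inter> Y \<times> Y" using assms(1-3) by blast
qed

text \<open>The joint from \<open>z\<close> to \<open>y\<close> is merely recorded differently, as a
  consecutive pair instead of a member of \<open>Z\<close>, so nodes and joints stay the same. In
  \<open>Z'\<close> the head of \<open>z\<close> is the former head of \<open>y\<close>.\<close>

lemma word_det_join: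
  assumes st: "strands Y L" and zy: "z \<in> Y" "y \<in> Y" "z \<noteq> y" "(z, y) \<in> Z"
    and uniq: "\<And>k. k \<in> Y \<Longrightarrow> (k, y) \<in> Z \<Longrightarrow> k = z" "\<And>j. j \<in> Y \<Longrightarrow> (z, j) \<in> Z \<Longrightarrow> j = y"
    and Z': "\<And>k j. k \<in> Y - {y} \<Longrightarrow> j \<in> Y - {y} \<Longrightarrow> (k, j) \<in> Z' \<longleftrightarrow> ((id(z := y)) k, j) \<in> Z"
  shows "word_det Y L Z K = word_det (Y - {y}) (L(z := L z @ L y)) Z' K"
proof -
  let ?L = "L(z := L z @ L y)"
  have V: "nodes (Y - {y}) ?L = nodes Y L"
    using zy nodes_at[of z "Y - {y}" ?L] nodes_at[of y Y L] by (auto simp: nodes_def)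
  have ne: "L z \<noteq> []" "L y \<noteq> []" using strandsD(1)[OF st] zy by auto
  have last: "last (?L k) = last (L ((id(z := y)) k))" and hd: "hd (?L k) = hd (L k)" for k
    using ne by auto
  have P: "(\<Union>k\<in>Y - {y}. pairs (?L k)) = insert (last (L z), hd (L y)) (\<Union>k\<in>Y. pairs (L k))"
  proof -
    have "(\<Union>k\<in>Y - {y}. pairs (?L k)) = (\<Union>k\<in>Y - {y} - {z}. pairs (L k)) \<union> pairs (L z @ L y)"
      using zy by (auto split: if_splits)
    also have "\<dots> = insert (last (L z), hd (L y)) (\<Union>k\<in>Y. pairs (L k))"
      using zy ne by (auto simp: pairs_append)
    finally show ?thesis .
  qed
  let ?A = "{(last (?L k), hd (?L j)) |k j. k \<in> Y - {y} \<and> j \<in> Y - {y} \<and> (k, j) \<in> Z'}"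
  let ?B = "{(last (L k), hd (L j)) |k j. k \<in> Y - {z} \<and> j \<in> Y - {y} \<and> (k, j) \<in> Z}"
  have "?A = ?B"
  proof (intro equalityI subsetI)
    fix e assume "e \<in> ?A"
    then obtain k j where kj: "k \<in> Y - {y}" "j \<in> Y - {y}" "(k, j) \<in> Z'" "e = (last (?L k), hd (?L j))"
      by blast
    then have "e = (last (L ((id(z := y)) k)), hd (L j))" "((id(z := y)) k, j) \<in> Z"
      "(id(z := y)) k \<in> Y - {z}"
      using Z' last hd zy by (auto split: if_splits)
    then show "e \<in> ?B" using kj(2) by blast
  next
    fix e assume "e \<in> ?B"
    then obtain k j where kj: "k \<in> Y - {z}" "j \<in> Y - {y}" "(k, j) \<in> Z" "e = (last (L k), hd (L j))"
      by blast
    define k' where "k' = (id(y := z)) k"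
    have "k' \<in> Y - {y}" "(id(z := y)) k' = k" using kj zy by (auto simp: k'_def)
    then have "e = (last (?L k'), hd (?L j))" "(k', j) \<in> Z'"
      using Z'[of k' j] kj last[of k'] hd[of j] by auto
    then show "e \<in> ?A" using \<open>k' \<in> Y - {y}\<close> kj(2) by blast
  qed
  then have "insert (last (L z), hd (L y)) ?A = insert (last (L z), hd (L y)) ?B"
    by (rule arg_cong)
  also have "insert (last (L z), hd (L y)) ?B =
      {(last (L k), hd (L j)) |k j. k \<in> Y \<and> j \<in> Y \<and> (k, j) \<in> Z}"
  proof -
    have "Z \<inter> Y \<times> Y = insert (z, y) (Z \<inter> (Y - {z}) \<times> (Y - {y}))"
      by (rule Int_Times_unique_pair) (use zy uniq in blast)+
    then show ?thesis
      unfolding Collect_pairs_image by simp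
  qed
  finally have A: "insert (last (L z), hd (L y)) ?A =
      {(last (L k), hd (L j)) |k j. k \<in> Y \<and> j \<in> Y \<and> (k, j) \<in> Z}" .
  have "joints (Y - {y}) ?L Z' = joints Y L Z"
    unfolding joints_def P A[symmetric] by (simp only: Un_insert_left Un_insert_right)
  then show ?thesis by (simp add: word_det_def V)
qed

text \<open>When \<open>z\<close> is joined to itself and to nothing else, its joints form a cycle,
  and a cycle has no first node.\<close>

lemma word_det_rotate:
  assumes z: "z \<in> Y" "(z, z) \<in> Z" and L: "L z = U @ W"
    and uniq: "\<And>k. k \<in> Y \<Longrightarrow> (k, z) \<in> Z \<Longrightarrow> k = z" "\<And>j. j \<in> Y \<Longrightarrow> (z, j) \<in> Z \<Longrightarrow> j = z"
  shows "word_det Y L Z K = word_det Y (L(z := W @ U)) Z K"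
proof (cases "U = [] \<or> W = []")
  case True
  then have "L(z := W @ U) = L" using L by auto
  then show ?thesis by simp
next
  case False
  have V: "nodes Y (L(z := W @ U)) = nodes Y L"
    unfolding nodes_update[OF z(1)] nodes_at[OF z(1), of L] L by auto
  have J: "joints Y (L(z := w)) Z = (\<Union>y\<in>Y - {z}. pairs (L y)) \<union> pairs w \<union> {(last w, hd w)} \<union>
     {(last (L y), hd (L y')) |y y'. y \<in> Y - {z} \<and> y' \<in> Y - {z} \<and> (y, y') \<in> Z}" for w
  proof -
    let ?L = "L(z := w)"
    have ZY: "Z \<inter> Y \<times> Y = insert (z, z) (Z \<inter> (Y - {z}) \<times> (Y - {z}))"
      by (rule Int_Times_unique_pair) (use z uniq in blast)+
    have cong: "map_prod (\<lambda>y. last (?L y)) (\<lambda>y. hd (?L y)) ` (Z \<inter> (Y - {z}) \<times> (Y - {z})) =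
        map_prod (\<lambda>y. last (L y)) (\<lambda>y. hd (L y)) ` (Z \<inter> (Y - {z}) \<times> (Y - {z}))"
      by (rule image_cong) (auto split: if_splits)
    show ?thesis
      unfolding joints_update[OF z(1)] Collect_pairs_image ZY image_insert cong map_prod_simp
      by (simp only: Un_insert_right Un_empty_right Un_insert_left fun_upd_same)
  qed
  have "joints Y L Z = joints Y (L(z := L z)) Z" by simp
  also have "\<dots> = joints Y (L(z := W @ U)) Z"
    unfolding J L using False by (auto simp: pairs_append hd_append)
  finally show ?thesis by (simp add: word_det_def V)
qed

lemma word_det_map:
  assumes st: "strands Y L" and inj: "inj_on g (nodes Y L)"
    and L': "\<And>y. y \<in> Y \<Longrightarrow> L' y = map g (L y)"
  shows "word_det Y L' Z K = word_det Y L Z (\<lambda>i j. K (g i) (g j))"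
proof -
  have V: "nodes Y L' = g ` nodes Y L"
    using L' by (auto simp: nodes_def)
  have sub: "joints Y L Z \<subseteq> nodes Y L \<times> nodes Y L"
  proof
    fix e assume e: "e \<in> joints Y L Z"
    obtain i j where ij: "e = (i, j)" by (cases e)
    from e consider y where "y \<in> Y" "(i, j) \<in> pairs (L y)"
      | y y' where "y \<in> Y" "y' \<in> Y" "e = (last (L y), hd (L y'))"
      unfolding joints_def ij by blast
    then show "e \<in> nodes Y L \<times> nodes Y L"
    proof cases
      case 1
      then show ?thesis using pairs_subset[OF 1(2)] by (auto simp: nodes_def ij)
    next
      case 2
      then show ?thesis using strandsD(3,4)[OF st] by (auto simp: nodes_def)
    qed
  qed
  have hl: "last (L' y) = g (last (L y))" "hd (L' y) = g (hd (L y))" if "y \<in> Y" for y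
    using strandsD(1)[OF st that] L'[OF that] by (simp_all add: last_map hd_map)
  have "joints Y L' Z = map_prod g g ` joints Y L Z" (is "?A = ?B")
  proof (intro equalityI subsetI)
    fix e assume "e \<in> ?A"
    then consider y where "y \<in> Y" "e \<in> pairs (L' y)"
      | y y' where "y \<in> Y" "y' \<in> Y" "(y, y') \<in> Z" "e = (last (L' y), hd (L' y'))"
      unfolding joints_def by blast
    then show "e \<in> ?B"
    proof cases
      case 1
      then have "e \<in> map_prod g g ` pairs (L y)" by (simp add: L' pairs_map)
      then show ?thesis unfolding joints_def using 1(1) by blast
    next
      case 2
      then have "(last (L y), hd (L y')) \<in> joints Y L Z"
        unfolding joints_def by blast
      moreover have "e = map_prod g g (last (L y), hd (L y'))"
        using hl 2 by simp
      ultimately show ?thesis by blast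
    qed
  next
    fix e assume "e \<in> ?B"
    then obtain e' where e': "e' \<in> joints Y L Z" "e = map_prod g g e'" by (elim imageE)
    then consider y where "y \<in> Y" "e' \<in> pairs (L y)"
      | y y' where "y \<in> Y" "y' \<in> Y" "(y, y') \<in> Z" "e' = (last (L y), hd (L y'))"
      unfolding joints_def by blast
    then show "e \<in> ?A"
    proof cases
      case 1
      then have "e \<in> pairs (L' y)" using L' e' by (simp add: pairs_map)
      then show ?thesis unfolding joints_def using 1(1) by blast
    next
      case 2
      then have "e = (last (L' y), hd (L' y'))" using hl e' by auto
      then show ?thesis unfolding joints_def using 2(1-3) by blast
    qed
  qed
  moreover have "(g i, g j) \<in> map_prod g g ` joints Y L Z \<longleftrightarrow> (i, j) \<in> joints Y L Z"
    if "i \<in> nodes Y L" "j \<in> nodes Y L" for i j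
  proof
    assume "(g i, g j) \<in> map_prod g g ` joints Y L Z"
    then obtain e where e: "e \<in> joints Y L Z" "(g i, g j) = map_prod g g e" by (elim imageE)
    obtain i' j' where "e = (i', j')" by (cases e)
    with e have *: "(i', j') \<in> joints Y L Z" "g i = g i'" "g j = g j'" by simp_all
    then have "i = i'" "j = j'"
      using inj_onD[OF inj *(2) that(1)] inj_onD[OF inj *(3) that(2)] subsetD[OF sub *(1)] by simp_all
    then show "(i, j) \<in> joints Y L Z" using * by simp
  next
    assume "(i, j) \<in> joints Y L Z"
    then show "(g i, g j) \<in> map_prod g g ` joints Y L Z"
      by (rule image_eqI[rotated]) simp
  qed
  ultimately have J: "(g i, g j) \<in> joints Y L' Z \<longleftrightarrow> (i, j) \<in> joints Y L Z"
    if "i \<in> nodes Y L" "j \<in> nodes Y L" for i j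
    using that by simp
  show ?thesis
    unfolding word_det_def V closing_det_image[OF finite_nodes[OF st] inj]
    by (rule closing_det_cong[OF finite_nodes[OF st] refl]) (simp only: J)
qed

text \<open>Plain merging of \<open>[b, a]\<close> would keep the name \<open>b\<close>. Renaming
  the survivor to \<open>a\<close> lets both orders of a pair leave the same word, so that the two
  sides of a move can be compared entry by entry.\<close>

lemma word_det_stitch_second:
  fixes K :: "'n \<Rightarrow> 'n \<Rightarrow> 'f::field"
  assumes st: "strands Y L" and z: "z \<in> Y" and L: "L z = U @ [b, a] @ W" and K: "K a b = 0"
  shows "word_det Y L Z K = word_det Y (L(z := U @ [a] @ W)) Z
           (\<lambda>i j. K ((id(a := b)) i) j + K ((id(a := b)) i) b * K a j)"
proof -
  let ?L1 = "L(z := U @ [b] @ W)" and ?L2 = "L(z := U @ [a] @ W)"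
  let ?K1 = "\<lambda>i j. K i ((id(b := a)) j) + K i b * K a ((id(b := a)) j)"
  have dist: "distinct (U @ [b, a] @ W)"
    using strandsD(2)[OF st z] L by simp
  have st2: "strands Y ?L2"
    by (rule strands_update) (use st z L dist in auto)
  have V2: "nodes Y ?L2 = nodes Y L - {b}"
    using nodes_remove[OF st z, of U b "[a] @ W"] L by simp
  have other: "{a, b} \<inter> set (L y) = {}" if "y \<in> Y" "y \<noteq> z" for y
    using strands_unique[OF st that(1) z] L that by auto
  have "word_det Y L Z K = word_det Y ?L1 Z ?K1"
    by (rule word_det_stitch[where K = K, OF st z L K])
  also have "\<dots> = word_det Y ?L2 Z (\<lambda>i j. ?K1 ((id(a := b)) i) ((id(a := b)) j))"
  proof (rule word_det_map[where g = "id(a := b)" and K = ?K1, OF st2])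
    show "inj_on (id(a := b)) (nodes Y ?L2)"
      unfolding V2 by (auto simp: inj_on_def)
    fix y assume y: "y \<in> Y"
    have id: "map (id(a := b)) xs = xs" if "a \<notin> set xs" for xs
      by (rule map_idI) (use that in auto)
    show "?L1 y = map (id(a := b)) (?L2 y)"
    proof (cases "y = z")
      case True
      have U: "map (id(a := b)) U = U" by (rule id) (use dist in simp)
      have W: "map (id(a := b)) W = W" by (rule id) (use dist in simp)
      show ?thesis by (simp add: True U W del: id_apply)
    next
      case False
      then have "a \<notin> set (L y)" using other[OF y] by blast
      then have "map (id(a := b)) (L y) = L y" by (rule id)
      then show ?thesis using False by simp
    qed
  qed
  also have "\<dots> = word_det Y ?L2 Z (\<lambda>i j. K ((id(a := b)) i) j + K ((id(a := b)) i) b * K a j)"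
    by (rule word_det_cong[OF st2], unfold V2) auto
  finally show ?thesis .
qed

section \<open>Substitution\<close>

definition power_product :: "('a \<Rightarrow> 'a mpoly) \<Rightarrow> ('a \<Rightarrow>\<^sub>0 nat) \<Rightarrow> 'a mpoly" where
  "power_product \<sigma> m = (\<Prod>i\<in>Poly_Mapping.keys m. \<sigma> i ^ Poly_Mapping.lookup m i)"

lemma power_product_superset:
  assumes "finite A" "Poly_Mapping.keys m \<subseteq> A"
  shows "power_product \<sigma> m = (\<Prod>i\<in>A. \<sigma> i ^ Poly_Mapping.lookup m i)"
  unfolding power_product_def
  by (rule prod.mono_neutral_left) (use assms in \<open>auto simp: in_keys_iff\<close>)

lemma power_product_zero [simp]: "power_product \<sigma> 0 = 1"
  by (simp add: power_product_def)

lemma power_product_add: "power_product \<sigma> (m + n) = power_product \<sigma> m * power_product \<sigma> n"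
proof -
  let ?A = "Poly_Mapping.keys m \<union> Poly_Mapping.keys n"
  have "Poly_Mapping.keys (m + n) \<subseteq> ?A" by (rule Poly_Mapping.keys_add)
  then show ?thesis
    using power_product_superset[of ?A m \<sigma>] power_product_superset[of ?A n \<sigma>]
      power_product_superset[of ?A "m + n" \<sigma>]
    by (simp add: lookup_add power_add prod.distrib)
qed

lemma poly_subst_superset:
  assumes "finite A" "Poly_Mapping.keys p \<subseteq> A"
  shows "poly_subst \<sigma> p = (\<Sum>m\<in>A. Poly_Mapping.single 0 (Poly_Mapping.lookup p m) * power_product \<sigma> m)"
  unfolding poly_subst_def power_product_def[symmetric]
  by (rule sum.mono_neutral_left) (use assms in \<open>auto simp: in_keys_iff\<close>)

lemma poly_subst_zero [simp]: "poly_subst \<sigma> 0 = 0"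
  by (simp add: poly_subst_def)

lemma poly_subst_single: "poly_subst \<sigma> (Poly_Mapping.single m r) = Poly_Mapping.single 0 r * power_product \<sigma> m"
  using poly_subst_superset[of "{m}" "Poly_Mapping.single m r" \<sigma>] by simp

lemma poly_subst_one [simp]: "poly_subst \<sigma> 1 = 1"
  unfolding single_one[symmetric] poly_subst_single by simp

lemma poly_subst_add: "poly_subst \<sigma> (p + q) = poly_subst \<sigma> p + poly_subst \<sigma> q"
proof -
  let ?A = "Poly_Mapping.keys p \<union> Poly_Mapping.keys q"
  have "Poly_Mapping.keys (p + q) \<subseteq> ?A" by (rule Poly_Mapping.keys_add)
  then show ?thesis
    using poly_subst_superset[of ?A p \<sigma>] poly_subst_superset[of ?A q \<sigma>]
      poly_subst_superset[of ?A "p + q" \<sigma>]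
    by (simp add: lookup_add single_add distrib_right sum.distrib)
qed

lemma poly_subst_uminus: "poly_subst \<sigma> (- p) = - poly_subst \<sigma> p"
  using poly_subst_add[of \<sigma> p "- p"] by (simp add: eq_neg_iff_add_eq_0 add.commute)

lemma poly_subst_sum: "poly_subst \<sigma> (sum f A) = (\<Sum>x\<in>A. poly_subst \<sigma> (f x))"
  by (induction A rule: infinite_finite_induct) (simp_all add: poly_subst_add)

lemma sum_single_lookup:
  fixes p :: "'b \<Rightarrow>\<^sub>0 'c::comm_monoid_add"
  shows "(\<Sum>m\<in>Poly_Mapping.keys p. Poly_Mapping.single m (Poly_Mapping.lookup p m)) = p"
proof (rule poly_mapping_eqI)
  fix k
  have "(\<Sum>m\<in>Poly_Mapping.keys p. Poly_Mapping.lookup p m when m = k) = Poly_Mapping.lookup p k"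
    by (simp add: when_def sum.delta in_keys_iff)
  then show "Poly_Mapping.lookup (\<Sum>m\<in>Poly_Mapping.keys p. Poly_Mapping.single m (Poly_Mapping.lookup p m)) k =
      Poly_Mapping.lookup p k"
    by (simp add: lookup_sum lookup_single)
qed

text \<open>Both factors are expanded into monomials, where multiplicativity is that of
  \<open>power_product\<close>.\<close>

lemma poly_subst_mult: "poly_subst \<sigma> (p * q) = poly_subst \<sigma> p * poly_subst \<sigma> q"
proof -
  let ?t = "\<lambda>p m. Poly_Mapping.single m (Poly_Mapping.lookup p m)"
  let ?c = "\<lambda>p m. Poly_Mapping.single 0 (Poly_Mapping.lookup p m) * power_product \<sigma> m"
  have "p * q = (\<Sum>m\<in>Poly_Mapping.keys p. \<Sum>n\<in>Poly_Mapping.keys q. ?t p m * ?t q n)"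
    using sum_product[of "?t p" "Poly_Mapping.keys p" "?t q" "Poly_Mapping.keys q"]
    by (simp add: sum_single_lookup)
  then have "poly_subst \<sigma> (p * q) =
      (\<Sum>m\<in>Poly_Mapping.keys p. \<Sum>n\<in>Poly_Mapping.keys q. poly_subst \<sigma> (?t p m * ?t q n))"
    by (simp add: poly_subst_sum)
  also have "\<dots> = (\<Sum>m\<in>Poly_Mapping.keys p. \<Sum>n\<in>Poly_Mapping.keys q. ?c p m * ?c q n)"
  proof (intro sum.cong refl)
    fix m n
    have "Poly_Mapping.single (0 :: 'a \<Rightarrow>\<^sub>0 nat) (Poly_Mapping.lookup p m * Poly_Mapping.lookup q n) =
        Poly_Mapping.single 0 (Poly_Mapping.lookup p m) * Poly_Mapping.single 0 (Poly_Mapping.lookup q n)"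
      by (simp add: mult_single)
    then show "poly_subst \<sigma> (?t p m * ?t q n) = ?c p m * ?c q n"
      by (simp only: mult_single poly_subst_single power_product_add ac_simps)
  qed
  also have "\<dots> = poly_subst \<sigma> p * poly_subst \<sigma> q"
    unfolding poly_subst_def power_product_def[symmetric] sum_product ..
  finally show ?thesis .
qed

lemma poly_subst_var [simp]: "poly_subst \<sigma> (var i) = \<sigma> i"
  by (simp add: var_def poly_subst_single power_product_def)

lemma var_nonzero [simp]: "var i \<noteq> 0"
  by (metis lookup_single_eq lookup_zero one_neq_zero var_def)

text \<open>Cross multiplication, which \<open>poly_subst\<close> respects, compares two
  representations whose denominators survive the substitution. This will identify the \<phi>-side
  with the diagram side: both are values of one substitution at the same function.\<close>

lemma subst_to_unique:
  assumes "subst_to \<sigma> f g" "subst_to \<sigma> f h"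
  shows "g = h"
proof -
  obtain p q where pq: "poly_subst \<sigma> q \<noteq> 0" "f = Fraction_Field.Fract p q"
      "g = Fraction_Field.Fract (poly_subst \<sigma> p) (poly_subst \<sigma> q)"
    using assms(1) by (auto simp: subst_to_def)
  obtain r s where rs: "poly_subst \<sigma> s \<noteq> 0" "f = Fraction_Field.Fract r s"
      "h = Fraction_Field.Fract (poly_subst \<sigma> r) (poly_subst \<sigma> s)"
    using assms(2) by (auto simp: subst_to_def)
  have "q \<noteq> 0" "s \<noteq> 0" using pq(1) rs(1) by auto
  then have "p * s = r * q" using pq(2) rs(2) by (simp add: eq_fract)
  then have "poly_subst \<sigma> p * poly_subst \<sigma> s = poly_subst \<sigma> r * poly_subst \<sigma> q"
    by (metis poly_subst_mult)
  then show ?thesis using pq rs by (simp add: eq_fract)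
qed

lemma subst_toE:
  assumes "subst_to \<sigma> f g"
  obtains p q where "poly_subst \<sigma> q \<noteq> 0" "q \<noteq> 0" "f = Fraction_Field.Fract p q"
    "g = Fraction_Field.Fract (poly_subst \<sigma> p) (poly_subst \<sigma> q)"
  using assms unfolding subst_to_def by (metis poly_subst_zero)

lemma subst_to_zero [simp, intro]: "subst_to \<sigma> 0 0"
  unfolding subst_to_def by (rule exI[of _ 0], rule exI[of _ 1]) (simp add: Zero_fract_def)

lemma subst_to_one [simp, intro]: "subst_to \<sigma> 1 1"
  unfolding subst_to_def by (rule exI[of _ 1], rule exI[of _ 1]) (simp add: One_fract_def)

lemma subst_to_add [intro]:
  assumes "subst_to \<sigma> f g" "subst_to \<sigma> f' g'"
  shows "subst_to \<sigma> (f + f') (g + g')"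
proof -
  obtain p q where pq: "poly_subst \<sigma> q \<noteq> 0" "q \<noteq> 0" "f = Fraction_Field.Fract p q"
    "g = Fraction_Field.Fract (poly_subst \<sigma> p) (poly_subst \<sigma> q)" using assms(1) by (rule subst_toE)
  obtain r s where rs: "poly_subst \<sigma> s \<noteq> 0" "s \<noteq> 0" "f' = Fraction_Field.Fract r s"
    "g' = Fraction_Field.Fract (poly_subst \<sigma> r) (poly_subst \<sigma> s)" using assms(2) by (rule subst_toE)
  show ?thesis unfolding subst_to_def
    by (rule exI[of _ "p * s + r * q"], rule exI[of _ "q * s"])
       (use pq rs in \<open>simp add: poly_subst_mult poly_subst_add add_fract\<close>)
qed

lemma subst_to_mult [intro]:
  assumes "subst_to \<sigma> f g" "subst_to \<sigma> f' g'"
  shows "subst_to \<sigma> (f * f') (g * g')"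
proof -
  obtain p q where pq: "poly_subst \<sigma> q \<noteq> 0" "q \<noteq> 0" "f = Fraction_Field.Fract p q"
    "g = Fraction_Field.Fract (poly_subst \<sigma> p) (poly_subst \<sigma> q)" using assms(1) by (rule subst_toE)
  obtain r s where rs: "poly_subst \<sigma> s \<noteq> 0" "s \<noteq> 0" "f' = Fraction_Field.Fract r s"
    "g' = Fraction_Field.Fract (poly_subst \<sigma> r) (poly_subst \<sigma> s)" using assms(2) by (rule subst_toE)
  show ?thesis unfolding subst_to_def
    by (rule exI[of _ "p * r"], rule exI[of _ "q * s"])
       (use pq rs in \<open>simp add: poly_subst_mult mult_fract\<close>)
qed

lemma subst_to_uminus [intro]:
  assumes "subst_to \<sigma> f g"
  shows "subst_to \<sigma> (- f) (- g)"
proof -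
  obtain p q where pq: "poly_subst \<sigma> q \<noteq> 0" "q \<noteq> 0" "f = Fraction_Field.Fract p q"
    "g = Fraction_Field.Fract (poly_subst \<sigma> p) (poly_subst \<sigma> q)" using assms(1) by (rule subst_toE)
  show ?thesis unfolding subst_to_def
    by (rule exI[of _ "- p"], rule exI[of _ q]) (use pq in \<open>simp add: poly_subst_uminus\<close>)
qed

lemma subst_to_diff [intro]:
  "subst_to \<sigma> f g \<Longrightarrow> subst_to \<sigma> f' g' \<Longrightarrow> subst_to \<sigma> (f - f') (g - g')"
  using subst_to_add[OF _ subst_to_uminus, of \<sigma> f g f' g'] by simp

text \<open>The condition on \<open>g\<close> says that the numerator of \<open>f\<close> survives
  the substitution; it becomes the new denominator.\<close>

lemma subst_to_inverse [intro]:
  assumes "subst_to \<sigma> f g" "g \<noteq> 0"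
  shows "subst_to \<sigma> (inverse f) (inverse g)"
proof -
  obtain p q where pq: "poly_subst \<sigma> q \<noteq> 0" "q \<noteq> 0" "f = Fraction_Field.Fract p q"
    "g = Fraction_Field.Fract (poly_subst \<sigma> p) (poly_subst \<sigma> q)" using assms(1) by (rule subst_toE)
  have "poly_subst \<sigma> p \<noteq> 0" using pq(4) assms(2) by (auto simp: fract_collapse)
  then show ?thesis unfolding subst_to_def
    by (intro exI[of _ q] exI[of _ p]) (use pq in simp)
qed

lemma subst_to_sum [intro]:
  "(\<And>x. x \<in> A \<Longrightarrow> subst_to \<sigma> (f x) (g x)) \<Longrightarrow> subst_to \<sigma> (sum f A) (sum g A)"
  by (induction A rule: infinite_finite_induct) auto

lemma subst_to_prod [intro]:
  "(\<And>x. x \<in> A \<Longrightarrow> subst_to \<sigma> (f x) (g x)) \<Longrightarrow> subst_to \<sigma> (prod f A) (prod g A)"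
  by (induction A rule: infinite_finite_induct) auto

lemma subst_to_of_bool [simp, intro]: "subst_to \<sigma> (of_bool b) (of_bool b)"
  by (cases b) auto

lemma subst_to_tvar [intro]:
  assumes "\<sigma> i = var j"
  shows "subst_to \<sigma> (tvar i) (tvar j)"
  unfolding subst_to_def tvar_def
  by (rule exI[of _ "var i"], rule exI[of _ 1]) (simp add: assms)

lemma tvar_nonzero [simp]: "tvar i \<noteq> 0"
  by (simp add: tvar_def Zero_fract_def eq_fract)

text \<open>The Leibniz formula is free of divisions, so no denominators arise beyond those of the
  entries.\<close>

lemma subst_to_fdet:
  assumes "finite V" "\<And>i j. i \<in> V \<Longrightarrow> j \<in> V \<Longrightarrow> subst_to \<sigma> (N i j) (N' i j)"
  shows "subst_to \<sigma> (fdet V N) (fdet V N')"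
proof -
  obtain xs where xs: "set xs = V" "distinct xs"
    using assms(1) finite_distinct_list by blast
  have sgn: "subst_to \<sigma> (signof p) (signof p)" for p :: "nat \<Rightarrow> nat"
    by (auto simp: sign_def)
  have perm: "p i < length xs" if "p permutes {0..<length xs}" "i < length xs" for p i
    using permutes_in_image[OF that(1), of i] that(2) by simp
  show ?thesis
    unfolding fdet_list[OF xs(2,1) refl] det_def
    by (auto intro!: subst_to_sum subst_to_mult subst_to_prod sgn assms(2)
        simp: perm xs(1)[symmetric] simp del: of_int_sum)
qed

lemma subst_to_closing_det:
  assumes "finite V" "\<And>i j. i \<in> V \<Longrightarrow> j \<in> V \<Longrightarrow> subst_to \<sigma> (K i j) (K' i j)"
    "\<And>i j. i \<in> V \<Longrightarrow> j \<in> V \<Longrightarrow> subst_to \<sigma> (S i j) (S' i j)"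
  shows "subst_to \<sigma> (closing_det V K S) (closing_det V K' S')"
  unfolding closing_det_def by (intro subst_to_fdet assms(1) subst_to_diff subst_to_of_bool
    subst_to_sum subst_to_mult assms(2,3))

section \<open>Orbits and connected components\<close>

text \<open>The equivalence relation generated by \<open>R\<close>. Faces and connected parts are
  both counted as its classes, so that the effect of one additional pair on the number of classes
  controls both.\<close>

definition conn :: "('b \<times> 'b) set \<Rightarrow> ('b \<times> 'b) set" where
  "conn R = (R \<union> R\<inverse>)\<^sup>*"

lemma equiv_conn: "equiv UNIV (conn R)"
  unfolding conn_def by (intro equivI refl_rtrancl trans_rtrancl sym_rtrancl) (auto simp: sym_def refl_on_def)

lemma conn_refl [simp, intro]: "(x, x) \<in> conn R"
  by (simp add: conn_def)

lemma conn_sym: "(x, y) \<in> conn R \<Longrightarrow> (y, x) \<in> conn R"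
  using equiv_conn[of R] by (auto simp: equiv_def sym_def)

lemma conn_trans: "(x, y) \<in> conn R \<Longrightarrow> (y, z) \<in> conn R \<Longrightarrow> (x, z) \<in> conn R"
  by (auto simp: conn_def)

lemma conn_base: "(x, y) \<in> R \<Longrightarrow> (x, y) \<in> conn R"
  by (auto simp: conn_def)

lemma conn_induct [consumes 1, case_names refl forward backward]:
  assumes "(x, y) \<in> conn R" "P x"
    and "\<And>y z. (x, y) \<in> conn R \<Longrightarrow> P y \<Longrightarrow> (y, z) \<in> R \<Longrightarrow> P z"
    and "\<And>y z. (x, y) \<in> conn R \<Longrightarrow> P y \<Longrightarrow> (z, y) \<in> R \<Longrightarrow> P z"
  shows "P y"
  using assms(1) unfolding conn_def
proof (induction rule: rtrancl_induct)
  case base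
  show ?case by (rule assms(2))
next
  case (step y z)
  then show ?case using assms(3,4)[of y z] by (auto simp: conn_def)
qed

lemma conn_subset:
  assumes "R \<subseteq> conn R'"
  shows "conn R \<subseteq> conn R'"
proof
  fix e assume "e \<in> conn R"
  then obtain x y where xy: "e = (x, y)" "(x, y) \<in> conn R" by (cases e) auto
  from xy(2) have "(x, y) \<in> conn R'"
    by (induction rule: conn_induct) (use assms in \<open>blast intro: conn_trans conn_sym\<close>)+
  then show "e \<in> conn R'" using xy by simp
qed

lemma conn_mono: "R \<subseteq> R' \<Longrightarrow> conn R \<subseteq> conn R'"
  by (rule conn_subset) (auto intro: conn_base)

lemma conn_class_eq: "conn R `` {x} = conn R `` {y} \<longleftrightarrow> (x, y) \<in> conn R"
  using eq_equiv_class_iff[OF equiv_conn, of x y R] by simp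

lemma conn_insert_connected:
  assumes "(a, b) \<in> conn R"
  shows "conn (insert (a, b) R) = conn R"
proof
  show "conn (insert (a, b) R) \<subseteq> conn R"
    by (rule conn_subset) (use assms in \<open>auto intro: conn_base\<close>)
qed (rule conn_mono, blast)

lemma conn_insert:
  "conn (insert (a, b) R) = {(x, y). (x, y) \<in> conn R \<or> (x, a) \<in> conn R \<and> (b, y) \<in> conn R \<or>
     (x, b) \<in> conn R \<and> (a, y) \<in> conn R}" (is "_ = ?E")
proof (intro equalityI subsetI)
  fix e assume "e \<in> conn (insert (a, b) R)"
  then obtain x y where xy: "e = (x, y)" "(x, y) \<in> conn (insert (a, b) R)" by (cases e) auto
  from xy(2) have "(x, y) \<in> ?E"
  proof (induction rule: conn_induct)
    case (forward y z)
    then have "(y, z) = (a, b) \<or> (y, z) \<in> conn R" by (auto intro: conn_base)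
    with forward.IH show ?case
      unfolding mem_Collect_eq case_prod_conv by (metis conn_refl conn_trans prod.inject)
  next
    case (backward y z)
    then have "(z, y) = (a, b) \<or> (y, z) \<in> conn R" by (auto intro: conn_base conn_sym)
    with backward.IH show ?case
      unfolding mem_Collect_eq case_prod_conv by (metis conn_refl conn_trans prod.inject)
  qed simp
  then show "e \<in> ?E" using xy by simp
next
  have sub: "(x, y) \<in> conn (insert (a, b) R)" if "(x, y) \<in> conn R" for x y
    using that conn_mono[of R "insert (a, b) R"] by blast
  have ab: "(a, b) \<in> conn (insert (a, b) R)" by (rule conn_base) simp
  fix e assume "e \<in> ?E"
  then obtain x y where "e = (x, y)" "(x, y) \<in> conn R \<or> (x, a) \<in> conn R \<and> (b, y) \<in> conn R \<or>
     (x, b) \<in> conn R \<and> (a, y) \<in> conn R" by blast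
  then show "e \<in> conn (insert (a, b) R)"
    using sub ab conn_sym[OF ab] by (metis conn_trans)
qed

text \<open>The new pair merges the classes of \<open>a\<close> and \<open>b\<close> and touches no
  other class.\<close>

lemma card_quotient_insert:
  assumes "finite A" "a \<in> A" "b \<in> A" "(a, b) \<notin> conn R"
  shows "card (A // conn R) = card (A // conn (insert (a, b) R)) + 1"
proof -
  let ?cl = "\<lambda>x. conn R `` {x}" and ?cl' = "\<lambda>x. conn (insert (a, b) R) `` {x}"
  let ?B = "A - (?cl a \<union> ?cl b)"
  have cl': "?cl' x = ?cl x" if "x \<in> ?B" for x
  proof -
    have "(x, a) \<notin> conn R" "(x, b) \<notin> conn R"
      using that conn_sym[of x a R] conn_sym[of x b R] by blast+
    then show ?thesis unfolding conn_insert by auto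
  qed
  have cl'_ab: "?cl' x = ?cl a \<union> ?cl b" if "x \<in> ?cl a \<union> ?cl b" for x
  proof -
    have "(x, y) \<in> conn (insert (a, b) R) \<longleftrightarrow> (a, y) \<in> conn R \<or> (b, y) \<in> conn R" for y
      unfolding conn_insert using that
      by (simp, metis conn_sym conn_trans)
    then show ?thesis by blast
  qed
  have split: "A = ?B \<union> (A \<inter> (?cl a \<union> ?cl b))" by blast
  have q: "A // S = (\<lambda>x. S `` {x}) ` A" for S
    by (auto simp: quotient_def)
  have "A // conn R = ?cl ` ?B \<union> {?cl a, ?cl b}"
  proof -
    have "?cl ` (A \<inter> (?cl a \<union> ?cl b)) = {?cl a, ?cl b}"
    proof (intro equalityI subsetI)
      fix C assume "C \<in> ?cl ` (A \<inter> (?cl a \<union> ?cl b))"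
      then obtain x where "C = ?cl x" "(a, x) \<in> conn R \<or> (b, x) \<in> conn R" by blast
      then show "C \<in> {?cl a, ?cl b}" using conn_class_eq[of R a x] conn_class_eq[of R b x] by auto
    qed (use assms in auto)
    then show ?thesis unfolding q by (subst split) (simp only: image_Un)
  qed
  moreover have "A // conn (insert (a, b) R) = ?cl ` ?B \<union> {?cl a \<union> ?cl b}"
  proof -
    have "?cl' ` (A \<inter> (?cl a \<union> ?cl b)) = {?cl a \<union> ?cl b}"
      using cl'_ab assms(2) by (auto simp: image_iff intro!: bexI[of _ a])
    moreover have "?cl' ` ?B = ?cl ` ?B" by (rule image_cong[OF refl cl'])
    ultimately show ?thesis unfolding q by (subst split) (simp only: image_Un)
  qed
  moreover have "?cl a \<notin> ?cl ` ?B" "?cl b \<notin> ?cl ` ?B" "?cl a \<union> ?cl b \<notin> ?cl ` ?B" "?cl a \<noteq> ?cl b"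
  proof -
    show "?cl a \<notin> ?cl ` ?B" "?cl b \<notin> ?cl ` ?B"
      using conn_class_eq[of R a] conn_class_eq[of R b] by blast+
    show "?cl a \<union> ?cl b \<notin> ?cl ` ?B"
    proof
      assume "?cl a \<union> ?cl b \<in> ?cl ` ?B"
      then obtain x where x: "x \<in> ?B" "?cl x = ?cl a \<union> ?cl b" by blast
      then have "(x, a) \<in> conn R" by blast
      then show False using x(1) conn_sym[of x a R] by blast
    qed
    show "?cl a \<noteq> ?cl b" using assms(4) conn_class_eq[of R a b] by blast
  qed
  moreover have "finite (?cl ` ?B)" using assms(1) by simp
  ultimately show ?thesis by simp
qed

lemma card_quotient_insert_le:
  assumes "finite A" "a \<in> A" "b \<in> A"
  shows "card (A // conn R) \<le> card (A // conn (insert (a, b) R)) + 1"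
    and "card (A // conn (insert (a, b) R)) \<le> card (A // conn R)"
proof -
  have "card (A // conn R) = card (A // conn (insert (a, b) R)) + (if (a, b) \<in> conn R then 0 else 1)"
    using card_quotient_insert[OF assms, of R] conn_insert_connected[of a b R] by auto
  then show "card (A // conn R) \<le> card (A // conn (insert (a, b) R)) + 1"
    and "card (A // conn (insert (a, b) R)) \<le> card (A // conn R)"
    by (simp_all split: if_splits)
qed

definition graph_of :: "'b set \<Rightarrow> ('b \<Rightarrow> 'b) \<Rightarrow> ('b \<times> 'b) set" where
  "graph_of H f = {(x, f x) |x. x \<in> H}"

text \<open>\<open>orbit\<close> moves forward along \<open>f\<close> only, \<open>conn\<close> in
  both directions. On a finite invariant set an injective \<open>f\<close> runs in cycles, so a
  backward step is also a forward path.\<close>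

lemma orbit_eq_conn:
  assumes "finite H" "f ` H \<subseteq> H" "inj f" "h \<in> H"
  shows "orbit f h = conn (graph_of H f) `` {h}"
proof (intro equalityI subsetI)
  fix y assume "y \<in> orbit f h"
  then have "y \<in> H \<and> (h, y) \<in> conn (graph_of H f)"
  proof (induction rule: orbit.induct)
    case base
    then show ?case using assms by (auto simp: graph_of_def intro: conn_base)
  next
    case (step y)
    then have "(y, f y) \<in> conn (graph_of H f)" by (auto simp: graph_of_def intro: conn_base)
    then show ?case using step assms(2) by (auto intro: conn_trans)
  qed
  then show "y \<in> conn (graph_of H f) `` {h}" by blast
next
  have self: "x \<in> orbit f x" if "x \<in> H" for x
  proof -
    have "(f ^^ n) x \<in> H" for n
      by (induction n) (use that assms(2) in auto)
    then have "finite {y. \<exists>n. y = (f ^^ n) x}"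
      by (auto intro: finite_subset[OF _ assms(1)])
    then obtain n where "n > 0" "(f ^^ n) x = x"
      using funpow_inj_finite[OF assms(3)] by blast
    then show ?thesis unfolding orbit_altdef by force
  qed
  fix y assume "y \<in> conn (graph_of H f) `` {h}"
  then have "(h, y) \<in> conn (graph_of H f)" by blast
  then show "y \<in> orbit f h"
  proof (induction rule: conn_induct)
    case refl
    then show ?case using self assms(4) .
  next
    case (forward y z)
    then show ?case by (auto simp: graph_of_def intro: orbit.step)
  next
    case (backward y z)
    then have z: "z \<in> H" "y = f z" by (auto simp: graph_of_def)
    have "w \<in> orbit f y \<or> w = y" if "w \<in> orbit f z" for w
      using that by (induction rule: orbit.induct) (auto simp: z intro: orbit.intros)
    with self[OF z(1)] have "z \<in> orbit f y \<or> z = y" by blast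
    then show ?case using backward.IH by (auto intro: orbit_trans)
  qed
qed

text \<open>Once \<open>a\<close> and \<open>b\<close> are identified, every \<open>x\<close> is
  equivalent to its image under the transposition, so both maps generate the same relation. The two
  orbit partitions thus have a common coarsening by a single pair.\<close>

lemma graph_of_transpose:
  assumes "a \<in> H" "b \<in> H"
  shows "conn (insert (a, b) (graph_of H (f \<circ> Transposition.transpose a b))) =
         conn (insert (a, b) (graph_of H f))"
proof -
  \<comment> \<open>Stated for every \<open>g\<close>, because composing with the transposition
    twice gives \<open>f\<close> back: the reverse inclusion is another instance.\<close>
  have sub: "conn (insert (a, b) (graph_of H (g \<circ> Transposition.transpose a b))) \<subseteq>
         conn (insert (a, b) (graph_of H g))" (is "conn ?R \<subseteq> conn ?R'") for g
  proof (rule conn_subset, rule subsetI)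
    fix e assume "e \<in> ?R"
    have ab: "(a, b) \<in> conn ?R'" by (rule conn_base) simp
    have fx: "(x, g x) \<in> conn ?R'" if "x \<in> H" for x
      using that by (auto simp: graph_of_def intro: conn_base)
    from \<open>e \<in> ?R\<close> consider "e = (a, b)" | x where "x \<in> H" "e = (x, g (Transposition.transpose a b x))"
      by (auto simp: graph_of_def)
    then show "e \<in> conn ?R'"
    proof cases
      case 1
      then show ?thesis using ab by simp
    next
      case 2
      then have "(x, Transposition.transpose a b x) \<in> conn ?R'" "Transposition.transpose a b x \<in> H"
        using ab conn_sym[OF ab] assms by (auto simp: Transposition.transpose_def)
      then show ?thesis using fx 2 conn_trans by metis
    qed
  qed
  have "(f \<circ> Transposition.transpose a b) \<circ> Transposition.transpose a b = f"
    by (auto simp: fun_eq_iff)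
  with sub[of f] sub[of "f \<circ> Transposition.transpose a b"] show ?thesis by auto
qed

text \<open>The first bound compares both partitions with their common coarsening. For the second,
  \<open>g\<close> sends \<open>a\<close> to \<open>f b\<close> and then follows the
  \<open>f\<close>-cycle of \<open>b\<close> round to \<open>b\<close>, so \<open>a\<close> and
  \<open>b\<close> end up on one cycle.\<close>

lemma card_orbits_transpose:
  assumes H: "finite H" "f ` H \<subseteq> H" "inj f" and ab: "a \<in> H" "b \<in> H"
  defines "g \<equiv> f \<circ> Transposition.transpose a b"
  shows "card (H // conn (graph_of H g)) \<le> card (H // conn (graph_of H f)) + 1"
    and "(a, b) \<notin> conn (graph_of H f) \<Longrightarrow>
      card (H // conn (graph_of H g)) + 1 \<le> card (H // conn (graph_of H f))"
proof -
  note eq = graph_of_transpose[OF ab, of f, folded g_def]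
  show "card (H // conn (graph_of H g)) \<le> card (H // conn (graph_of H f)) + 1"
    using card_quotient_insert_le(1)[OF H(1) ab, of "graph_of H g"]
      card_quotient_insert_le(2)[OF H(1) ab, of "graph_of H f"] eq by simp
  assume nab: "(a, b) \<notin> conn (graph_of H f)"
  have orb: "(f ^^ k) b \<in> H" "(b, (f ^^ k) b) \<in> conn (graph_of H f)" for k
  proof (induction k)
    case (Suc k)
    case 1
    then show ?case using Suc.IH H(2) by auto
  next
    case (Suc k)
    case 2
    have "((f ^^ k) b, f ((f ^^ k) b)) \<in> conn (graph_of H f)"
      using Suc.IH by (auto simp: graph_of_def intro: conn_base)
    then show ?case using Suc.IH by (auto intro: conn_trans)
  qed (use ab in auto)
  have "finite {y. \<exists>n. y = (f ^^ n) b}"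
    using orb(1) by (auto intro: finite_subset[OF _ H(1)])
  then obtain n0 where "n0 > 0" "(f ^^ n0) b = b"
    using funpow_inj_finite[OF H(3)] by blast
  then have ex: "\<exists>n. n > 0 \<and> (f ^^ n) b = b" by blast
  \<comment> \<open>The period of \<open>b\<close>. Strictly before it the iterates avoid
    \<open>b\<close>, and they never meet \<open>a\<close>, so \<open>g\<close> agrees with
    \<open>f\<close> on them.\<close>
  define n where "n = (LEAST n. n > 0 \<and> (f ^^ n) b = b)"
  have n: "n > 0" "(f ^^ n) b = b" using LeastI_ex[OF ex] by (auto simp: n_def)
  have least: "(f ^^ k) b \<noteq> b" if "0 < k" "k < n" for k
    using not_less_Least[of k "\<lambda>n. n > 0 \<and> (f ^^ n) b = b"] that by (auto simp: n_def)
  have "0 < k \<longrightarrow> k \<le> n \<longrightarrow> (a, (f ^^ k) b) \<in> conn (graph_of H g)" for k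
  proof (induction k)
    case (Suc k)
    show ?case
    proof (intro impI)
      assume "Suc k \<le> n"
      have edge: "(x, g x) \<in> conn (graph_of H g)" if "x \<in> H" for x
        using that by (auto simp: graph_of_def intro: conn_base)
      show "(a, (f ^^ Suc k) b) \<in> conn (graph_of H g)"
      proof (cases "k = 0")
        case True
        then show ?thesis using edge[OF ab(1)] by (simp add: g_def)
      next
        case False
        have "(f ^^ k) b \<noteq> b" using least[of k] False \<open>Suc k \<le> n\<close> by simp
        moreover have "(f ^^ k) b \<noteq> a" using orb(2)[of k] nab conn_sym by metis
        ultimately have "g ((f ^^ k) b) = (f ^^ Suc k) b"
          by (simp add: g_def)
        then show ?thesis
          using Suc.IH False \<open>Suc k \<le> n\<close> edge[OF orb(1)[of k]] by (auto intro: conn_trans)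
      qed
    qed
  qed simp
  from this[of n] n have "(a, b) \<in> conn (graph_of H g)" by simp
  then have "conn (graph_of H g) = conn (insert (a, b) (graph_of H f))"
    using conn_insert_connected[of a b "graph_of H g"] eq by simp
  then show "card (H // conn (graph_of H g)) + 1 \<le> card (H // conn (graph_of H f))"
    using card_quotient_insert[OF H(1) ab nab] by simp
qed

section \<open>Planarity of cut diagrams\<close>

lemma count_list_le_one_iff: "(\<forall>p. count_list xs p \<le> 1) \<longleftrightarrow> distinct xs"
proof (induction xs)
  case (Cons x xs)
  have "count_list (x # xs) p \<le> 1 \<longleftrightarrow> (p = x \<longrightarrow> count_list xs x = 0) \<and> count_list xs p \<le> 1" for p
    by auto
  then have "(\<forall>p. count_list (x # xs) p \<le> 1) \<longleftrightarrow> x \<notin> set xs \<and> (\<forall>p. count_list xs p \<le> 1)"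
    by (simp add: count_list_0_iff all_conj_distrib)
  then show ?case using Cons by simp
qed simp

lemma sum_count_list_eq_one:
  assumes "finite Y"
  shows "(\<Sum>y\<in>Y. count_list (w y) p) = 1 \<longleftrightarrow>
    (\<exists>y\<in>Y. count_list (w y) p = 1 \<and> (\<forall>y'\<in>Y. y' \<noteq> y \<longrightarrow> p \<notin> set (w y')))"
  unfolding sum_eq_1_iff[OF assms] count_list_0_iff by metis

lemma well_formed_iff:
  "well_formed D \<longleftrightarrow>
     finite (labels D) \<and> opens D \<inter> closeds D = {} \<and> (\<forall>y. y \<notin> labels D \<longrightarrow> word D y = []) \<and>
     (\<forall>y\<in>labels D. distinct (word D y)) \<and>
     (\<forall>y\<in>labels D. \<forall>y'\<in>labels D. y \<noteq> y' \<longrightarrow> set (word D y) \<inter> set (word D y') = {}) \<and>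
     (\<forall>c\<in>crossings D. \<forall>s. \<exists>y\<in>labels D. (c, s) \<in> set (word D y)) \<and>
     (\<forall>c. c \<notin> crossings D \<longrightarrow> mark D c = Virtual)"
proof (cases "finite (labels D)")
  case True
  let ?Y = "labels D" and ?w = "word D"
  have "(\<forall>c\<in>crossings D. \<forall>s. (\<Sum>y\<in>?Y. count_list (?w y) (c, s)) = 1) \<longleftrightarrow>
     (\<forall>y\<in>?Y. distinct (?w y)) \<and>
     (\<forall>y\<in>?Y. \<forall>y'\<in>?Y. y \<noteq> y' \<longrightarrow> set (?w y) \<inter> set (?w y') = {}) \<and>
     (\<forall>c\<in>crossings D. \<forall>s. \<exists>y\<in>?Y. (c, s) \<in> set (?w y))" (is "?lhs \<longleftrightarrow> ?rhs")
  proof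
    assume lhs: ?lhs
    have ex1: "\<exists>y\<in>?Y. count_list (?w y) p = 1 \<and> (\<forall>y'\<in>?Y. y' \<noteq> y \<longrightarrow> p \<notin> set (?w y'))"
      if "fst p \<in> crossings D" for p
      using lhs that unfolding sum_count_list_eq_one[OF True] by (cases p) auto
    have in_cr: "fst p \<in> crossings D" if "y \<in> ?Y" "p \<in> set (?w y)" for y p
      using that by (auto simp: crossings_def)
    have "distinct (?w y)" if "y \<in> ?Y" for y
    proof -
      have "count_list (?w y) p \<le> 1" for p
      proof (cases "p \<in> set (?w y)")
        case False
        then show ?thesis by (simp add: count_list_0_iff)
      next
        case p: True
        note ex1[OF in_cr[OF that p]]
        then obtain y0 where "y0 \<in> ?Y" "count_list (?w y0) p = 1" "\<forall>y'\<in>?Y. y' \<noteq> y0 \<longrightarrow> p \<notin> set (?w y')"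
          by blast
        then show ?thesis using p that by (cases "y = y0") auto
      qed
      then show ?thesis unfolding count_list_le_one_iff[symmetric] ..
    qed
    moreover have "set (?w y) \<inter> set (?w y') = {}" if "y \<in> ?Y" "y' \<in> ?Y" "y \<noteq> y'" for y y'
    proof (rule ccontr)
      assume "set (?w y) \<inter> set (?w y') \<noteq> {}"
      then obtain p where p: "p \<in> set (?w y)" "p \<in> set (?w y')" by blast
      note ex1[OF in_cr[OF that(1) p(1)]]
      then obtain y0 where "\<forall>y'\<in>?Y. y' \<noteq> y0 \<longrightarrow> p \<notin> set (?w y')"
        by blast
      then have "y = y0" "y' = y0" using p that by auto
      then show False using that by simp
    qed
    moreover have "\<exists>y\<in>?Y. (c, s) \<in> set (?w y)" if "c \<in> crossings D" for c s
    proof -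
      obtain y where "y \<in> ?Y" "count_list (?w y) (c, s) = 1" using ex1[of "(c, s)"] \<open>c \<in> crossings D\<close> by auto
      moreover from this(2) have "(c, s) \<in> set (?w y)"
        using count_list_0_iff[of "?w y" "(c, s)"] by fastforce
      ultimately show ?thesis by blast
    qed
    ultimately show ?rhs by blast
  next
    assume rhs: ?rhs
    show ?lhs unfolding sum_count_list_eq_one[OF True]
    proof (intro ballI allI)
      fix c s assume "c \<in> crossings D"
      then obtain y where y: "y \<in> ?Y" "(c, s) \<in> set (?w y)" using rhs by blast
      then have "count_list (?w y) (c, s) \<noteq> 0" by (simp add: count_list_0_iff)
      moreover have "distinct (?w y)" using rhs y(1) by blast
      then have "count_list (?w y) (c, s) \<le> 1" unfolding count_list_le_one_iff[symmetric] ..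
      ultimately have "count_list (?w y) (c, s) = 1" by linarith
      moreover have "\<forall>y'\<in>?Y. y' \<noteq> y \<longrightarrow> (c, s) \<notin> set (?w y')" using rhs y by blast
      ultimately show "\<exists>y\<in>?Y. count_list (?w y) (c, s) = 1 \<and> (\<forall>y'\<in>?Y. y' \<noteq> y \<longrightarrow> (c, s) \<notin> set (?w y'))"
        using y by blast
    qed
  qed
  then show ?thesis unfolding well_formed_def by (simp only: conj_assoc)
qed (simp add: well_formed_def)

lemma passage_unique:
  assumes "well_formed D" "p \<in> set (word D y)" "p \<in> set (word D y')"
  shows "y = y'"
proof -
  have "y \<in> labels D" "y' \<in> labels D" using assms unfolding well_formed_iff by force+
  then show ?thesis using assms unfolding well_formed_iff by blast
qed

lemma follows_open:
  "closeds D = {} \<Longrightarrow> follows D p q \<longleftrightarrow> (\<exists>y\<in>labels D. (p, q) \<in> pairs (word D y))"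
  by (simp add: follows_def pairs_split)

lemma finite_crossings: "well_formed D \<Longrightarrow> finite (crossings D)"
  by (simp add: well_formed_def crossings_def)

text \<open>All that the face permutation uses of \<open>follows\<close>: a partial injection
  between passages at double points in \<open>X\<close>. Fixing \<open>X\<close> lets a diagram and
  its cut version be compared on the same half-edges.\<close>

definition edge_relation :: "nat set \<Rightarrow> (passage \<Rightarrow> passage \<Rightarrow> bool) \<Rightarrow> bool" where
  "edge_relation X F \<longleftrightarrow> finite X \<and> (\<forall>p q. F p q \<longrightarrow> fst p \<in> X \<and> fst q \<in> X) \<and>
     (\<forall>p q q'. F p q \<longrightarrow> F p q' \<longrightarrow> q = q') \<and> (\<forall>p p' q. F p q \<longrightarrow> F p' q \<longrightarrow> p = p')"

lemma edge_relationD: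
  assumes "edge_relation X F" "F p q"
  shows "fst p \<in> X" "fst q \<in> X"
  using assms unfolding edge_relation_def by blast+

lemma edge_relation_follows:
  assumes "well_formed D" "closeds D = {}"
  shows "edge_relation (crossings D) (follows D)"
proof -
  have d: "distinct (word D y)" if "y \<in> labels D" for y
    using assms(1) that unfolding well_formed_iff by blast
  show ?thesis
    unfolding edge_relation_def follows_open[OF assms(2)]
  proof (intro conjI allI impI)
    fix p q assume "\<exists>y\<in>labels D. (p, q) \<in> pairs (word D y)"
    then show "fst p \<in> crossings D" "fst q \<in> crossings D"
      by (auto simp: crossings_def dest!: pairs_subset)
  next
    fix p q q' assume "\<exists>y\<in>labels D. (p, q) \<in> pairs (word D y)" "\<exists>y\<in>labels D. (p, q') \<in> pairs (word D y)"
    then obtain y y' where y: "y \<in> labels D" "(p, q) \<in> pairs (word D y)" "(p, q') \<in> pairs (word D y')" by blast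
    then have "y = y'" using passage_unique[OF assms(1), of p] pairs_subset by metis
    then show "q = q'" using y pairs_functional(1)[OF d[OF y(1)]] by metis
  next
    fix p p' q assume "\<exists>y\<in>labels D. (p, q) \<in> pairs (word D y)" "\<exists>y\<in>labels D. (p', q) \<in> pairs (word D y)"
    then obtain y y' where y: "y \<in> labels D" "(p, q) \<in> pairs (word D y)" "(p', q) \<in> pairs (word D y')" by blast
    then have "y = y'" using passage_unique[OF assms(1), of q] pairs_subset by metis
    then show "p = p'" using y pairs_functional(2)[OF d[OF y(1)]] by metis
  qed (rule finite_crossings[OF assms(1)])
qed

section \<open>The face permutation and the Euler characteristic\<close>

definition half_edges :: "nat set \<Rightarrow> half_edge set" where
  "half_edges X = {h. fst (fst h) \<in> X}"

lemma UNIV_side: "(UNIV :: side set) = {East, North}"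
  using side.exhaust by auto

lemma UNIV_direction: "(UNIV :: direction set) = {In, Out}"
  using direction.exhaust by auto

lemma finite_half_edges:
  assumes "finite X"
  shows "finite (half_edges X)"
proof -
  have "finite ((X \<times> (UNIV :: side set)) \<times> (UNIV :: direction set))"
    using assms by (simp add: UNIV_side UNIV_direction)
  moreover have "half_edges X \<subseteq> (X \<times> UNIV) \<times> UNIV"
    by (auto simp: half_edges_def)
  ultimately show ?thesis by (rule finite_subset[rotated])
qed

lemma inj_rot: "inj rot"
proof (rule injI)
  fix x y assume "rot x = rot y"
  then show "x = y"
    by (cases x rule: rot.cases; cases y rule: rot.cases) auto
qed

lemma fst_rot [simp]: "fst (fst (rot x)) = fst (fst x)"
  by (cases x rule: rot.cases) auto

context
  fixes D :: "'a diagram" and X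
  assumes on: "edge_relation X (follows D)"
begin

lemma glue_Out:
  assumes "follows D p q"
  shows "glue D (p, Out) = (q, In)"
proof -
  have "q' = q" if "follows D p q'" for q'
    using on assms that unfolding edge_relation_def by blast
  then have the: "(THE q. follows D p q) = q" using assms by (rule the_equality[rotated])
  have "\<exists>q. follows D p q" using assms by (rule exI)
  then show ?thesis by (simp only: glue.simps the if_True)
qed

lemma glue_In:
  assumes "follows D p q"
  shows "glue D (q, In) = (p, Out)"
proof -
  have "p' = p" if "follows D p' q" for p'
    using on assms that unfolding edge_relation_def by blast
  then have the: "(THE p. follows D p q) = p" using assms by (rule the_equality[rotated])
  have "\<exists>p. follows D p q" using assms by (rule exI)
  then show ?thesis by (simp only: glue.simps the if_True)
qed

lemma glue_cases:
  obtains (Out) p q where "h = (p, Out)" "follows D p q" "glue D h = (q, In)"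
  | (In) p q where "h = (q, In)" "follows D p q" "glue D h = (p, Out)"
  | (fixed) "glue D h = h" "\<forall>p. snd h = Out \<longrightarrow> \<not> follows D (fst h) p" "\<forall>p. snd h = In \<longrightarrow> \<not> follows D p (fst h)"
proof -
  obtain p d where h: "h = (p, d)" by (cases h)
  show ?thesis
  proof (cases d)
    case In
    show ?thesis
    proof (cases "\<exists>p'. follows D p' p")
      case True
      then show ?thesis using that(2) glue_In h In by blast
    next
      case False
      then show ?thesis using that(3) h In by simp
    qed
  next
    case Out
    show ?thesis
    proof (cases "\<exists>p'. follows D p p'")
      case True
      then show ?thesis using that(1) glue_Out h Out by blast
    next
      case False
      then show ?thesis using that(3) h Out by simp
    qed
  qed
qed

lemma glue_glue: "glue D (glue D h) = h"
  by (cases h rule: glue_cases) (auto simp: glue_In glue_Out simp del: glue.simps)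

lemma inj_face: "inj (rot \<circ> glue D)"
  by (rule inj_compose[OF inj_rot]) (metis glue_glue injI)

lemma face_half_edges: "(rot \<circ> glue D) ` half_edges X \<subseteq> half_edges X"
proof -
  have "glue D h \<in> half_edges X" if "h \<in> half_edges X" for h
    using that on by (cases h rule: glue_cases) (auto simp: half_edges_def dest: edge_relationD[OF on] simp del: glue.simps)
  then show ?thesis by (auto simp: half_edges_def)
qed

text \<open>Rotation stays at a double point and gluing follows an edge, so a face never leaves its
  connected part. Hence half-edges in different parts lie on different faces, as needed when
  \<open>euler_cut\<close> removes a bridge.\<close>

lemma face_connected:
  assumes "(h, h') \<in> conn (graph_of (half_edges X) (rot \<circ> glue D))"
  shows "(fst (fst h), fst (fst h')) \<in> conn {(c, d). \<exists>s t. follows D (c, s) (d, t)}"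
proof -
  let ?P = "{(c, d). \<exists>s t. follows D (c, s) (d, t)}"
  have step: "(fst (fst x), fst (fst ((rot \<circ> glue D) x))) \<in> conn ?P" for x
  proof (cases x rule: glue_cases)
    case (Out p q)
    then have "(fst p, fst q) \<in> ?P" by (cases p; cases q) auto
    then show ?thesis using Out by (auto intro: conn_base simp del: glue.simps)
  next
    case (In p q)
    then have "(fst p, fst q) \<in> ?P" by (cases p; cases q) auto
    then have "(fst q, fst p) \<in> conn ?P" by (rule conn_sym[OF conn_base])
    then show ?thesis using In by (simp del: glue.simps)
  next
    case fixed
    then show ?thesis by (simp del: glue.simps)
  qed
  from assms show ?thesis
  proof (induction rule: conn_induct)
    case (forward y z)
    then have "z = (rot \<circ> glue D) y" by (auto simp: graph_of_def)
    then show ?case using conn_trans[OF forward.IH step[of y]] by simp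
  next
    case (backward y z)
    then have "y = (rot \<circ> glue D) z" by (auto simp: graph_of_def)
    then show ?case using conn_trans[OF backward.IH] conn_sym[OF step[of z]] by simp
  qed simp
qed

end

text \<open>The defect in Euler's formula, summed over the connected parts. It is an integer because
  nonplanar gluings make it negative.\<close>

definition euler :: "'a diagram \<Rightarrow> int" where
  "euler D = int (card (crossings D)) + int (card (faces D)) - int (card (edges D)) - 2 * int (card (connected_parts D))"

lemma planar_euler: "planar D \<longleftrightarrow> euler D = 0"
  unfolding planar_def euler_def by linarith

lemma connected_parts_conn:
  "connected_parts D = crossings D // conn {(c, d). \<exists>s t. follows D (c, s) (d, t)}"
proof -
  have "{(c, d). \<exists>s t. follows D (c, s) (d, t) \<or> follows D (d, t) (c, s)} =
      {(c, d). \<exists>s t. follows D (c, s) (d, t)} \<union> {(c, d). \<exists>s t. follows D (c, s) (d, t)}\<inverse>"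
    by blast
  then show ?thesis unfolding connected_parts_def conn_def by simp
qed

lemma faces_conn:
  assumes on: "edge_relation (crossings D) (follows D)"
  shows "faces D = half_edges (crossings D) // conn (graph_of (half_edges (crossings D)) (rot \<circ> glue D))"
proof -
  have fin: "finite (half_edges (crossings D))" using on by (simp add: edge_relation_def finite_half_edges)
  show ?thesis
    unfolding faces_def half_edges_def[symmetric] quotient_def
    using orbit_eq_conn[OF fin face_half_edges[OF on] inj_face[OF on]] by auto
qed

text \<open>Removing an edge composes the face permutation with the transposition of its two
  half-edges. If the parts stay the same, the edge number drops by one and the face number by at
  most one. If the edge is a bridge, one part is added at a cost of 2, but its half-edges end on
  different faces, so the face number rises by at least one and compensates together with the lost
  edge.\<close>

lemma euler_cut:
  assumes on: "edge_relation (crossings D) (follows D)" and cr: "crossings D' = crossings D"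
    and F': "\<And>p q. follows D p q \<longleftrightarrow> follows D' p q \<or> p = p0 \<and> q = q0"
    and new: "\<And>q. \<not> follows D' p0 q" "\<And>p. \<not> follows D' p q0"
  shows "euler D \<le> euler D'"
proof -
  let ?X = "crossings D" and ?H = "half_edges (crossings D)"
  have on': "edge_relation ?X (follows D')"
    using on F' unfolding edge_relation_def by blast
  have fin: "finite ?X" "finite ?H" using on by (simp_all add: edge_relation_def finite_half_edges)
  have e0: "follows D p0 q0" using F' by blast
  then have in_X: "fst p0 \<in> ?X" "fst q0 \<in> ?X" using edge_relationD[OF on] by blast+
  let ?h = "(p0, Out)" and ?h' = "(q0, In)"
  have hH: "?h \<in> ?H" "?h' \<in> ?H" using in_X by (auto simp: half_edges_def)
  have "glue D x = glue D' (Transposition.transpose ?h ?h' x)" for x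
  proof (cases "x = ?h \<or> x = ?h'")
    case True
    then show ?thesis using glue_Out[OF on e0] glue_In[OF on e0] new by auto
  next
    case False
    then have t: "Transposition.transpose ?h ?h' x = x" by (auto simp: Transposition.transpose_def)
    have "glue D x = glue D' x"
    proof (cases x rule: glue_cases[OF on', case_names Out In fixed])
      case (Out p q)
      then show ?thesis using F' glue_Out[OF on, of p q] by (simp del: glue.simps)
    next
      case (In p q)
      then show ?thesis using F' glue_In[OF on, of p q] by (simp del: glue.simps)
    next
      case fixed
      obtain p d where "x = (p, d)" by (cases x)
      then have "glue D x = x" using fixed F' False by (cases d) auto
      then show ?thesis using fixed by simp
    qed
    then show ?thesis unfolding t .
  qed
  then have f: "rot \<circ> glue D = (rot \<circ> glue D') \<circ> Transposition.transpose ?h ?h'"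
    by (simp add: fun_eq_iff)
  have faces: "faces D = ?H // conn (graph_of ?H (rot \<circ> glue D))"
      "faces D' = ?H // conn (graph_of ?H (rot \<circ> glue D'))"
    using faces_conn[OF on] faces_conn[of D'] on' cr by simp_all
  note T = card_orbits_transpose[OF fin(2) face_half_edges[OF on'] inj_face[OF on'] hH,
      folded f, folded faces]
  have "edges D = insert (p0, q0) (edges D')" "(p0, q0) \<notin> edges D'"
    using F' new by (auto simp: edges_def)
  moreover have "finite (edges D')"
  proof (rule finite_subset)
    show "edges D' \<subseteq> (?X \<times> UNIV) \<times> (?X \<times> UNIV)"
      using edge_relationD[OF on'] by (fastforce simp: edges_def)
    show "finite ((?X \<times> (UNIV :: side set)) \<times> (?X \<times> (UNIV :: side set)))"
      using fin by (simp add: UNIV_side)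
  qed
  ultimately have E: "card (edges D) = card (edges D') + 1" by simp
  let ?P = "\<lambda>D. {(c, d). \<exists>s t. follows D (c, s) (d, t)}"
  have P: "?P D = insert (fst p0, fst q0) (?P D')"
    unfolding F' by (cases p0; cases q0) auto
  show ?thesis
  proof (cases "(fst p0, fst q0) \<in> conn (?P D')")
    case True
    then have "connected_parts D = connected_parts D'"
      unfolding connected_parts_conn P cr by (simp add: conn_insert_connected)
    then show ?thesis using T(1) E cr unfolding euler_def by simp
  next
    case False
    then have "card (connected_parts D') = card (connected_parts D) + 1"
      unfolding connected_parts_conn P cr by (rule card_quotient_insert[OF fin(1) in_X])
    moreover have "(?h, ?h') \<notin> conn (graph_of ?H (rot \<circ> glue D'))"
      using face_connected[OF on', of ?h ?h'] False by auto
    ultimately show ?thesis using T(2) E cr unfolding euler_def by simp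
  qed
qed

text \<open>Without edges the face permutation is \<open>rot\<close>, which cycles through the four
  half-edges of a double point. So every double point is one face and one part of its own.\<close>

lemma euler_no_edges:
  assumes "finite (crossings D)" "\<And>p q. \<not> follows D p q"
  shows "euler D = 0"
proof -
  let ?X = "crossings D"
  have on: "edge_relation ?X (follows D)" using assms by (simp add: edge_relation_def)
  have glue: "glue D = id"
  proof
    fix x show "glue D x = id x" using assms(2) by (cases x rule: glue_cases[OF on]) auto
  qed
  have "orbit rot h = {x :: half_edge. fst (fst x) = fst (fst h)}" for h
  proof (intro equalityI subsetI)
    fix x assume "x \<in> orbit rot h"
    then show "x \<in> {x :: half_edge. fst (fst x) = fst (fst h)}"
      by (induction rule: orbit.induct) auto
  next
    fix x :: half_edge assume "x \<in> {x. fst (fst x) = fst (fst h)}"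
    then have x: "fst (fst x) = fst (fst h)" by simp
    have 4: "rot (rot (rot (rot h))) = h"
      by (cases h rule: rot.cases) auto
    have "x \<in> {rot h, rot (rot h), rot (rot (rot h)), rot (rot (rot (rot h)))}"
      using x by (cases x rule: rot.cases; cases h rule: rot.cases) auto
    moreover have "rot h \<in> orbit rot h" "rot (rot h) \<in> orbit rot h" "rot (rot (rot h)) \<in> orbit rot h"
        "rot (rot (rot (rot h))) \<in> orbit rot h"
      by (intro orbit.intros)+
    ultimately show "x \<in> orbit rot h" by blast
  qed
  then have "faces D = (\<lambda>c. {x. fst (fst x) = c}) ` (\<lambda>h. fst (fst h)) ` {h :: half_edge. fst (fst h) \<in> ?X}"
    unfolding faces_def glue by (simp add: image_image)
  also have "(\<lambda>h. fst (fst h)) ` {h :: half_edge. fst (fst h) \<in> ?X} = ?X"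
  proof -
    have "c \<in> (\<lambda>h. fst (fst h)) ` {h :: half_edge. fst (fst h) \<in> ?X}" if "c \<in> ?X" for c
      by (rule image_eqI[of _ _ "((c, East), In)"]) (use that in auto)
    then show ?thesis by blast
  qed
  finally have faces: "faces D = (\<lambda>c. {x :: half_edge. fst (fst x) = c}) ` ?X" .
  have "inj_on (\<lambda>c. {x :: half_edge. fst (fst x) = c}) ?X"
  proof (rule inj_onI)
    fix c d assume *: "{x :: half_edge. fst (fst x) = c} = {x. fst (fst x) = d}"
    have "((c, East), In) \<in> {x :: half_edge. fst (fst x) = c}" by simp
    then show "c = d" unfolding * by simp
  qed
  then have "card (faces D) = card ?X" unfolding faces by (rule card_image)
  moreover have "edges D = {}" using assms(2) by (simp add: edges_def)
  moreover have "connected_parts D = (\<lambda>c. {c}) ` ?X"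
    unfolding connected_parts_conn conn_def using assms(2) by (auto simp: quotient_def)
  then have "card (connected_parts D) = card ?X" by (simp add: card_image)
  ultimately show ?thesis unfolding euler_def by simp
qed

text \<open>Undoes a stitching whose connecting arc meets no double point: crossings and marks stay,
  and only the edge between \<open>u\<close> and \<open>w\<close> disappears.\<close>

definition cut_strand :: "'a \<Rightarrow> 'a \<Rightarrow> passage list \<Rightarrow> passage list \<Rightarrow> 'a diagram \<Rightarrow> 'a diagram" where
  "cut_strand y y' u w D = D\<lparr>opens := insert y' (opens D), word := (word D)(y := u, y' := w)\<rparr>"

context
  fixes D :: "'a diagram" and y y' u w
  assumes wf: "well_formed D" and op: "closeds D = {}" and y: "y \<in> opens D" and y': "y' \<notin> opens D"
    and word: "word D y = u @ w"
begin

lemma cut_strand_simps: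
  "opens (cut_strand y y' u w D) = insert y' (opens D)" "closeds (cut_strand y y' u w D) = {}"
  "labels (cut_strand y y' u w D) = insert y' (opens D)"
  "mark (cut_strand y y' u w D) = mark D"
  "word (cut_strand y y' u w D) = (word D)(y := u, y' := w)"
  using op by (simp_all add: cut_strand_def labels_def)

lemma labels_open: "labels D = opens D"
  using op by (simp add: labels_def)

lemma cut_distinct: "distinct (u @ w)"
  using wf y word labels_open unfolding well_formed_iff by metis

lemma crossings_cut: "crossings (cut_strand y y' u w D) = crossings D"
proof -
  let ?w = "(word D)(y := u, y' := w)"
  have "y \<noteq> y'" using y y' by auto
  then have w: "?w y = u" "?w y' = w" by simp_all
  have new: "insert y' (opens D) = insert y (insert y' (opens D - {y}))"
    and old: "opens D = insert y (opens D - {y})" using y by auto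
  have rest: "(\<Union>z\<in>opens D - {y}. fst ` set (?w z)) = (\<Union>z\<in>opens D - {y}. fst ` set (word D z))"
    by (rule SUP_cong[OF refl]) (use y' in auto)
  have "(\<Union>z\<in>insert y' (opens D). fst ` set (?w z)) = (\<Union>z\<in>opens D. fst ` set (word D z))"
    by (subst new, subst old) (simp only: UN_insert rest w word set_append image_Un Un_assoc)
  then show ?thesis
    unfolding crossings_def cut_strand_simps labels_open .
qed

lemma cut_well_formed: "well_formed (cut_strand y y' u w D)"
proof -
  let ?w = "(word D)(y := u, y' := w)"
  have neq: "y \<noteq> y'" using y y' by auto
  note wf' = wf[unfolded well_formed_iff labels_open]
  note d = cut_distinct
  have disj: "set (word D z) \<inter> set (word D z') = {}" if "z \<noteq> z'" for z z'
    using passage_unique[OF wf, of _ z z'] that by blast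
  have sub: "set (?w z) \<subseteq> set (word D (if z = y' then y else z))" for z
    using word neq by auto
  show ?thesis
    unfolding well_formed_iff crossings_cut cut_strand_simps
  proof (intro conjI ballI allI impI)
    show "finite (insert y' (opens D))" using wf' by simp
    show "insert y' (opens D) \<inter> {} = {}" by simp
    show "?w z = []" if "z \<notin> insert y' (opens D)" for z
      using that wf' y by auto
    show "distinct (?w z)" if "z \<in> insert y' (opens D)" for z
      using that wf' d by auto
    show "set (?w z) \<inter> set (?w z') = {}" if "z \<noteq> z'" for z z'
    proof (cases "{z, z'} = {y, y'}")
      case True
      then have "{?w z, ?w z'} = {u, w}" using neq by (auto simp: doubleton_eq_iff)
      then show ?thesis using d by (auto simp: doubleton_eq_iff)
    next
      case False
      then have "(if z = y' then y else z) \<noteq> (if z' = y' then y else z')"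
        using that by (auto split: if_splits)
      then show ?thesis using sub[of z] sub[of z'] disj by blast
    qed
    show "\<exists>z\<in>insert y' (opens D). (c, s) \<in> set (?w z)" if "c \<in> crossings D" for c s
    proof -
      obtain z where z: "z \<in> opens D" "(c, s) \<in> set (word D z)" using wf' \<open>c \<in> crossings D\<close> by blast
      show ?thesis
      proof (cases "z = y")
        case True
        then have "(c, s) \<in> set (?w y) \<or> (c, s) \<in> set (?w y')" using z word neq by auto
        then show ?thesis using y by blast
      next
        case False
        then have "(c, s) \<in> set (?w z)" using z y' by auto
        then show ?thesis using z by blast
      qed
    qed
    show "mark D c = Virtual" if "c \<notin> crossings D" for c using wf' that by blast
  qed
qed

lemma follows_cut:
  assumes "u \<noteq> []" "w \<noteq> []"
  shows "follows D p q \<longleftrightarrow> follows (cut_strand y y' u w D) p q \<or> p = last u \<and> q = hd w"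
    and "\<not> follows (cut_strand y y' u w D) (last u) q"
    and "\<not> follows (cut_strand y y' u w D) p (hd w)"
proof -
  let ?w = "(word D)(y := u, y' := w)" and ?D = "cut_strand y y' u w D"
  have neq: "y \<noteq> y'" using y y' by auto
  have f: "follows ?D p q \<longleftrightarrow> (\<exists>z\<in>opens D - {y}. (p, q) \<in> pairs (word D z)) \<or> (p, q) \<in> pairs u \<or> (p, q) \<in> pairs w"
    for p q
  proof -
    have "insert y' (opens D) = insert y (insert y' (opens D - {y}))" using y by auto
    moreover have "?w z = word D z" if "z \<in> opens D - {y}" for z using that y' by auto
    moreover have "?w y = u" "?w y' = w" using neq by simp_all
    ultimately show ?thesis
      unfolding follows_open[OF cut_strand_simps(2)] cut_strand_simps by (metis insertE insertI1 insertI2)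
  qed
  have g: "follows D p q \<longleftrightarrow> (\<exists>z\<in>opens D - {y}. (p, q) \<in> pairs (word D z)) \<or> (p, q) \<in> pairs (u @ w)" for p q
    unfolding follows_open[OF op] labels_open word[symmetric] using y by blast
  show "follows D p q \<longleftrightarrow> follows ?D p q \<or> p = last u \<and> q = hd w"
    unfolding f g using assms by (auto simp: pairs_append)
  have lu: "last u \<in> set (word D y)" "hd w \<in> set (word D y)" using assms word by auto
  have other: "p \<notin> set (word D z)" if "z \<noteq> y" "p \<in> set (word D y)" for z p
    using passage_unique[OF wf, of p y z] that by blast
  have d: "distinct u" "distinct w" "set u \<inter> set w = {}" using cut_distinct by auto
  show "\<not> follows ?D (last u) q"
  proof
    assume "follows ?D (last u) q"
    then consider z where "z \<noteq> y" "(last u, q) \<in> pairs (word D z)" | "(last u, q) \<in> pairs u" | "(last u, q) \<in> pairs w"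
      unfolding f by blast
    then show False
    proof cases
      case 1
      then show False using other[OF 1(1) lu(1)] pairs_subset by metis
    next
      case 2
      then show False using pairs_hd_last(1)[OF d(1)] by blast
    next
      case 3
      then show False using pairs_subset[OF 3] d(3) last_in_set[OF assms(1)] by blast
    qed
  qed
  show "\<not> follows ?D p (hd w)"
  proof
    assume "follows ?D p (hd w)"
    then consider z where "z \<noteq> y" "(p, hd w) \<in> pairs (word D z)" | "(p, hd w) \<in> pairs u" | "(p, hd w) \<in> pairs w"
      unfolding f by blast
    then show False
    proof cases
      case 1
      then show False using other[OF 1(1) lu(2)] pairs_subset by metis
    next
      case 2
      then show False using pairs_subset[OF 2] d(3) hd_in_set[OF assms(2)] by blast
    next
      case 3
      then show False using pairs_hd_last(2)[OF d(2)] by blast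
    qed
  qed
qed

lemma euler_cut_strand: "u \<noteq> [] \<Longrightarrow> w \<noteq> [] \<Longrightarrow> euler D \<le> euler (cut_strand y y' u w D)"
  by (rule euler_cut[OF edge_relation_follows[OF wf op] crossings_cut])
     (use follows_cut in blast)+

end

text \<open>The measure counts pairs of consecutive passages; the truncated subtraction lets an
  empty word count as zero. A cut after the first passage destroys one pair.\<close>

lemma cut_strand_shorter:
  assumes wf: "well_formed D" and op: "closeds D = {}" and y: "y \<in> opens D" and y': "y' \<notin> opens D"
    and word: "word D y = p # q # v"
  shows "(\<Sum>z\<in>opens (cut_strand y y' [p] (q # v) D). length (word (cut_strand y y' [p] (q # v) D) z) - 1) <
    (\<Sum>z\<in>opens D. length (word D z) - 1)"
proof -
  let ?D = "cut_strand y y' [p] (q # v) D"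
  have word': "word D y = [p] @ (q # v)" using word by simp
  have fin: "finite (opens D)" using wf op by (simp add: well_formed_def labels_def)
  have "(\<Sum>z\<in>opens ?D. length (word ?D z) - 1) =
      (\<Sum>z\<in>opens D. length (((word D)(y := [p])) z) - 1) + length v"
  proof -
    have "(\<Sum>z\<in>opens ?D. length (word ?D z) - 1) =
      length v + (\<Sum>z\<in>opens D. length (word ?D z) - 1)"
      unfolding cut_strand_simps[OF wf op y y' word'] using fin y' by simp
    also have "(\<Sum>z\<in>opens D. length (word ?D z) - 1) = (\<Sum>z\<in>opens D. length (((word D)(y := [p])) z) - 1)"
      unfolding cut_strand_simps[OF wf op y y' word'] using y' by (intro sum.cong) auto
    finally show ?thesis by simp
  qed
  also have "\<dots> < (\<Sum>z\<in>opens D. length (word D z) - 1)"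
  proof -
    have "(\<Sum>z\<in>opens D. length (((word D)(y := [p])) z) - 1) =
        (\<Sum>z\<in>opens D - {y}. length (word D z) - 1)"
      using fin y word by (subst sum.remove[of _ y]) (auto intro!: sum.cong)
    moreover have "(\<Sum>z\<in>opens D. length (word D z) - 1) =
        length v + 1 + (\<Sum>z\<in>opens D - {y}. length (word D z) - 1)"
      using fin y word by (subst sum.remove[of _ y]) auto
    ultimately show ?thesis by simp
  qed
  finally show ?thesis .
qed

text \<open>Cutting never lowers \<open>euler\<close> and ends at a diagram without edges, where it
  is zero. Planarity is not assumed, and infinitely many labels provide a name for each new
  strand.\<close>

lemma euler_le_zero:
  fixes D :: "'a::infinite diagram"
  assumes "well_formed D" "closeds D = {}"
  shows "euler D \<le> 0"
  using assms
proof (induction "\<Sum>y\<in>opens D. length (word D y) - 1" arbitrary: D rule: less_induct)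
  case less
  note wf = less.prems(1) and op = less.prems(2)
  show ?case
  proof (cases "\<exists>y\<in>opens D. \<exists>p q v. word D y = p # q # v")
    case True
    then obtain y p q v where y: "y \<in> opens D" "word D y = [p] @ (q # v)" by auto
    have fin: "finite (opens D)" using wf op by (simp add: well_formed_def labels_def)
    obtain y' where y': "y' \<notin> opens D" using ex_new_if_finite[OF infinite_UNIV fin] by blast
    let ?D = "cut_strand y y' [p] (q # v) D"
    have "euler ?D \<le> 0"
      by (rule less.hyps[OF cut_strand_shorter[OF wf op y(1) y']]) (use y(2) cut_well_formed[OF wf op y(1) y' y(2)] cut_strand_simps[OF wf op y(1) y' y(2)] in auto)
    then show ?thesis using euler_cut_strand[OF wf op y(1) y' y(2)] by simp
  next
    case False
    have "pairs (word D y) = {}" if "y \<in> opens D" for y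
    proof -
      consider "word D y = []" | a where "word D y = [a]" | a b xs where "word D y = a # b # xs"
        by (metis list.exhaust)
      then show ?thesis using False that by cases auto
    qed
    then have "\<not> follows D p q" for p q
      unfolding follows_open[OF op] using op by (simp add: labels_def)
    then show ?thesis using euler_no_edges[of D] finite_crossings[OF wf] by simp
  qed
qed

text \<open>Planarity by squeezing: \<open>euler\<close> starts at zero, does not fall under the cut
  and cannot exceed zero.\<close>

lemma is_diagram_cut:
  fixes D :: "'a::infinite diagram"
  assumes "is_diagram D" "closeds D = {}" "y \<in> opens D" "y' \<notin> opens D" "word D y = u @ w"
    and "u \<noteq> []" "w \<noteq> []"
  shows "is_diagram (cut_strand y y' u w D)"
proof -
  have wf: "well_formed D" using assms(1) by (simp add: is_diagram_def)
  note ctx = wf assms(2-5)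
  have "euler D = 0" using assms(1) by (simp add: is_diagram_def planar_euler)
  then have "euler (cut_strand y y' u w D) = 0"
    using euler_cut_strand[OF ctx assms(6,7)]
      euler_le_zero[OF cut_well_formed[OF ctx] cut_strand_simps(2)[OF ctx]] by simp
  then show ?thesis
    using cut_well_formed[OF ctx] by (simp add: is_diagram_def planar_euler)
qed

lemma is_diagram_short_words:
  assumes "well_formed D" "closeds D = {}" "\<And>y. length (word D y) \<le> 1"
  shows "is_diagram D"
proof -
  have "pairs (word D y) = {}" for y
    using assms(3)[of y] by (cases "word D y") auto
  then have "\<not> follows D p q" for p q
    unfolding follows_open[OF assms(2)] by simp
  then show ?thesis
    using euler_no_edges[of D] finite_crossings[OF assms(1)] assms(1) by (simp add: is_diagram_def planar_euler)
qed

section \<open>Local moves\<close>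

lemma fill_simps [simp]:
  "fill us [] = []" "fill us (Inl p # w) = p # fill us w" "fill us (Inr i # w) = us ! i @ fill us w"
  "fill us (w @ w') = fill us w @ fill us w'"
  by (simp_all add: fill_def)

lemma fill_cong: "(\<And>i. Inr i \<in> set w \<Longrightarrow> us ! i = vs ! i) \<Longrightarrow> fill us w = fill vs w"
proof (induction w)
  case (Cons a w)
  then show ?case by (cases a) auto
qed simp

lemma filter_fill:
  "(\<And>i. Inr i \<in> set w \<Longrightarrow> i < length us) \<Longrightarrow>
    filter P (fill us w) = fill (map (filter P) us) (filter (case_sum P (\<lambda>_. True)) w)"
proof (induction w)
  case (Cons a w)
  then show ?case by (cases a) auto
qed simp

lemma set_fill: "set (fill us w) = {p. Inl p \<in> set w} \<union> (\<Union>i\<in>{i. Inr i \<in> set w}. set (us ! i))"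
proof (induction w)
  case (Cons a w)
  then show ?case by (cases a) auto
qed simp

text \<open>The condition on the pattern in \<open>local_move\<close>, detached from the two
  diagrams so that it survives restriction to the real passages.\<close>

definition template :: "'a set \<Rightarrow> nat \<Rightarrow> ('a \<Rightarrow> (passage + nat) list) \<Rightarrow> bool" where
  "template Y n W \<longleftrightarrow> finite Y \<and> (\<forall>i<n. (\<Sum>y\<in>Y. count_list (W y) (Inr i)) = 1) \<and>
     (\<forall>y. \<forall>i. Inr i \<in> set (W y) \<longrightarrow> y \<in> Y \<and> i < n)"

lemma count_list_filter: "count_list (filter P w) x = (if P x then count_list w x else 0)"
  by (induction w) auto

lemma template_filter:
  assumes "template Y n W"
  shows "template Y n (\<lambda>y. filter (case_sum P (\<lambda>_. True)) (W y))"
  using assms unfolding template_def by (auto simp: count_list_filter)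

text \<open>The leading \<open>Inl y\<close> keeps a word nonempty when its holes are emptied, and
  gives \<open>filled\<close> the shape of \<open>strand_nodes\<close> below.\<close>

definition filled :: "('a \<Rightarrow> (passage + nat) list) \<Rightarrow> passage list list \<Rightarrow> 'a \<Rightarrow> ('a + passage) list" where
  "filled W us y = Inl y # map Inr (fill us (W y))"

text \<open>Since hole \<open>i\<close> occurs exactly once, changing its content is a function
  update at a single strand \<open>z\<close>. This makes the lemmas about \<open>L(z := ...)\<close>
  applicable to holes.\<close>

lemma template_hole:
  assumes T: "template Y n W" and i: "i < n" and len: "length us = n"
  obtains z P Q where "z \<in> Y" "filled W us z = Inl z # map Inr (P @ us ! i @ Q)"
    "\<And>v. filled W (us[i := v]) = (filled W us)(z := Inl z # map Inr (P @ v @ Q))"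
proof -
  have fin: "finite Y" and "(\<Sum>y\<in>Y. count_list (W y) (Inr i)) = 1"
    using T i by (auto simp: template_def)
  then obtain z where z: "z \<in> Y" "count_list (W z) (Inr i) = 1"
      "\<forall>y\<in>Y. y \<noteq> z \<longrightarrow> Inr i \<notin> set (W y)"
    unfolding sum_count_list_eq_one[OF fin] by blast
  have other: "Inr i \<notin> set (W y)" if "y \<noteq> z" for y
    using T z(3) that unfolding template_def by blast
  have "count_list (W z) (Inr i) \<noteq> 0" using z(2) by simp
  then have "Inr i \<in> set (W z)" by (simp add: count_list_0_iff)
  from split_list_first[OF this] obtain P Q where W: "W z = P @ Inr i # Q" "Inr i \<notin> set P"
    by blast
  then have Q: "Inr i \<notin> set Q" using z(2) by (simp add: count_list_0_iff)
  have upd: "fill (us[i := v]) w = fill us w" if "Inr i \<notin> set w" for v w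
    by (rule fill_cong, rule nth_list_update_neq) (use that in auto)
  show ?thesis
  proof (rule that[OF z(1)])
    show "filled W us z = Inl z # map Inr (fill us P @ us ! i @ fill us Q)"
      by (simp add: filled_def W)
    show "filled W (us[i := v]) = (filled W us)(z := Inl z # map Inr (fill us P @ v @ fill us Q))" for v
    proof
      fix y show "filled W (us[i := v]) y = ((filled W us)(z := Inl z # map Inr (fill us P @ v @ fill us Q))) y"
      proof (cases "y = z")
        case True
        then show ?thesis using i len by (simp add: filled_def W upd[OF W(2)] upd[OF Q])
      next
        case False
        then show ?thesis by (simp add: filled_def upd[OF other[OF False]])
      qed
    qed
  qed
qed

context
  fixes Y :: "'a set" and n W
  assumes T: "template Y n W"
begin

lemma strands_filled_update:
  assumes "strands Y (filled W us)" "i < n" "length us = n" "set v \<subseteq> set (us ! i)" "distinct v"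
  shows "strands Y (filled W (us[i := v]))"
proof -
  obtain z P Q where z: "z \<in> Y" "filled W us z = Inl z # map Inr (P @ us ! i @ Q)"
    "\<And>v. filled W (us[i := v]) = (filled W us)(z := Inl z # map Inr (P @ v @ Q))"
    using template_hole[OF T assms(2,3)] by blast
  have "distinct (P @ us ! i @ Q)"
    using strandsD(2)[OF assms(1) z(1)] unfolding z(2) distinct.simps distinct_map by blast
  then have "distinct (P @ v @ Q)" using assms(4,5) by auto
  then have dist: "distinct (Inl z # map Inr (P @ v @ Q) :: ('a + passage) list)"
    unfolding distinct.simps distinct_map by auto
  show ?thesis
    unfolding z(3) by (rule strands_update[OF assms(1) _ dist z(1)]) (use assms(4) z(2) in auto)
qed

lemma filled_stitch:
  fixes K :: "'a + passage \<Rightarrow> 'a + passage \<Rightarrow> 'f::field"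
  assumes "strands Y (filled W us)" "i < n" "length us = n" "us ! i = [a, b]" "K (Inr b) (Inr a) = 0"
  shows "word_det Y (filled W us) Z K = word_det Y (filled W (us[i := [a]])) Z
    (\<lambda>x y. K x ((id(Inr a := Inr b)) y) + K x (Inr a) * K (Inr b) ((id(Inr a := Inr b)) y))"
proof -
  obtain z P Q where z: "z \<in> Y" "filled W us z = Inl z # map Inr (P @ us ! i @ Q)"
    "\<And>v. filled W (us[i := v]) = (filled W us)(z := Inl z # map Inr (P @ v @ Q))"
    using template_hole[OF T assms(2,3)] by blast
  have L: "filled W us z = (Inl z # map Inr P) @ [Inr a, Inr b] @ map Inr Q"
    by (simp add: z(2) assms(4))
  show ?thesis
    using word_det_stitch[where K = K, OF assms(1) z(1) L assms(5)] by (simp add: z(3))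
qed

lemma filled_stitch_second:
  fixes K :: "'a + passage \<Rightarrow> 'a + passage \<Rightarrow> 'f::field"
  assumes "strands Y (filled W us)" "i < n" "length us = n" "us ! i = [b, a]" "K (Inr a) (Inr b) = 0"
  shows "word_det Y (filled W us) Z K = word_det Y (filled W (us[i := [a]])) Z
    (\<lambda>x y. K ((id(Inr a := Inr b)) x) y + K ((id(Inr a := Inr b)) x) (Inr b) * K (Inr a) y)"
proof -
  obtain z P Q where z: "z \<in> Y" "filled W us z = Inl z # map Inr (P @ us ! i @ Q)"
    "\<And>v. filled W (us[i := v]) = (filled W us)(z := Inl z # map Inr (P @ v @ Q))"
    using template_hole[OF T assms(2,3)] by blast
  have L: "filled W us z = (Inl z # map Inr P) @ [Inr b, Inr a] @ map Inr Q"
    by (simp add: z(2) assms(4))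
  show ?thesis
    using word_det_stitch_second[where K = K, OF assms(1) z(1) L assms(5)] by (simp add: z(3))
qed

lemma filled_delete:
  fixes K :: "'a + passage \<Rightarrow> 'a + passage \<Rightarrow> 'f::field"
  assumes "strands Y (filled W us)" "i < n" "length us = n" "us ! i = [a]" "K (Inr a) (Inr a) = 1"
    and "\<And>x. x \<in> nodes Y (filled W us) \<Longrightarrow> x \<noteq> Inr a \<Longrightarrow> K (Inr a) x = 0"
    and "\<And>x. x \<in> nodes Y (filled W us) \<Longrightarrow> x \<noteq> Inr a \<Longrightarrow> K x (Inr a) = 0"
  shows "word_det Y (filled W us) Z K = word_det Y (filled W (us[i := []])) Z K"
proof -
  obtain z P Q where z: "z \<in> Y" "filled W us z = Inl z # map Inr (P @ us ! i @ Q)"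
    "\<And>v. filled W (us[i := v]) = (filled W us)(z := Inl z # map Inr (P @ v @ Q))"
    using template_hole[OF T assms(2,3)] by blast
  have L: "filled W us z = (Inl z # map Inr P) @ [Inr a] @ map Inr Q"
    by (simp add: z(2) assms(4))
  show ?thesis
    using word_det_delete[where K = K, OF assms(1) z(1) L _ assms(5-7)] by (simp add: z(3))
qed

lemma nodes_filled:
  assumes "i < n" "length us = n" "x \<in> set (us ! i)"
  shows "Inr x \<in> nodes Y (filled W us)"
proof -
  obtain z P Q where z: "z \<in> Y" "filled W us z = Inl z # map Inr (P @ us ! i @ Q)"
    using template_hole[OF T assms(1,2)] by metis
  show ?thesis unfolding nodes_def by (rule UN_I[OF z(1)]) (use z(2) assms(3) in auto)
qed

lemma distinct_hole:
  assumes "strands Y (filled W us)" "i < n" "length us = n"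
  shows "distinct (us ! i)"
proof -
  obtain z P Q where z: "z \<in> Y" "filled W us z = Inl z # map Inr (P @ us ! i @ Q)"
    using template_hole[OF T assms(2,3)] by metis
  show ?thesis
    using strandsD(2)[OF assms(1) z(1)] unfolding z(2) distinct.simps distinct_map distinct_append by blast
qed

lemma hole_gone:
  assumes st: "strands Y (filled W us)" and i: "i < n" "length us = n" and a: "a \<in> set (us ! i)"
  shows "Inr a \<notin> nodes Y (filled W (us[i := []]))"
proof -
  obtain z P Q where z: "z \<in> Y" "filled W us z = Inl z # map Inr (P @ us ! i @ Q)"
      "\<And>v. filled W (us[i := v]) = (filled W us)(z := Inl z # map Inr (P @ v @ Q))"
    using template_hole[OF T i] by blast
  have "Inr a \<in> set (filled W us z)" using a z(2) by simp
  then have "Inr a \<notin> set (filled W us y)" if "y \<in> Y - {z}" for y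
    using strands_unique[OF st, of y z "Inr a"] that z(1) by auto
  moreover have "distinct (P @ us ! i @ Q)"
    using strandsD(2)[OF st z(1)] unfolding z(2) distinct.simps distinct_map by blast
  then have "Inr a \<notin> set (Inl z # map Inr (P @ [] @ Q))" using a by auto
  ultimately show ?thesis unfolding z(3) nodes_update[OF z(1)] by blast
qed

text \<open>Emptying hole \<open>i\<close> removes its passages from all nodes, while those of hole
  \<open>j\<close> remain nodes.\<close>

lemma disjoint_holes:
  assumes st: "strands Y (filled W us)" and ij: "i < n" "j < n" "i \<noteq> j" and len: "length us = n"
  shows "set (us ! i) \<inter> set (us ! j) = {}"
proof -
  have "Inr a \<in> nodes Y (filled W (us[i := []]))" if "a \<in> set (us ! j)" for a
    by (rule nodes_filled[OF ij(2)]) (use that ij len in auto)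
  then show ?thesis using hole_gone[OF st ij(1) len] by blast
qed

lemma nodes_filled_merge:
  assumes "strands Y (filled W us)" "i < n" "length us = n" "us ! i = [a, b] \<or> us ! i = [b, a]"
  shows "nodes Y (filled W (us[i := [a]])) = nodes Y (filled W us) - {Inr b}"
proof -
  obtain z P Q where z: "z \<in> Y" "filled W us z = Inl z # map Inr (P @ us ! i @ Q)"
    "\<And>v. filled W (us[i := v]) = (filled W us)(z := Inl z # map Inr (P @ v @ Q))"
    using template_hole[OF T assms(2,3)] by blast
  from assms(4) show ?thesis
  proof
    assume ab: "us ! i = [a, b]"
    have "filled W us z = (Inl z # map Inr (P @ [a])) @ Inr b # map Inr Q"
      by (simp add: z(2) ab)
    from nodes_remove[OF assms(1) z(1) this] show ?thesis by (simp add: z(3))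
  next
    assume ba: "us ! i = [b, a]"
    have "filled W us z = (Inl z # map Inr P) @ Inr b # map Inr (a # Q)"
      by (simp add: z(2) ba)
    from nodes_remove[OF assms(1) z(1) this] show ?thesis by (simp add: z(3))
  qed
qed

text \<open>Unit columns at \<open>a\<close> and \<open>b\<close> make merging add the two rows off
  the diagonal, which is symmetric in \<open>a\<close> and \<open>b\<close>. This is the move OC in
  terms of matrices, as over passages have unit columns.\<close>

lemma filled_swap:
  fixes K :: "'a + passage \<Rightarrow> 'a + passage \<Rightarrow> 'f::field"
  assumes st: "strands Y (filled W us)" and i: "i < n" "length us = n" and us: "us ! i = [a, b]"
    and K: "K (Inr a) (Inr a) = 1" "K (Inr b) (Inr b) = 1"
      "\<And>x. x \<in> nodes Y (filled W us) \<Longrightarrow> x \<noteq> Inr a \<Longrightarrow> K x (Inr a) = 0"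
      "\<And>x. x \<in> nodes Y (filled W us) \<Longrightarrow> x \<noteq> Inr b \<Longrightarrow> K x (Inr b) = 0"
  shows "word_det Y (filled W us) Z K = word_det Y (filled W (us[i := [b, a]])) Z K"
proof -
  let ?us = "us[i := [a]]" and ?vs = "us[i := [b, a]]"
  let ?c = "id(Inr a := Inr b) :: 'a + passage \<Rightarrow> _"
  have "distinct (us ! i)" by (rule distinct_hole[OF st i])
  then have ab: "a \<noteq> b" using us by simp
  have ab_in: "Inr a \<in> nodes Y (filled W us)" "Inr b \<in> nodes Y (filled W us)"
    using nodes_filled[OF i] us by auto
  have zero: "K (Inr a) (Inr b) = 0" "K (Inr b) (Inr a) = 0"
    using K(3)[OF ab_in(2)] K(4)[OF ab_in(1)] ab by auto
  have st': "strands Y (filled W ?vs)"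
    by (rule strands_filled_update[OF st i]) (use us ab in auto)
  have st1: "strands Y (filled W ?us)"
    by (rule strands_filled_update[OF st i]) (use us ab in auto)
  have "word_det Y (filled W us) Z K =
      word_det Y (filled W ?us) Z (\<lambda>x y. K x (?c y) + K x (Inr a) * K (Inr b) (?c y))"
    by (rule filled_stitch[where K = K, OF st i us zero(2)])
  also have "\<dots> = word_det Y (filled W ?us) Z (\<lambda>x y. K (?c x) y + K (?c x) (Inr b) * K (Inr a) y)"
  proof (rule word_det_cong[OF st1])
    fix x y assume "x \<in> nodes Y (filled W ?us)" "y \<in> nodes Y (filled W ?us)"
    then have "x \<in> nodes Y (filled W us)" "x \<noteq> Inr b" "y \<noteq> Inr b"
      using nodes_filled_merge[OF st i disjI1[OF us]] by auto
    then show "K x (?c y) + K x (Inr a) * K (Inr b) (?c y) = K (?c x) y + K (?c x) (Inr b) * K (Inr a) y"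
      using K zero ab by (cases "x = Inr a"; cases "y = Inr a") auto
  qed
  also have "\<dots> = word_det Y (filled W (?vs[i := [a]])) Z (\<lambda>x y. K (?c x) y + K (?c x) (Inr b) * K (Inr a) y)"
    by simp
  also have "\<dots> = word_det Y (filled W ?vs) Z K"
    by (rule filled_stitch_second[where K = K, OF st' i(1) _ _ zero(1), symmetric]) (use i in auto)
  finally show ?thesis .
qed

text \<open>Reidemeister two: \<open>x1\<close>, \<open>x2\<close> are the over passages, \<open>u1\<close>, \<open>u2\<close> the passages below them.\<close>

lemma filled_R2:
  fixes K :: "'a + passage \<Rightarrow> 'a + passage \<Rightarrow> 'f::field"
  assumes st: "strands Y (filled W us)" and len: "length us = n" and i: "i < n" and j: "j < n" and ij: "i \<noteq> j"
    and us: "us ! i = [x1, x2]" "us ! j = [u1, u2] \<or> us ! j = [u2, u1]"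
    and dist: "distinct [x1, x2, u1, u2]" and s: "s * s' = 1"
    and K: "\<And>x y. x \<in> nodes Y (filled W us) \<Longrightarrow> y \<in> nodes Y (filled W us) \<Longrightarrow> K x y =
      (if x = Inr x1 then of_bool (y = Inr x1) + (1 - s) * of_bool (y = Inr u1)
       else if x = Inr x2 then of_bool (y = Inr x2) + (1 - s') * of_bool (y = Inr u2)
       else if x = Inr u1 then s * of_bool (y = Inr u1)
       else if x = Inr u2 then s' * of_bool (y = Inr u2)
       else if y \<in> {Inr x1, Inr x2, Inr u1, Inr u2} then 0 else K' x y)"
  shows "word_det Y (filled W us) Z K = word_det Y (filled W (us[i := [], j := []])) Z K'"
proof -
  define Kx where "Kx x y =
      (if x = Inr x1 then of_bool (y = Inr x1) + (1 - s) * of_bool (y = Inr u1)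
       else if x = Inr x2 then of_bool (y = Inr x2) + (1 - s') * of_bool (y = Inr u2)
       else if x = Inr u1 then s * of_bool (y = Inr u1)
       else if x = Inr u2 then s' * of_bool (y = Inr u2)
       else if y \<in> {Inr x1, Inr x2, Inr u1, Inr u2} then 0 else K' x y)" for x y
  let ?c = "id(Inr x1 := Inr x2) :: 'a + passage \<Rightarrow> _" and ?d = "id(Inr u1 := Inr u2) :: 'a + passage \<Rightarrow> _"
  let ?K1 = "\<lambda>x y. Kx x (?c y) + Kx x (Inr x1) * Kx (Inr x2) (?c y)"
  \<comment> \<open>After both stitchings the two merged nodes are trivial strands:
    \<open>s * s' = 1\<close> cancels the entry (1 - s') + (1 - s) s' from the over to the under
    branch, or the same entry with s and s' exchanged if the under branch runs the other way. Both
    nodes can then be deleted.\<close>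
  define K2 where "K2 x y = (if x \<in> {Inr x1, Inr u1} \<or> y \<in> {Inr x1, Inr u1} then of_bool (x = y) else K' x y)" for x y
  let ?us1 = "us[i := [x1]]" and ?us2 = "us[i := [x1], j := [u1]]"
  have d: "x1 \<noteq> x2" "x1 \<noteq> u1" "x1 \<noteq> u2" "x2 \<noteq> u1" "x2 \<noteq> u2" "u1 \<noteq> u2"
    "x2 \<noteq> x1" "u1 \<noteq> x1" "u2 \<noteq> x1" "u1 \<noteq> x2" "u2 \<noteq> x2" "u2 \<noteq> u1"
    using dist by auto
  have st1: "strands Y (filled W ?us1)"
    by (rule strands_filled_update[OF st i len]) (use us in auto)
  have j1: "?us1 ! j = us ! j" using ij by simp
  have st2: "strands Y (filled W ?us2)"
    by (rule strands_filled_update[OF st1 j]) (use us j1 len in auto)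
  have len1: "length ?us1 = n" "length ?us2 = n" using len by simp_all
  have N1: "nodes Y (filled W ?us1) = nodes Y (filled W us) - {Inr x2}"
    by (rule nodes_filled_merge[OF st i len disjI1[OF us(1)]])
  have N2: "nodes Y (filled W ?us2) = nodes Y (filled W us) - {Inr x2, Inr u2}"
    using nodes_filled_merge[OF st1 j len1(1)] us(2) unfolding j1 N1 by blast
  have "word_det Y (filled W us) Z K = word_det Y (filled W us) Z Kx"
    by (rule word_det_cong[OF st]) (simp only: K Kx_def)
  also have "\<dots> = word_det Y (filled W ?us1) Z ?K1"
    by (rule filled_stitch[where K = Kx, OF st i len us(1)]) (use d in \<open>simp add: Kx_def\<close>)
  also have "\<dots> = word_det Y (filled W ?us2) Z K2"
    using us(2)
  proof
    assume u: "us ! j = [u1, u2]"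
    have "word_det Y (filled W ?us1) Z ?K1 = word_det Y (filled W ?us2) Z
        (\<lambda>x y. ?K1 x (?d y) + ?K1 x (Inr u1) * ?K1 (Inr u2) (?d y))"
      by (rule filled_stitch[where K = ?K1, OF st1 j len1(1)]) (use u ij d in \<open>simp_all add: Kx_def\<close>)
    also have "\<dots> = word_det Y (filled W ?us2) Z K2"
    proof (rule word_det_cong[OF st2])
      fix x y assume "x \<in> nodes Y (filled W ?us2)" "y \<in> nodes Y (filled W ?us2)"
      then have "x \<noteq> Inr x2" "x \<noteq> Inr u2" "y \<noteq> Inr x2" "y \<noteq> Inr u2" unfolding N2 by auto
      then show "?K1 x (?d y) + ?K1 x (Inr u1) * ?K1 (Inr u2) (?d y) = K2 x y"
        using d s by (cases "x = Inr x1"; cases "x = Inr u1"; cases "y = Inr x1"; cases "y = Inr u1")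
          (simp_all add: Kx_def K2_def algebra_simps)
    qed
    finally show ?thesis .
  next
    assume u: "us ! j = [u2, u1]"
    have "word_det Y (filled W ?us1) Z ?K1 = word_det Y (filled W ?us2) Z
        (\<lambda>x y. ?K1 (?d x) y + ?K1 (?d x) (Inr u2) * ?K1 (Inr u1) y)"
      by (rule filled_stitch_second[where K = ?K1, OF st1 j len1(1)]) (use u ij d in \<open>simp_all add: Kx_def\<close>)
    also have "\<dots> = word_det Y (filled W ?us2) Z K2"
    proof (rule word_det_cong[OF st2])
      fix x y assume "x \<in> nodes Y (filled W ?us2)" "y \<in> nodes Y (filled W ?us2)"
      then have "x \<noteq> Inr x2" "x \<noteq> Inr u2" "y \<noteq> Inr x2" "y \<noteq> Inr u2" unfolding N2 by auto
      then show "?K1 (?d x) y + ?K1 (?d x) (Inr u2) * ?K1 (Inr u1) y = K2 x y"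
        using d s by (cases "x = Inr x1"; cases "x = Inr u1"; cases "y = Inr x1"; cases "y = Inr u1")
          (simp_all add: Kx_def K2_def algebra_simps)
    qed
    finally show ?thesis .
  qed
  also have "\<dots> = word_det Y (filled W (?us2[i := []])) Z K2"
    by (rule filled_delete[where a = x1, OF st2 i len1(2)]) (use i ij len in \<open>auto simp: K2_def\<close>)
  also have "\<dots> = word_det Y (filled W (?us2[i := [], j := []])) Z K2"
  proof (rule filled_delete[where a = u1, OF _ j])
    show "strands Y (filled W (?us2[i := []]))"
      by (rule strands_filled_update[OF st2 i len1(2)]) simp_all
  qed (use j ij len in \<open>auto simp: K2_def\<close>)
  also have "?us2[i := [], j := []] = us[i := [], j := []]"
    using ij by (simp add: list_update_swap)
  also have "word_det Y (filled W (us[i := [], j := []])) Z K2 = word_det Y (filled W (us[i := [], j := []])) Z K'"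
  proof (rule word_det_cong)
    let ?us3 = "us[i := []]" and ?us4 = "us[i := [], j := []]"
    have st3: "strands Y (filled W ?us3)"
      by (rule strands_filled_update[OF st i len]) simp_all
    show st4: "strands Y (filled W ?us4)"
      by (rule strands_filled_update[OF st3 j]) (use len in simp_all)
    fix x y assume xy: "x \<in> nodes Y (filled W ?us4)" "y \<in> nodes Y (filled W ?us4)"
    have st3': "strands Y (filled W (us[j := []]))"
      by (rule strands_filled_update[OF st j len]) simp_all
    have "Inr x1 \<notin> nodes Y (filled W (us[j := [], i := []]))"
      by (rule hole_gone[OF st3' i]) (use len us ij in auto)
    then have x1: "Inr x1 \<notin> nodes Y (filled W ?us4)" using ij by (simp add: list_update_swap)
    have u1: "Inr u1 \<notin> nodes Y (filled W ?us4)"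
      by (rule hole_gone[OF st3 j]) (use len us ij in auto)
    have "x \<noteq> Inr x1" "y \<noteq> Inr x1" "x \<noteq> Inr u1" "y \<noteq> Inr u1" using x1 u1 xy by auto
    then show "K2 x y = K' x y" by (simp add: K2_def)
  qed
  finally show ?thesis .
qed

end

text \<open>Three crossings, with \<open>x1\<close> over \<open>m1\<close> of weight
  \<open>s\<close>, \<open>x2\<close> over \<open>u1\<close> of weight \<open>s'\<close> and
  \<open>m2\<close> over \<open>u2\<close> of weight \<open>r\<close>; other nodes keep the entries
  of \<open>K\<close> among themselves.\<close>

definition triangle_matrix ::
  "'n \<Rightarrow> 'n \<Rightarrow> 'n \<Rightarrow> 'n \<Rightarrow> 'n \<Rightarrow> 'n \<Rightarrow> 'f \<Rightarrow> 'f \<Rightarrow> 'f \<Rightarrow> ('n \<Rightarrow> 'n \<Rightarrow> 'f::field) \<Rightarrow> 'n \<Rightarrow> 'n \<Rightarrow> 'f" where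
  "triangle_matrix x1 x2 m1 m2 u1 u2 s s' r K x y =
     (if x = x1 then of_bool (y = x1) + (1 - s) * of_bool (y = m1)
      else if x = x2 then of_bool (y = x2) + (1 - s') * of_bool (y = u1)
      else if x = m1 then s * of_bool (y = m1)
      else if x = m2 then of_bool (y = m2) + (1 - r) * of_bool (y = u2)
      else if x = u1 then s' * of_bool (y = u1)
      else if x = u2 then r * of_bool (y = u2)
      else if y \<in> {x1, x2, m1, m2, u1, u2} then 0 else K x y)"

text \<open>
  The matrix that is left of \<open>triangle_matrix\<close> when the passages of the over branch \<open>x1, x2\<close>, of the
  middle branch \<open>m1, m2\<close> and of the under branch \<open>u1, u2\<close> are stitched; \<open>b\<close> and \<open>b'\<close> tell whether
  \<open>m1\<close> precedes \<open>m2\<close> and \<open>u1\<close> precedes \<open>u2\<close>. The order on the over branch does not matter.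
\<close>

definition triangle_paths ::
  "bool \<Rightarrow> bool \<Rightarrow> 'n \<Rightarrow> 'n \<Rightarrow> 'n \<Rightarrow> 'f \<Rightarrow> 'f \<Rightarrow> 'f \<Rightarrow> ('n \<Rightarrow> 'n \<Rightarrow> 'f::field) \<Rightarrow> 'n \<Rightarrow> 'n \<Rightarrow> 'f" where
  "triangle_paths b b' x1 m1 u1 s s' r K x y =
     (if x = x1 then of_bool (y = x1) + (1 - s) * of_bool (y = m1) +
        ((1 - s') * (if b' then r else 1) + (if b then (1 - s) * (1 - r) * (if b' then 1 else s') else 0)) *
        of_bool (y = u1)
      else if x = m1 then s * of_bool (y = m1) +
        (if b then s else 1) * (1 - r) * (if b' then 1 else s') * of_bool (y = u1)
      else if x = u1 then s' * r * of_bool (y = u1)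
      else if y \<in> {x1, m1, u1} then 0 else K x y)"

text \<open>The third Reidemeister move reverses all three words, that is, negates \<open>b\<close>
  and \<open>b'\<close>. From the middle to the under branch the two sides give s (1 - r) and (1 -
  r) s' if \<open>b = b'\<close>, and s (1 - r) s' and 1 - r otherwise; the hypothesis makes them
  equal, and the entry from the over to the under branch is settled likewise.\<close>

lemma triangle_paths_flip:
  assumes "if b = b' then s = s' else s * s' = 1"
  shows "triangle_paths (\<not> b) (\<not> b') x1 m1 u1 s s' r K = triangle_paths b b' x1 m1 u1 s s' r K"
proof -
  have "s' * s = 1" "s * (r * s') = r" "s' * (r * s) = r" "r * (s * s') = r" if "b \<noteq> b'"
  proof -
    show 1: "s' * s = 1" using assms that by (simp add: mult.commute)
    have "s * (r * s') = r * (s' * s)" "s' * (r * s) = r * (s' * s)" "r * (s * s') = r * (s' * s)" by simp_all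
    then show "s * (r * s') = r" "s' * (r * s) = r" "r * (s * s') = r" unfolding 1 by simp_all
  qed
  then show ?thesis
    using assms
    by (intro ext; cases b; cases b') (simp_all add: triangle_paths_def algebra_simps)
qed

text \<open>By \<open>filled_swap\<close> the over branch can be put into the order
  \<open>x1\<close>, \<open>x2\<close> whatever \<open>b0\<close> is. Then each branch is stitched
  once, always with pivot 1: \<open>K1\<close>, \<open>K2\<close>, \<open>K3\<close> are the
  matrices after the over, middle and under branch.\<close>

lemma filled_triangle:
  fixes K :: "'a + passage \<Rightarrow> 'a + passage \<Rightarrow> 'f::field"
  assumes T: "template Y n W" and st: "strands Y (filled W us)" and len: "length us = n"
    and ijk: "i < n" "j < n" "k < n" "i \<noteq> j" "i \<noteq> k" "j \<noteq> k"
    and us: "us ! i = directed b0 [x1, x2]" "us ! j = directed b [m1, m2]" "us ! k = directed b' [u1, u2]"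
    and dist: "distinct [x1, x2, m1, m2, u1, u2]"
    and K: "\<And>x y. x \<in> nodes Y (filled W us) \<Longrightarrow> y \<in> nodes Y (filled W us) \<Longrightarrow> K x y =
      triangle_matrix (Inr x1) (Inr x2) (Inr m1) (Inr m2) (Inr u1) (Inr u2) s s' r K' x y"
  shows "word_det Y (filled W us) Z K = word_det Y (filled W (us[i := [x1], j := [m1], k := [u1]])) Z
      (triangle_paths b b' (Inr x1) (Inr m1) (Inr u1) s s' r K')"
proof -
  let ?Kx = "triangle_matrix (Inr x1) (Inr x2) (Inr m1) (Inr m2) (Inr u1) (Inr u2) s s' r K'"
  let ?P = "triangle_paths b b' (Inr x1) (Inr m1) (Inr u1) s s' r K'"
  let ?c = "id(Inr x1 := Inr x2) :: 'a + passage \<Rightarrow> _" and ?d = "id(Inr m1 := Inr m2) :: 'a + passage \<Rightarrow> _"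
    and ?e = "id(Inr u1 := Inr u2) :: 'a + passage \<Rightarrow> _"
  define K1 where "K1 x y = ?Kx x (?c y) + ?Kx x (Inr x1) * ?Kx (Inr x2) (?c y)" for x y
  define K2 where "K2 x y = (if b then K1 x (?d y) + K1 x (Inr m1) * K1 (Inr m2) (?d y)
     else K1 (?d x) y + K1 (?d x) (Inr m2) * K1 (Inr m1) y)" for x y
  define K3 where "K3 x y = (if b' then K2 x (?e y) + K2 x (Inr u1) * K2 (Inr u2) (?e y)
     else K2 (?e x) y + K2 (?e x) (Inr u2) * K2 (Inr u1) y)" for x y
  have d: "x1 \<noteq> x2" "x1 \<noteq> m1" "x1 \<noteq> m2" "x1 \<noteq> u1" "x1 \<noteq> u2"
    "x2 \<noteq> x1" "x2 \<noteq> m1" "x2 \<noteq> m2" "x2 \<noteq> u1" "x2 \<noteq> u2"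
    "m1 \<noteq> x1" "m1 \<noteq> x2" "m1 \<noteq> m2" "m1 \<noteq> u1" "m1 \<noteq> u2"
    "m2 \<noteq> x1" "m2 \<noteq> x2" "m2 \<noteq> m1" "m2 \<noteq> u1" "m2 \<noteq> u2"
    "u1 \<noteq> x1" "u1 \<noteq> x2" "u1 \<noteq> m1" "u1 \<noteq> m2" "u1 \<noteq> u2"
    "u2 \<noteq> x1" "u2 \<noteq> x2" "u2 \<noteq> m1" "u2 \<noteq> m2" "u2 \<noteq> u1"
    using dist by auto
  let ?us0 = "us[i := [x1, x2]]" and ?us1 = "us[i := [x1]]" and ?us2 = "us[i := [x1], j := [m1]]"
    and ?us3 = "us[i := [x1], j := [m1], k := [u1]]"
  have len': "length ?us0 = n" "length ?us1 = n" "length ?us2 = n" using len by simp_all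
  have nth: "?us0 ! i = [x1, x2]" "?us1 ! j = us ! j" "?us2 ! k = us ! k"
    using ijk len by simp_all
  have st0: "strands Y (filled W ?us0)"
    by (rule strands_filled_update[OF T st ijk(1) len]) (use us d in \<open>auto simp: directed_def\<close>)
  have st1: "strands Y (filled W ?us1)"
    by (rule strands_filled_update[OF T st ijk(1) len]) (use us d in \<open>auto simp: directed_def\<close>)
  have st2: "strands Y (filled W ?us2)"
    by (rule strands_filled_update[OF T st1 ijk(2) len'(2)]) (use us d nth in \<open>auto simp: directed_def\<close>)
  have st3: "strands Y (filled W ?us3)"
    by (rule strands_filled_update[OF T st2 ijk(3) len'(3)]) (use us d nth in \<open>auto simp: directed_def\<close>)
  have N1: "nodes Y (filled W ?us1) = nodes Y (filled W us) - {Inr x2}"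
    by (rule nodes_filled_merge[OF T st ijk(1) len]) (use us in \<open>auto simp: directed_def\<close>)
  have N2: "nodes Y (filled W ?us2) = nodes Y (filled W ?us1) - {Inr m2}"
    by (rule nodes_filled_merge[OF T st1 ijk(2) len'(2)]) (use us nth in \<open>auto simp: directed_def\<close>)
  have N3: "nodes Y (filled W ?us3) = nodes Y (filled W ?us2) - {Inr u2}"
    by (rule nodes_filled_merge[OF T st2 ijk(3) len'(3)]) (use us nth in \<open>auto simp: directed_def\<close>)
  have "word_det Y (filled W us) Z K = word_det Y (filled W us) Z ?Kx"
    by (rule word_det_cong[OF st K])
  also have "\<dots> = word_det Y (filled W ?us0) Z ?Kx"
  proof (cases b0)
    case True
    then have "us ! i = [x1, x2]" using us by (simp add: directed_def)
    then have "us[i := [x1, x2]] = us" by (metis list_update_id)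
    then show ?thesis by simp
  next
    case False
    then have "us ! i = [x2, x1]" using us by (simp add: directed_def)
    then show ?thesis
      by (rule filled_swap[where K = ?Kx, OF T st ijk(1) len]) (use d in \<open>auto simp: triangle_matrix_def\<close>)
  qed
  also have "\<dots> = word_det Y (filled W (?us0[i := [x1]])) Z K1"
    unfolding K1_def
    by (rule filled_stitch[where K = ?Kx, OF T st0 ijk(1) len'(1) nth(1)]) (use d in \<open>simp add: triangle_matrix_def\<close>)
  also have "?us0[i := [x1]] = ?us1" by simp
  also have "word_det Y (filled W ?us1) Z K1 = word_det Y (filled W ?us2) Z K2"
  proof (cases b)
    case True
    then show ?thesis unfolding K2_def if_P[OF True]
      by (intro filled_stitch[where K = K1, OF T st1 ijk(2) len'(2)])
         (use d us nth in \<open>simp_all add: directed_def K1_def triangle_matrix_def\<close>)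
  next
    case False
    then show ?thesis unfolding K2_def if_not_P[OF False]
      by (intro filled_stitch_second[where K = K1, OF T st1 ijk(2) len'(2)])
         (use d us nth in \<open>simp_all add: directed_def K1_def triangle_matrix_def\<close>)
  qed
  also have "\<dots> = word_det Y (filled W ?us3) Z K3"
  proof (cases b')
    case True
    then show ?thesis unfolding K3_def if_P[OF True]
      by (intro filled_stitch[where K = K2, OF T st2 ijk(3) len'(3)])
         (use d us nth in \<open>simp_all add: directed_def K2_def K1_def triangle_matrix_def\<close>)
  next
    case False
    then show ?thesis unfolding K3_def if_not_P[OF False]
      by (intro filled_stitch_second[where K = K2, OF T st2 ijk(3) len'(3)])
         (use d us nth in \<open>simp_all add: directed_def K2_def K1_def triangle_matrix_def\<close>)
  qed
  also have "\<dots> = word_det Y (filled W ?us3) Z ?P"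
  proof (rule word_det_cong[OF st3])
    fix x y assume "x \<in> nodes Y (filled W ?us3)" "y \<in> nodes Y (filled W ?us3)"
    then have xy: "x \<noteq> Inr x2" "x \<noteq> Inr m2" "x \<noteq> Inr u2" "y \<noteq> Inr x2" "y \<noteq> Inr m2" "y \<noteq> Inr u2"
      unfolding N3 N2 N1 by auto
    note defs = K3_def K2_def K1_def triangle_matrix_def triangle_paths_def
    have "x = Inr x1 \<or> x = Inr m1 \<or> x = Inr u1 \<or> x \<noteq> Inr x1 \<and> x \<noteq> Inr m1 \<and> x \<noteq> Inr u1" by blast
    moreover have "y = Inr x1 \<or> y = Inr m1 \<or> y = Inr u1 \<or> y \<noteq> Inr x1 \<and> y \<noteq> Inr m1 \<and> y \<noteq> Inr u1"
      by blast
    ultimately show "K3 x y = ?P x y"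
      by (elim disjE conjE; cases b; cases b') (use d xy in \<open>simp_all add: defs algebra_simps\<close>)
  qed
  finally show ?thesis .
qed

section \<open>The determinant of a diagram\<close>

definition is_real :: "'a diagram \<Rightarrow> passage \<Rightarrow> bool" where
  "is_real D p \<longleftrightarrow> \<not> virtual D (fst p)"

definition strand_of :: "'a diagram \<Rightarrow> passage \<Rightarrow> 'a" where
  "strand_of D p = (THE y. p \<in> set (word D y))"

text \<open>Only meaningful if \<open>c\<close> is a real crossing; the passage whose strand is taken is the over passage.\<close>

definition weight :: "'a::linorder diagram \<Rightarrow> nat \<Rightarrow> 'a ratfun" where
  "weight D c = (if mark D c = Positive then tvar (strand_of D (c, East))
                 else inverse (tvar (strand_of D (c, North))))"

text \<open>The direct sum of the Gamma matrices of the crossings, each passage being a strand of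
  its own. The variable, however, is already that of the component of the over passage, so no
  substitution remains to be made. Virtual passages do not occur in \<open>strand_nodes\<close>, so
  their entries carry no meaning.\<close>

fun crossing_matrix :: "'a::linorder diagram \<Rightarrow> 'a + passage \<Rightarrow> 'a + passage \<Rightarrow> 'a ratfun" where
  "crossing_matrix D (Inr p) (Inr q) =
     (if q = p then (if over D p then 1 else weight D (fst p))
      else if fst q = fst p \<and> over D p then 1 - weight D (fst p) else 0)"
| "crossing_matrix D x y = of_bool (x = y)"

lemma crossing_matrix_label:
  "crossing_matrix D (Inl y) (Inl y) = 1" "n \<noteq> Inl y \<Longrightarrow> crossing_matrix D (Inl y) n = 0"
  "m \<noteq> Inl y \<Longrightarrow> crossing_matrix D m (Inl y) = 0"
  by (simp, (cases n; simp), (cases m; simp))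

text \<open>The node \<open>Inl y\<close> at the beginning of every strand keeps strands without real passages visible.\<close>

definition strand_nodes :: "'a diagram \<Rightarrow> 'a \<Rightarrow> ('a + passage) list" where
  "strand_nodes D y = Inl y # map Inr (filter (is_real D) (word D y))"

definition diagram_det :: "'a::linorder diagram \<Rightarrow> ('a \<times> 'a) set \<Rightarrow> 'a ratfun" where
  "diagram_det D Z = word_det (labels D) (strand_nodes D) Z (crossing_matrix D)"

lemma strands_passages:
  assumes "well_formed D"
  shows "strands (labels D) (\<lambda>y. Inl y # map Inr (filter P (word D y)))"
  unfolding strands_def
proof (intro conjI ballI impI)
  show "finite (labels D)" using assms by (simp add: well_formed_def)
  fix y assume y: "y \<in> labels D"
  then have "distinct (word D y)" using assms by (simp add: well_formed_iff)
  then show "distinct (Inl y # map Inr (filter P (word D y)) :: ('a + passage) list)"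
    by (auto simp: distinct_map)
  fix y' assume "y' \<in> labels D" "y \<noteq> y'"
  then have "set (word D y) \<inter> set (word D y') = {}" using assms y by (simp add: well_formed_iff)
  then show "set (Inl y # map Inr (filter P (word D y)) :: ('a + passage) list) \<inter>
      set (Inl y' # map Inr (filter P (word D y'))) = {}"
    using \<open>y \<noteq> y'\<close> by auto
qed simp

lemma strands_nodes: "well_formed D \<Longrightarrow> strands (labels D) (strand_nodes D)"
  unfolding strand_nodes_def by (rule strands_passages)

lemma strand_of_eq:
  assumes "well_formed D" "p \<in> set (word D y)"
  shows "strand_of D p = y"
  unfolding strand_of_def
proof (rule the_equality[where P = "\<lambda>y. p \<in> set (word D y)"])
  show "p \<in> set (word D y)" by (rule assms(2))
  show "y' = y" if "p \<in> set (word D y')" for y'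
    by (rule passage_unique[OF assms(1) that assms(2)])
qed

lemma in_labels:
  assumes "well_formed D" "p \<in> set (word D y)"
  shows "y \<in> labels D"
proof (rule ccontr)
  assume "y \<notin> labels D"
  then have "word D y = []" using assms(1) by (simp add: well_formed_def)
  then show False using assms(2) by simp
qed

lemma in_crossings:
  assumes "well_formed D" "p \<in> set (word D y)"
  shows "fst p \<in> crossings D"
  unfolding crossings_def using in_labels[OF assms] assms(2) by blast

lemma crossings_passage:
  assumes "well_formed D" "c \<in> crossings D"
  obtains y where "y \<in> labels D" "(c, s) \<in> set (word D y)"
  using assms unfolding well_formed_iff by blast

lemma Inr_in_nodes: "Inr p \<in> nodes (labels D) (strand_nodes D) \<longleftrightarrow> is_real D p \<and> (\<exists>y\<in>labels D. p \<in> set (word D y))"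
  by (auto simp: nodes_def strand_nodes_def)

lemma side_cases: "t = s \<or> t = opp s"
  by (cases t; cases s) auto

lemma opp_simps [simp]: "opp (opp s) = s" "opp s \<noteq> s" "s \<noteq> opp s"
  by (cases s; simp)+

text \<open>A row \<open>Inr p\<close> depends on the diagram only through the mark of its crossing
  and the strand of the over passage, which a diagram with fewer passages inherits. Hence only the
  row index has to be a node.\<close>

lemma crossing_matrix_sub:
  assumes wf: "well_formed D" "well_formed D'"
    and sub: "\<And>y. set (word D' y) \<subseteq> set (word D y)"
    and mark: "\<And>c. c \<in> crossings D' \<Longrightarrow> mark D' c = mark D c"
    and x: "x \<in> nodes (labels D') (strand_nodes D')"
  shows "crossing_matrix D' x y = crossing_matrix D x y"
proof (cases x)
  case (Inr p)
  then obtain z where "p \<in> set (word D' z)" using x by (auto simp: Inr_in_nodes)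
  then have "fst p \<in> crossings D'" by (rule in_crossings[OF wf(2)])
  moreover have "strand_of D' (c, s) = strand_of D (c, s)" if c: "c \<in> crossings D'" for c s
  proof -
    obtain y where y: "(c, s) \<in> set (word D' y)" using crossings_passage[OF wf(2) c] by metis
    then have "(c, s) \<in> set (word D y)" using sub by blast
    then show ?thesis using strand_of_eq[OF wf(2) y] strand_of_eq[OF wf(1)] by simp
  qed
  ultimately show ?thesis
    using mark[of "fst p"] by (cases y) (simp_all add: Inr over_def weight_def)
qed simp

lemma real_sub:
  assumes "well_formed D'" "\<And>c. c \<in> crossings D' \<Longrightarrow> mark D' c = mark D c" "p \<in> set (word D' y)"
  shows "is_real D' p \<longleftrightarrow> is_real D p"
  using assms(2)[OF in_crossings[OF assms(1,3)]] by (simp add: is_real_def virtual_def)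

text \<open>One argument for every change that touches virtual passages only, since the real ones
  keep their strands, order and marks. It serves the purely virtual and mixed moves, end points and
  the closing of strands.\<close>

lemma diagram_det_sub:
  assumes wf: "well_formed D" "well_formed D'" and lab: "labels D' = labels D"
    and sub: "\<And>y. set (word D' y) \<subseteq> set (word D y)"
    and mark: "\<And>c. c \<in> crossings D' \<Longrightarrow> mark D' c = mark D c"
    and words: "\<And>y. y \<in> labels D \<Longrightarrow> filter (is_real D) (word D' y) = filter (is_real D) (word D y)"
  shows "diagram_det D' Z = diagram_det D Z"
proof -
  have eq: "strand_nodes D' y = strand_nodes D y" if "y \<in> labels D" for y
  proof -
    have "filter (is_real D') (word D' y) = filter (is_real D) (word D' y)"
      by (rule filter_cong[OF refl]) (rule real_sub[OF wf(2) mark])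
    then show ?thesis using words[OF that] by (simp add: strand_nodes_def)
  qed
  have "nodes (labels D) (strand_nodes D') = nodes (labels D) (strand_nodes D)"
    using eq by (simp add: nodes_def)
  moreover have "joints (labels D) (strand_nodes D') Z = joints (labels D) (strand_nodes D) Z"
  proof -
    have "{(last (strand_nodes D' y), hd (strand_nodes D' y')) |y y'. y \<in> labels D \<and> y' \<in> labels D \<and> (y, y') \<in> Z} =
      {(last (strand_nodes D y), hd (strand_nodes D y')) |y y'. y \<in> labels D \<and> y' \<in> labels D \<and> (y, y') \<in> Z}"
      using eq by (intro Collect_cong ex_cong1) auto
    then show ?thesis unfolding joints_def using eq by simp
  qed
  ultimately have "word_det (labels D) (strand_nodes D') Z K = word_det (labels D) (strand_nodes D) Z K"
    for K :: "'a + passage \<Rightarrow> 'a + passage \<Rightarrow> 'a ratfun"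
    by (simp add: word_det_def)
  moreover have "word_det (labels D') (strand_nodes D') Z (crossing_matrix D') =
      word_det (labels D') (strand_nodes D') Z (crossing_matrix D)"
    by (rule word_det_cong[OF strands_nodes[OF wf(2)]]) (rule crossing_matrix_sub[OF wf sub mark])
  ultimately show ?thesis unfolding diagram_det_def lab by simp
qed

text \<open>Restriction to real passages can be carried out hole by hole, so a local move of
  diagrams becomes a local change of words of nodes. The last claim, that each replaced piece lies
  on one strand, will relate the weights along a piece.\<close>

lemma local_move_template:
  assumes wf: "well_formed D" "well_formed D'" and lm: "local_move us vs D D'"
    and len: "length vs = length us" and sub: "\<forall>i<length us. set (vs ! i) \<subseteq> set (us ! i)"
  shows "labels D' = labels D" "\<And>y. set (word D' y) \<subseteq> set (word D y)"
    "\<And>c. c \<in> crossings D' \<Longrightarrow> mark D' c = mark D c"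
    "\<exists>W. template (labels D) (length us) W \<and>
       (\<forall>y. filter (is_real D) (word D y) = fill (map (filter (is_real D)) us) (W y)) \<and>
       (\<forall>y. filter (is_real D) (word D' y) = fill (map (filter (is_real D)) vs) (W y))"
    "\<And>i. i < length us \<Longrightarrow> \<exists>y\<in>labels D. set (us ! i) \<subseteq> set (word D y)"
proof -
  show lab: "labels D' = labels D" using lm by (simp add: local_move_def labels_def)
  obtain W where W: "\<forall>i<length us. (\<Sum>y\<in>labels D. count_list (W y) (Inr i)) = 1"
      "\<forall>y. \<forall>i. Inr i \<in> set (W y) \<longrightarrow> y \<in> labels D \<and> i < length us"
      "\<And>y. word D y = fill us (W y)" "\<And>y. word D' y = fill vs (W y)"
    using lm unfolding local_move_def by blast
  have fin: "finite (labels D)" using wf(1) by (simp add: well_formed_def)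
  have T: "template (labels D) (length us) W" using W fin by (simp add: template_def)
  show words: "set (word D' y) \<subseteq> set (word D y)" for y
    unfolding W(3,4) set_fill using sub W(2) by blast
  then have "crossings D' \<subseteq> crossings D" unfolding crossings_def lab by blast
  then show "\<And>c. c \<in> crossings D' \<Longrightarrow> mark D' c = mark D c"
    using lm unfolding local_move_def by blast
  let ?W = "\<lambda>y. filter (case_sum (is_real D) (\<lambda>_. True)) (W y)"
  have "template (labels D) (length us) ?W" by (rule template_filter[OF T])
  moreover have "filter (is_real D) (word D y) = fill (map (filter (is_real D)) us) (?W y)" for y
    unfolding W(3) by (rule filter_fill) (use W(2) in blast)
  moreover have "filter (is_real D) (word D' y) = fill (map (filter (is_real D)) vs) (?W y)" for y
    unfolding W(4) by (rule filter_fill) (use W(2) len in auto)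
  ultimately show "\<exists>W. template (labels D) (length us) W \<and>
       (\<forall>y. filter (is_real D) (word D y) = fill (map (filter (is_real D)) us) (W y)) \<and>
       (\<forall>y. filter (is_real D) (word D' y) = fill (map (filter (is_real D)) vs) (W y))"
    by blast
  show "\<exists>y\<in>labels D. set (us ! i) \<subseteq> set (word D y)" if "i < length us" for i
  proof -
    have i: "i < length us" by (rule that)
    obtain z P Q where "z \<in> labels D" "filled W us z = Inl z # map Inr (P @ us ! i @ Q)"
      by (rule template_hole[OF T i refl]) blast
    then have "map Inr (word D z) = (map Inr (P @ us ! i @ Q) :: ('a + passage) list)"
      by (simp add: filled_def W(3))
    then have "word D z = P @ us ! i @ Q" by (simp only: inj_map_eq_map inj_Inr)
    then show ?thesis using \<open>z \<in> labels D\<close> by (intro bexI[of _ z]) auto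
  qed
qed

lemma local_move_virtual:
  assumes wf: "well_formed D" "well_formed D'" and lm: "local_move us vs D D'"
    and len: "length vs = length us" and sub: "\<forall>i<length us. set (vs ! i) \<subseteq> set (us ! i)"
    and virt: "map (filter (is_real D)) us = map (filter (is_real D)) vs"
  shows "diagram_det D' Z = diagram_det D Z"
proof -
  note L = local_move_template[OF wf lm len sub]
  obtain W where "\<forall>y. filter (is_real D) (word D y) = fill (map (filter (is_real D)) us) (W y)"
       "\<forall>y. filter (is_real D) (word D' y) = fill (map (filter (is_real D)) vs) (W y)"
    using L(4) by blast
  then show ?thesis
    by (intro diagram_det_sub[OF wf L(1-3)]) (use virt in auto)
qed

lemma local_move_labels: "local_move us vs D D' \<Longrightarrow> opens D' = opens D \<and> closeds D' = closeds D"
  by (simp add: local_move_def)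

section \<open>Invariance of the determinant under the moves\<close>

lemma length_triangle [simp]: "length (triangle o1 o2 o3 p q r) = 3"
  by (simp add: triangle_def)

lemma set_directed [simp]: "set (directed b w) = set w"
  by (simp add: directed_def)

lemma triangle_nth:
  "triangle o1 o2 o3 p q r ! 0 = directed o1 [(p, side_of o1 o2), (q, side_of o1 o3)]"
  "triangle o1 o2 o3 p q r ! 1 = directed o2 [(p, opp (side_of o1 o2)), (r, side_of o2 o3)]"
  "triangle o1 o2 o3 p q r ! 2 = directed o3 [(q, opp (side_of o1 o3)), (r, opp (side_of o2 o3))]"
  by (simp_all add: triangle_def)

lemma set_triangle:
  assumes "i < 3"
  obtains a b where "triangle o1 o2 o3 p q r ! i = [a, b]" "{fst a, fst b} \<subseteq> {p, q, r}"
proof -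
  note witness = that
  have dir: thesis
    if t: "triangle o1 o2 o3 p q r ! i = directed c [a, b]" and u: "{fst a, fst b} \<subseteq> {p, q, r}" for c a b
  proof (cases c)
    case True
    show thesis by (rule witness[of a b]) (use True t u in \<open>simp_all add: directed_def\<close>)
  next
    case False
    show thesis by (rule witness[of b a]) (use False t u in \<open>simp_all add: directed_def\<close>)
  qed
  from assms consider "i = 0" | "i = 1" | "i = 2" by linarith
  then show thesis
  proof cases
    case 1
    show thesis unfolding 1 by (rule dir[unfolded 1, OF triangle_nth(1)]) simp
  next
    case 2
    show thesis unfolding 2 by (rule dir[unfolded 2, OF triangle_nth(2)]) simp
  next
    case 3
    show thesis unfolding 3 by (rule dir[unfolded 3, OF triangle_nth(3)]) simp
  qed
qed

lemma crossings_triangle: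
  assumes "i < 3"
  shows "fst ` set (triangle o1 o2 o3 p q r ! i) = (if i = 0 then {p, q} else if i = 1 then {p, r} else {q, r})"
proof -
  from assms consider "i = 0" | "i = 1" | "i = 2" by linarith
  then show ?thesis by cases (simp_all add: triangle_def)
qed

lemma triangle_third:
  assumes "i < 3" "j < 3" "i \<noteq> j" "c \<in> {p, q, r}" "c \<notin> fst ` set (triangle o1 o2 o3 p q r ! i)"
  shows "c \<in> fst ` set (triangle o1 o2 o3 p q r ! j)"
proof -
  have "j = 0 \<or> j = 1 \<or> j = 2" "i = 0 \<or> i = 1 \<or> i = 2" using assms(1,2) by linarith+
  then show ?thesis
    using assms(3-5) unfolding crossings_triangle[OF assms(1)] crossings_triangle[OF assms(2)]
    by (elim disjE) simp_all
qed

lemma rev_filter_one: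
  assumes "w = [a, b]" "\<exists>x\<in>set w. \<not> P x"
  shows "rev (filter P w) = filter P w"
  using assms by auto

text \<open>Reversing the three words keeps every passage on its strand, so both sides of the move
  have the same crossing matrix and only their words have to be compared.\<close>

lemma local_move_triangle_det:
  assumes wf: "well_formed D" "well_formed D'" and lm: "local_move F (map rev F) D D'"
    and det: "\<And>W. template (labels D) (length F) W \<Longrightarrow> strands (labels D) (filled W (map (filter (is_real D)) F)) \<Longrightarrow>
       strands (labels D) (filled W (map (filter (is_real D)) (map rev F))) \<Longrightarrow>
       word_det (labels D) (filled W (map (filter (is_real D)) F)) Z (crossing_matrix D) =
       word_det (labels D) (filled W (map (filter (is_real D)) (map rev F))) Z (crossing_matrix D)"
  shows "diagram_det D' Z = diagram_det D Z"
proof -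
  have len: "length (map rev F) = length F" by simp
  have sub: "\<forall>i<length F. set (map rev F ! i) \<subseteq> set (F ! i)" by simp
  note L = local_move_template[OF wf lm len sub]
  obtain W where W: "template (labels D) (length F) W"
       "\<And>y. filter (is_real D) (word D y) = fill (map (filter (is_real D)) F) (W y)"
       "\<And>y. filter (is_real D) (word D' y) = fill (map (filter (is_real D)) (map rev F)) (W y)"
    using L(4) by blast
  have D: "strand_nodes D = filled W (map (filter (is_real D)) F)"
    by (simp add: fun_eq_iff strand_nodes_def filled_def W)
  have D': "strand_nodes D' = filled W (map (filter (is_real D)) (map rev F))"
  proof
    fix y
    have "filter (is_real D') (word D' y) = filter (is_real D) (word D' y)"
      by (rule filter_cong[OF refl]) (rule real_sub[OF wf(2) L(3)])
    then show "strand_nodes D' y = filled W (map (filter (is_real D)) (map rev F)) y"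
      by (simp only: strand_nodes_def filled_def W)
  qed
  have st: "strands (labels D) (strand_nodes D)" "strands (labels D) (strand_nodes D')"
    using strands_nodes[OF wf(1)] strands_nodes[OF wf(2)] L(1) by simp_all
  have "diagram_det D' Z = word_det (labels D) (strand_nodes D') Z (crossing_matrix D')"
    by (simp add: diagram_det_def L(1))
  also have "\<dots> = word_det (labels D) (strand_nodes D') Z (crossing_matrix D)"
    by (rule word_det_cong[OF st(2)]) (rule crossing_matrix_sub[OF wf L(2,3)], simp_all add: L(1))
  also have "\<dots> = diagram_det D Z"
    unfolding diagram_det_def using det[OF W(1)] st unfolding D D' by simp
  finally show ?thesis .
qed

text \<open>The six passages occupy disjoint, repetition-free holes of a well-formed diagram; a
  coincidence of two crossings would repeat a passage.\<close>

lemma triangle_move_distinct: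
  assumes wf: "well_formed D" and lm: "local_move (triangle o1 o2 o3 p q r) (map rev (triangle o1 o2 o3 p q r)) D D'"
  shows "p \<noteq> q" "p \<noteq> r" "q \<noteq> r"
proof -
  let ?F = "triangle o1 o2 o3 p q r"
  obtain W where W: "\<forall>i<3. (\<Sum>y\<in>labels D. count_list (W y) (Inr i)) = 1"
      "\<forall>y. \<forall>i. Inr i \<in> set (W y) \<longrightarrow> y \<in> labels D \<and> i < 3" "\<And>y. word D y = fill ?F (W y)"
    using lm unfolding local_move_def length_triangle by blast
  have "finite (labels D)" using wf by (simp add: well_formed_def)
  then have T: "template (labels D) 3 W" using W by (simp add: template_def)
  have "filled W ?F = (\<lambda>y. Inl y # map Inr (filter (\<lambda>_. True) (word D y)))"
    by (simp add: fun_eq_iff filled_def W)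
  then have st: "strands (labels D) (filled W ?F)"
    using strands_passages[OF wf, of "\<lambda>_. True"] by simp
  have "distinct (?F ! 0)" "distinct (?F ! 1)" "distinct (?F ! 2)"
    "set (?F ! 0) \<inter> set (?F ! 1) = {}" "set (?F ! 0) \<inter> set (?F ! 2) = {}" "set (?F ! 1) \<inter> set (?F ! 2) = {}"
    by (rule distinct_hole[OF T st] disjoint_holes[OF T st]; simp)+
  then show "p \<noteq> q" "p \<noteq> r" "q \<noteq> r"
    by (auto simp: triangle_def directed_def side_of_def split: if_splits)
qed

lemma over_side:
  assumes "over D (c, s)"
  shows "mark D c = (if s = East then Positive else Negative)" "\<not> over D (c, opp s)" "is_real D (c, t)"
    "weight D c = (if s = East then tvar (strand_of D (c, s)) else inverse (tvar (strand_of D (c, s))))"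
  using assms by (cases s; auto simp: over_def is_real_def virtual_def weight_def)+

lemma under_side: "under D (c, s) \<Longrightarrow> over D (c, opp s)"
  by (cases s) (auto simp: over_def under_def)

lemma over_row:
  assumes "over D (c, s)"
  shows "crossing_matrix D (Inr (c, s)) y = of_bool (y = Inr (c, s)) + (1 - weight D c) * of_bool (y = Inr (c, opp s))"
    and "crossing_matrix D (Inr (c, opp s)) y = weight D c * of_bool (y = Inr (c, opp s))"
proof -
  show "crossing_matrix D (Inr (c, s)) y = of_bool (y = Inr (c, s)) + (1 - weight D c) * of_bool (y = Inr (c, opp s))"
  proof (cases y)
    case (Inr q)
    then show ?thesis using assms side_cases[of "snd q" s] by (cases q) auto
  qed simp
  show "crossing_matrix D (Inr (c, opp s)) y = weight D c * of_bool (y = Inr (c, opp s))"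
    using over_side(2)[OF assms] by (cases y) auto
qed

lemma other_column:
  assumes "x \<noteq> Inr (c, s)" "x \<noteq> Inr (c, opp s)"
  shows "crossing_matrix D x (Inr (c, t)) = 0"
proof (cases x)
  case (Inr q)
  then show ?thesis using assms side_cases[of "snd q" s] by (cases q) auto
qed simp

lemma over_column:
  assumes "over D (c, s)" "x \<noteq> Inr (c, s)"
  shows "crossing_matrix D x (Inr (c, s)) = 0"
proof (cases "x = Inr (c, opp s)")
  case True
  show ?thesis unfolding True over_row(2)[OF assms(1)] by simp
next
  case False
  then show ?thesis by (rule other_column[OF assms(2)])
qed

text \<open>The over branch is handled by \<open>filled_swap\<close>. Both other branches run
  through the virtual crossing \<open>c\<close>, so they have at most one real passage and their
  reversal is invisible.\<close>

lemma diagram_det_OC: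
  assumes wf: "well_formed D" "well_formed D'"
    and F: "F = triangle o1 o2 o3 p q r" and lm: "local_move F (map rev F) D D'"
    and i: "i < 3" "\<forall>x\<in>set (F ! i). over D x"
    and c: "c \<in> {p, q, r} - fst ` set (F ! i)" "virtual D c"
  shows "diagram_det D' Z = diagram_det D Z"
proof (rule local_move_triangle_det[OF wf lm])
  let ?F = "map (filter (is_real D)) F"
  fix W assume T: "template (labels D) (length F) W" and st: "strands (labels D) (filled W ?F)"
  have F_len: "length F = 3" by (simp add: F)
  have F_real: "is_real D x" if "x \<in> set (F ! i)" for x
    using i(2) that over_side(3)[of D "fst x" "snd x" "snd x"] by auto
  obtain a b where ab: "F ! i = [a, b]" unfolding F using set_triangle[OF i(1)] by metis
  have Fi: "?F ! i = [a, b]"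
    using F_len i(1) F_real ab by (simp add: filter_id_conv)
  have rest: "rev (filter (is_real D) (F ! j)) = filter (is_real D) (F ! j)" if j: "j < 3" "j \<noteq> i" for j
  proof -
    obtain a' b' where F_j: "F ! j = [a', b']" unfolding F using set_triangle[OF j(1)] by metis
    have "c \<in> fst ` set (F ! j)"
      using triangle_third[OF i(1) j(1)] j(2) c(1) unfolding F by blast
    then obtain x where "x \<in> set (F ! j)" "fst x = c" by blast
    then show ?thesis using c(2) by (intro rev_filter_one[OF F_j]) (auto simp: is_real_def)
  qed
  have K: "crossing_matrix D (Inr x) (Inr x) = 1" "y \<noteq> Inr x \<Longrightarrow> crossing_matrix D y (Inr x) = 0"
    if x: "x \<in> {a, b}" for x y
  proof -
    have ov: "over D (fst x, snd x)" using i(2) x ab by auto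
    show "crossing_matrix D (Inr x) (Inr x) = 1" using ov by simp
    show "y \<noteq> Inr x \<Longrightarrow> crossing_matrix D y (Inr x) = 0" using over_column[OF ov, of y] by simp
  qed
  have "word_det (labels D) (filled W ?F) Z (crossing_matrix D) =
     word_det (labels D) (filled W (?F[i := [b, a]])) Z (crossing_matrix D)"
    by (rule filled_swap[OF T st _ _ Fi]) (use i F_len K in auto)
  also have "?F[i := [b, a]] = map (filter (is_real D)) (map rev F)"
  proof (rule nth_equalityI)
    fix j assume "j < length (?F[i := [b, a]])"
    then have j: "j < 3" using F_len by simp
    show "?F[i := [b, a]] ! j = map (filter (is_real D)) (map rev F) ! j"
    proof (cases "j = i")
      case True
      then show ?thesis using j F_len ab F_real by simp
    next
      case False
      then show ?thesis using j F_len rest[OF j False] by (simp add: rev_filter)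
    qed
  qed simp
  finally show "word_det (labels D) (filled W ?F) Z (crossing_matrix D) =
     word_det (labels D) (filled W (map (filter (is_real D)) (map rev F))) Z (crossing_matrix D)" .
qed

text \<open>Both over passages lie on strand \<open>z\<close>, so both weights are the variable of
  \<open>z\<close> or its inverse. For an over passage the exponent, which is the sign of the
  crossing, can be read off from its side.\<close>

lemma weight_product:
  assumes wf: "well_formed D" and ov: "over D (c, x)" "over D (d, y)"
    and z: "(c, x) \<in> set (word D z)" "(d, y) \<in> set (word D z)"
  shows "if x = y then weight D c = weight D d else weight D c * weight D d = 1"
  using strand_of_eq[OF wf z(1)] strand_of_eq[OF wf z(2)] over_side(4)[OF ov(1)] over_side(4)[OF ov(2)]
  by (cases x; cases y) simp_all

text \<open>The three branches of a triangle in the order over, middle, under, up to the orientations \<open>b\<close>.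
  The last condition relates the signs of the two crossings of the over branch.\<close>

lemma triangle_normal_form:
  assumes "i < 3" "j < 3" "k < 3" "i \<noteq> j" "i \<noteq> k" "j \<noteq> k"
  obtains b b1 b2 c1 c2 c3 x y w where
    "triangle o1 o2 o3 p q r ! i = directed b [(c1, x), (c2, y)]"
    "triangle o1 o2 o3 p q r ! j = directed b1 [(c1, opp x), (c3, w)]"
    "triangle o1 o2 o3 p q r ! k = directed b2 [(c2, opp y), (c3, opp w)]"
    "b1 = b2 \<longleftrightarrow> x = y" "{c1, c2, c3} = {p, q, r}"
proof -
  let ?T = "triangle o1 o2 o3 p q r"
  let ?s = "side_of o1 o2" and ?t = "side_of o1 o3" and ?u = "side_of o2 o3"
  have T: "?T ! 0 = directed o1 [(p, ?s), (q, ?t)]" "?T ! 1 = directed o2 [(p, opp ?s), (r, ?u)]"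
    "?T ! 2 = directed o3 [(q, opp ?t), (r, opp ?u)]"
    by (simp_all add: triangle_def)
  \<comment> \<open>Negating the orientation bit exchanges the two entries of a branch without
    changing its word. The six cases below choose the bits so that the entries come in the required
    order.\<close>
  have flip: "directed b [a, a'] = directed (\<not> b) [a', a]" for b and a a' :: passage
    by (simp add: directed_def)
  have "i = 0 \<and> j = 1 \<and> k = 2 \<or> i = 0 \<and> j = 2 \<and> k = 1 \<or> i = 1 \<and> j = 0 \<and> k = 2 \<or>
    i = 1 \<and> j = 2 \<and> k = 0 \<or> i = 2 \<and> j = 0 \<and> k = 1 \<or> i = 2 \<and> j = 1 \<and> k = 0"
    using assms by presburger
  then consider "i = 0" "j = 1" "k = 2" | "i = 0" "j = 2" "k = 1" | "i = 1" "j = 0" "k = 2"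
    | "i = 1" "j = 2" "k = 0" | "i = 2" "j = 0" "k = 1" | "i = 2" "j = 1" "k = 0"
    by (elim disjE conjE)
  then show ?thesis
  proof cases
    case 1
    show ?thesis
      by (rule that[of o1 p ?s q ?t o2 r ?u o3]) (use 1 T in \<open>auto simp: side_of_def\<close>)
  next
    case 2
    show ?thesis
      by (rule that[of "\<not> o1" q ?t p ?s o3 r "opp ?u" o2])
        (use 2 T flip[of o1] in \<open>auto simp: side_of_def\<close>)
  next
    case 3
    show ?thesis
      by (rule that[of o2 p "opp ?s" r ?u o1 q ?t "\<not> o3"])
        (use 3 T flip[of o3] in \<open>auto simp: side_of_def\<close>)
  next
    case 4
    show ?thesis
      by (rule that[of "\<not> o2" r ?u p "opp ?s" "\<not> o3" q "opp ?t" o1])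
        (use 4 T flip[of o2] flip[of o3] in \<open>auto simp: side_of_def\<close>)
  next
    case 5
    show ?thesis
      by (rule that[of o3 q "opp ?t" r "opp ?u" "\<not> o1" p ?s "\<not> o2"])
        (use 5 T flip[of o1] flip[of o2] in \<open>auto simp: side_of_def\<close>)
  next
    case 6
    show ?thesis
      by (rule that[of "\<not> o3" r "opp ?u" q "opp ?t" "\<not> o2" p "opp ?s" "\<not> o1"])
        (use 6 T flip[of o1] flip[of o2] flip[of o3] in \<open>auto simp: side_of_def\<close>)
  qed
qed

text \<open>Stitching along the branches reduces both sides to the same words, with one passage per
  branch. The remaining matrices differ by negated orientation bits, and they agree because the two
  crossings of the over branch have the same variable.\<close>

lemma diagram_det_R3:
  assumes wf: "well_formed D" "well_formed D'"
    and F: "F = triangle o1 o2 o3 p q r" and lm: "local_move F (map rev F) D D'"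
    and i: "i < 3" "\<forall>x\<in>set (F ! i). over D x" and k: "k < 3" "\<forall>x\<in>set (F ! k). under D x"
    and nv: "\<not> virtual D p" "\<not> virtual D q" "\<not> virtual D r"
  shows "diagram_det D' Z = diagram_det D Z"
proof (rule local_move_triangle_det[OF wf lm])
  have F_len: "length F = 3" by (simp add: F)
  have ik: "i \<noteq> k"
  proof
    assume "i = k"
    obtain a b where "F ! i = [a, b]" unfolding F using set_triangle[OF i(1)] by metis
    then have "over D a" "under D a" using i(2) k(2) \<open>i = k\<close> by auto
    then show False by (auto simp: over_def under_def)
  qed
  \<comment> \<open>The branches are numbered 0, 1, 2, with sum 3, so this is the middle
    one.\<close>
  define j where "j = 3 - i - k"
  have j: "j < 3" "i \<noteq> j" "j \<noteq> k"
    using i(1) k(1) ik unfolding j_def by presburger+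
  obtain b b1 b2 c1 c2 c3 x y w where N:
    "F ! i = directed b [(c1, x), (c2, y)]"
    "F ! j = directed b1 [(c1, opp x), (c3, w)]"
    "F ! k = directed b2 [(c2, opp y), (c3, opp w)]"
    "b1 = b2 \<longleftrightarrow> x = y" "{c1, c2, c3} = {p, q, r}"
    unfolding F by (rule triangle_normal_form[OF i(1) j(1) k(1) j(2) ik j(3)])
  have pqr: "p \<noteq> q" "p \<noteq> r" "q \<noteq> r"
    using triangle_move_distinct[OF wf(1) lm[unfolded F]] by blast+
  have "card {c1, c2, c3} = 3" unfolding N(5) using pqr by simp
  then have c: "c1 \<noteq> c2" "c1 \<noteq> c3" "c2 \<noteq> c3" by (auto simp: card_insert_if split: if_splits)
  have ov: "over D (c1, x)" "over D (c2, y)" using i(2) N(1) by auto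
  have "under D (c3, opp w)" using k(2) N(3) by auto
  then have ov3: "over D (c3, w)" using under_side by fastforce
  have all_real: "is_real D a" if "a \<in> set (F ! l)" "l < 3" for a l
  proof -
    have l: "l < 3" by (rule that(2))
    obtain a1 a2 where "F ! l = [a1, a2]" "{fst a1, fst a2} \<subseteq> {p, q, r}"
      unfolding F by (rule set_triangle[OF l, of o1 o2 o3 p q r]) blast
    then show ?thesis using that(1) nv by (auto simp: is_real_def)
  qed
  have F_filter: "map (filter (is_real D)) F = F" "map (filter (is_real D)) (map rev F) = map rev F"
  proof -
    have w: "\<forall>a\<in>set w. is_real D a" if w_in: "w \<in> set F" for w
    proof
      fix a assume a: "a \<in> set w"
      obtain l where "l < 3" "F ! l = w" using w_in F_len unfolding in_set_conv_nth by auto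
      then show "is_real D a" using all_real[of a l] a by simp
    qed
    then have "filter (is_real D) w = w" if "w \<in> set F" for w
      using that by (simp add: filter_id_conv)
    then show "map (filter (is_real D)) F = F" by (rule map_idI)
    have "filter (is_real D) w = w" if "w \<in> set (map rev F)" for w
      using that w by (auto simp: filter_id_conv)
    then show "map (filter (is_real D)) (map rev F) = map rev F" by (rule map_idI)
  qed
  obtain z where "z \<in> labels D" "set (F ! i) \<subseteq> set (word D z)"
    using local_move_template(5)[OF wf lm] i(1) F_len by auto
  then have "if x = y then weight D c1 = weight D c2 else weight D c1 * weight D c2 = 1"
    by (intro weight_product[OF wf(1) ov, of z]) (use N(1) in auto)
  then have rel: "if b1 = b2 then weight D c1 = weight D c2 else weight D c1 * weight D c2 = 1"
    using N(4) by simp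
  \<comment> \<open>\<open>crossing_matrix D\<close> itself can serve as the remaining part: a
    crossing involves only its own two passages, so outside the six rows the six columns
    vanish.\<close>
  have K: "crossing_matrix D m n = triangle_matrix (Inr (c1, x)) (Inr (c2, y)) (Inr (c1, opp x)) (Inr (c3, w))
      (Inr (c2, opp y)) (Inr (c3, opp w)) (weight D c1) (weight D c2) (weight D c3) (crossing_matrix D) m n" for m n
    unfolding triangle_matrix_def
    using over_row[OF ov(1), of n] over_row[OF ov(2), of n] over_row[OF ov3, of n]
      other_column[of m c1 x D] other_column[of m c2 y D] other_column[of m c3 w D]
      over_row(2)[OF ov(1), of n] over_row(2)[OF ov(2), of n] over_row(2)[OF ov3, of n]
    by (auto simp del: crossing_matrix.simps)
  have dist: "distinct [(c1, x), (c2, y), (c1, opp x), (c3, w), (c2, opp y), (c3, opp w)]"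
    using c by auto
  fix W assume T: "template (labels D) (length F) W" and st: "strands (labels D) (filled W (map (filter (is_real D)) F))"
    and st': "strands (labels D) (filled W (map (filter (is_real D)) (map rev F)))"
  let ?P = "\<lambda>b1 b2. triangle_paths b1 b2 (Inr (c1, x)) (Inr (c1, opp x)) (Inr (c2, opp y))
      (weight D c1) (weight D c2) (weight D c3) (crossing_matrix D)"
  have rev_dir: "rev (directed b v) = directed (\<not> b) v" for b and v :: "passage list"
    by (simp add: directed_def)
  have N': "map rev F ! i = directed (\<not> b) [(c1, x), (c2, y)]"
    "map rev F ! j = directed (\<not> b1) [(c1, opp x), (c3, w)]"
    "map rev F ! k = directed (\<not> b2) [(c2, opp y), (c3, opp w)]"
    using i(1) j(1) k(1) F_len N(1-3) by (simp_all add: rev_dir)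
  have "word_det (labels D) (filled W F) Z (crossing_matrix D) =
    word_det (labels D) (filled W (F[i := [(c1, x)], j := [(c1, opp x)], k := [(c2, opp y)]])) Z (?P b1 b2)"
    by (rule filled_triangle[OF T st[unfolded F_filter] refl _ _ _ j(2) ik j(3) N(1-3) dist K])
       (use i(1) j(1) k(1) F_len in simp_all)
  moreover have "word_det (labels D) (filled W (map rev F)) Z (crossing_matrix D) =
    word_det (labels D) (filled W ((map rev F)[i := [(c1, x)], j := [(c1, opp x)], k := [(c2, opp y)]])) Z (?P (\<not> b1) (\<not> b2))"
    by (rule filled_triangle[OF T st'[unfolded F_filter] length_map _ _ _ j(2) ik j(3) N' dist K])
       (use i(1) j(1) k(1) F_len in simp_all)
  moreover have "(map rev F)[i := [(c1, x)], j := [(c1, opp x)], k := [(c2, opp y)]] =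
      F[i := [(c1, x)], j := [(c1, opp x)], k := [(c2, opp y)]]"
  proof (rule nth_equalityI)
    fix l assume "l < length ((map rev F)[i := [(c1, x)], j := [(c1, opp x)], k := [(c2, opp y)]])"
    then have l3: "l < 3" using F_len by simp
    have "l = i \<or> l = j \<or> l = k" using l3 i(1) j k(1) ik by linarith
    then show "(map rev F)[i := [(c1, x)], j := [(c1, opp x)], k := [(c2, opp y)]] ! l =
      F[i := [(c1, x)], j := [(c1, opp x)], k := [(c2, opp y)]] ! l"
      using F_len i(1) j(1) k(1) l3 by (simp add: nth_list_update) blast
  qed simp
  ultimately show "word_det (labels D) (filled W (map (filter (is_real D)) F)) Z (crossing_matrix D) =
     word_det (labels D) (filled W (map (filter (is_real D)) (map rev F))) Z (crossing_matrix D)"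
    unfolding F_filter by (simp add: triangle_paths_flip[OF rel])
qed

lemma length_bigon [simp]: "length (bigon par s p q) = 2"
  by (simp add: bigon_def)

lemma less_2: "i < 2 \<longleftrightarrow> i = 0 \<or> i = (1::nat)"
  by auto

lemma nth_two_empty: "i < 2 \<Longrightarrow> [[], []] ! i = []"
  by (auto simp: less_2)

text \<open>The branch meets the two corners on opposite sides, and the corners have opposite signs,
  so one branch is over at both of them. Its over passages have different sides, whence by
  \<open>weight_product\<close> their weights are inverse to each other.\<close>

lemma bigon_normal_form:
  assumes "{mark D p, mark D q} = {Positive, Negative}"
  obtains i j c d x y where "i < 2" "j < 2" "i \<noteq> j" "bigon par s p q ! i = [(c, x), (d, y)]"
    "bigon par s p q ! j = [(c, opp x), (d, opp y)] \<or> bigon par s p q ! j = [(d, opp y), (c, opp x)]"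
    "over D (c, x)" "over D (d, y)" "x \<noteq> y" "c \<noteq> d"
proof -
  have pq: "p \<noteq> q" using assms by (auto simp: doubleton_eq_iff)
  have marks: "mark D p = Positive \<and> mark D q = Negative \<or> mark D p = Negative \<and> mark D q = Positive"
    using assms by (auto simp: doubleton_eq_iff)
  have B: "bigon par s p q ! 0 = [(p, s), (q, opp s)]"
    "bigon par s p q ! 1 = (if par then [(p, opp s), (q, s)] else [(q, s), (p, opp s)])"
    by (simp_all add: bigon_def)
  show ?thesis
  proof (cases "over D (p, s)")
    case True
    then have "over D (q, opp s)" using marks by (cases s) (auto simp: over_def)
    then show ?thesis
      by (intro that[of 0 1 p s q "opp s"]) (use True pq B in simp_all)
  next
    case False
    then have o: "over D (p, opp s)" "over D (q, s)" using marks by (cases s; auto simp: over_def)+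
    show ?thesis
    proof (cases par)
      case True
      show ?thesis
        by (rule that[of 1 0 p "opp s" q s]) (use True pq B o in simp_all)
    next
      case False
      show ?thesis
        by (rule that[of 1 0 q s p "opp s"]) (use False pq B o in simp_all)
    qed
  qed
qed

lemma diagram_det_R2:
  assumes wf: "well_formed D" "well_formed D'"
    and lm: "local_move (bigon par s p q) [[], []] D D'"
    and marks: "{mark D p, mark D q} = {Positive, Negative}"
  shows "diagram_det D' Z = diagram_det D Z"
proof -
  let ?B = "bigon par s p q"
  have sub: "\<forall>i<length ?B. set ([[], []] ! i) \<subseteq> set (?B ! i)"
    by (simp add: nth_two_empty)
  have len: "length [[], []] = length ?B" by simp
  note L = local_move_template[OF wf lm len sub]
  obtain i j c d x y where N: "i < 2" "j < 2" "i \<noteq> j" "?B ! i = [(c, x), (d, y)]"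
    "?B ! j = [(c, opp x), (d, opp y)] \<or> ?B ! j = [(d, opp y), (c, opp x)]"
    "over D (c, x)" "over D (d, y)" "x \<noteq> y" "c \<noteq> d"
    by (rule bigon_normal_form[OF marks])
  obtain W where W: "template (labels D) 2 W"
       "\<And>y. filter (is_real D) (word D y) = fill (map (filter (is_real D)) ?B) (W y)"
       "\<And>y. filter (is_real D) (word D' y) = fill (map (filter (is_real D)) [[], []]) (W y)"
    using L(4) unfolding length_bigon by blast
  have real: "is_real D (c, t)" "is_real D (d, t)" for t
    using over_side(3) N(6,7) by blast+
  have Bi: "map (filter (is_real D)) ?B ! i = [(c, x), (d, y)]"
    using N(1,4) real by simp
  have Bj: "map (filter (is_real D)) ?B ! j = [(c, opp x), (d, opp y)] \<or>
      map (filter (is_real D)) ?B ! j = [(d, opp y), (c, opp x)]"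
    using N(2,5) real by auto
  have D: "strand_nodes D = filled W (map (filter (is_real D)) ?B)"
    by (simp add: fun_eq_iff strand_nodes_def filled_def W)
  have D': "strand_nodes D' = filled W [[], []]"
  proof
    fix y
    have "filter (is_real D') (word D' y) = filter (is_real D) (word D' y)"
      by (rule filter_cong[OF refl]) (rule real_sub[OF wf(2) L(3)])
    then show "strand_nodes D' y = filled W [[], []] y"
      by (simp add: strand_nodes_def filled_def W)
  qed
  have st: "strands (labels D) (strand_nodes D)" "strands (labels D) (strand_nodes D')"
    using strands_nodes[OF wf(1)] strands_nodes[OF wf(2)] L(1) by simp_all
  obtain z where z: "z \<in> labels D" "set (?B ! i) \<subseteq> set (word D z)"
    using L(5)[of i] N(1) by auto
  have "if x = y then weight D c = weight D d else weight D c * weight D d = 1"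
    by (rule weight_product[OF wf(1) N(6,7), of z]) (use z N(4) in auto)
  then have prod: "weight D c * weight D d = 1" using N(8) by simp
  have "diagram_det D Z = word_det (labels D) (filled W (map (filter (is_real D)) ?B)) Z (crossing_matrix D)"
    by (simp only: diagram_det_def D)
  also have "\<dots> = word_det (labels D) (filled W ((map (filter (is_real D)) ?B)[i := [], j := []])) Z (crossing_matrix D)"
  proof (rule filled_R2[OF W(1) st(1)[unfolded D] _ N(1,2,3) Bi Bj _ prod])
    show "distinct [(c, x), (d, y), (c, opp x), (d, opp y)]" using N(9) by auto
    fix m n
    show "crossing_matrix D m n =
      (if m = Inr (c, x) then of_bool (n = Inr (c, x)) + (1 - weight D c) * of_bool (n = Inr (c, opp x))
       else if m = Inr (d, y) then of_bool (n = Inr (d, y)) + (1 - weight D d) * of_bool (n = Inr (d, opp y))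
       else if m = Inr (c, opp x) then weight D c * of_bool (n = Inr (c, opp x))
       else if m = Inr (d, opp y) then weight D d * of_bool (n = Inr (d, opp y))
       else if n \<in> {Inr (c, x), Inr (d, y), Inr (c, opp x), Inr (d, opp y)} then 0 else crossing_matrix D m n)"
      using over_row[OF N(6), of n] over_row[OF N(7), of n]
        other_column[of m c x D] other_column[of m d y D]
      by (auto simp del: crossing_matrix.simps)
  qed simp
  also have "(map (filter (is_real D)) ?B)[i := [], j := []] = [[], []]"
    by (rule nth_equalityI) (use N(1-3) in \<open>auto simp: nth_list_update less_2\<close>)
  also have "word_det (labels D) (filled W [[], []]) Z (crossing_matrix D) = diagram_det D' Z"
  proof -
    have "diagram_det D' Z = word_det (labels D) (strand_nodes D') Z (crossing_matrix D')"
      unfolding diagram_det_def by (subst L(1)) (rule refl)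
    also have "\<dots> = word_det (labels D) (strand_nodes D') Z (crossing_matrix D)"
      by (rule word_det_cong[OF st(2)]) (rule crossing_matrix_sub[OF wf L(2,3)], simp_all add: L(1))
    finally show ?thesis by (simp only: D')
  qed
  finally show ?thesis ..
qed

text \<open>Each branch has at most one real passage, so reversing it does not change its list of
  real passages.\<close>

lemma diagram_det_one_real:
  assumes wf: "well_formed D" "well_formed D'"
    and F: "F = triangle o1 o2 o3 p q r" and lm: "local_move F (map rev F) D D'"
    and virt: "\<And>j. j < 3 \<Longrightarrow> \<exists>x\<in>set (F ! j). virtual D (fst x)"
  shows "diagram_det D' Z = diagram_det D Z"
proof (rule local_move_virtual[OF wf lm])
  have "rev (filter (is_real D) (F ! j)) = filter (is_real D) (F ! j)" if j: "j < 3" for j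
  proof -
    obtain a b where "F ! j = [a, b]" unfolding F by (rule set_triangle[OF j, of o1 o2 o3 p q r]) blast
    then show ?thesis by (rule rev_filter_one) (use virt[OF j] in \<open>auto simp: is_real_def\<close>)
  qed
  then show "map (filter (is_real D)) F = map (filter (is_real D)) (map rev F)"
    by (intro nth_equalityI) (simp_all add: F rev_filter)
qed simp_all

lemma diagram_det_rename:
  assumes wf: "well_formed D" "well_formed D'"
    and inj: "inj_on f (crossings D)" and lab: "opens D' = opens D" "closeds D' = closeds D"
    and words: "\<forall>y. word D' y = map (map_prod f id) (word D y)"
    and marks: "\<forall>c\<in>crossings D. mark D' (f c) = mark D c"
  shows "diagram_det D' Z = diagram_det D Z"
proof -
  have labels: "labels D' = labels D" using lab by (simp add: labels_def)
  let ?g = "map_sum id (map_prod f id) :: 'a + passage \<Rightarrow> _"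
  have real: "is_real D' (f c, s) \<longleftrightarrow> is_real D (c, s)" if "c \<in> crossings D" for c s
    using marks that by (simp add: is_real_def virtual_def)
  have in_cr: "fst p \<in> crossings D" if "p \<in> set (word D y)" for p y
    using in_crossings[OF wf(1) that] .
  have filter: "filter (is_real D') (word D' y) = map (map_prod f id) (filter (is_real D) (word D y))" for y
  proof -
    have "filter (is_real D' \<circ> map_prod f id) (word D y) = filter (is_real D) (word D y)"
      by (rule filter_cong[OF refl]) (use real in_cr in \<open>auto simp: split_paired_all\<close>)
    then show ?thesis using words by (simp add: filter_map)
  qed
  have nodes: "strand_nodes D' y = map ?g (strand_nodes D y)" for y
    by (simp add: strand_nodes_def filter)
  have strand: "strand_of D' (f c, s) = strand_of D (c, s)" if c: "c \<in> crossings D" for c s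
  proof -
    obtain y where y: "(c, s) \<in> set (word D y)" using crossings_passage[OF wf(1) c] by metis
    then have "map_prod f id (c, s) \<in> set (word D' y)" using words by (metis image_eqI list.set_map)
    then show ?thesis using strand_of_eq[OF wf(1) y] strand_of_eq[OF wf(2), of "(f c, s)" y] by simp
  qed
  have K: "crossing_matrix D' (?g m) (?g n) = crossing_matrix D m n"
    if m: "m \<in> nodes (labels D) (strand_nodes D)" and n: "n \<in> nodes (labels D) (strand_nodes D)" for m n
  proof (cases "\<exists>p q. m = Inr p \<and> n = Inr q")
    case True
    then obtain p q where pq: "m = Inr p" "n = Inr q" by blast
    then obtain y y' where "p \<in> set (word D y)" "q \<in> set (word D y')"
      using m n by (auto simp: Inr_in_nodes)
    then have cr: "fst p \<in> crossings D" "fst q \<in> crossings D" using in_cr by auto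
    have eq: "f (fst q) = f (fst p) \<longleftrightarrow> fst q = fst p" using inj_on_eq_iff[OF inj cr(2,1)] .
    have "over D' (f (fst p), snd p) \<longleftrightarrow> over D p" "weight D' (f (fst p)) = weight D (fst p)"
      using marks strand cr(1) by (simp_all add: over_def weight_def)
    then show ?thesis using eq by (cases p; cases q) (simp add: pq)
  next
    case False
    then show ?thesis by (cases m; cases n) auto
  qed
  have inj_g: "inj_on ?g (nodes (labels D) (strand_nodes D))"
  proof (rule inj_onI)
    fix m n assume mn: "m \<in> nodes (labels D) (strand_nodes D)" "n \<in> nodes (labels D) (strand_nodes D)" "?g m = ?g n"
    show "m = n"
    proof (cases "\<exists>p q. m = Inr p \<and> n = Inr q")
      case True
      then obtain p q where pq: "m = Inr p" "n = Inr q" by blast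
      then obtain y y' where "p \<in> set (word D y)" "q \<in> set (word D y')"
        using mn by (auto simp: Inr_in_nodes)
      then have "fst p \<in> crossings D" "fst q \<in> crossings D" using in_cr by auto
      then show ?thesis using mn(3) inj_on_eq_iff[OF inj] by (cases p; cases q) (simp add: pq)
    next
      case False
      then show ?thesis using mn(3) by (cases m; cases n) auto
    qed
  qed
  have "diagram_det D' Z = word_det (labels D) (strand_nodes D) Z (\<lambda>m n. crossing_matrix D' (?g m) (?g n))"
    unfolding diagram_det_def labels
    by (rule word_det_map[where g = ?g, OF strands_nodes[OF wf(1)] inj_g nodes])
  also have "\<dots> = diagram_det D Z"
    unfolding diagram_det_def by (rule word_det_cong[OF strands_nodes[OF wf(1)] K])
  finally show ?thesis .
qed

text \<open>The start node \<open>Inl c\<close> would be in the way of a cyclic rotation. Being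
  trivial, it is deleted, the real passages are rotated, and it is inserted again. The deletion
  needs another node on the component; without one, the rotation changes nothing.\<close>

lemma diagram_det_rotate:
  assumes wf: "well_formed D" "well_formed D'"
    and c: "c \<in> closeds D" "word D c = u @ v" and D': "D' = D\<lparr>word := (word D)(c := v @ u)\<rparr>"
  shows "diagram_det D' (Id_on (closeds D)) = diagram_det D (Id_on (closeds D))"
proof -
  have labels: "labels D' = labels D" and mark: "mark D' = mark D"
    and word: "word D' = (word D)(c := v @ u)" by (simp_all add: D' labels_def)
  have cl: "c \<in> labels D" using c by (simp add: labels_def)
  have real: "is_real D' = is_real D" by (simp add: fun_eq_iff is_real_def virtual_def mark)
  let ?L = "strand_nodes D" and ?Z = "Id_on (closeds D)" and ?K = "crossing_matrix D"
  let ?u = "map Inr (filter (is_real D) u) :: ('a + passage) list"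
    and ?v = "map Inr (filter (is_real D) v) :: ('a + passage) list"
  have Lc: "?L c = [] @ [Inl c] @ ?u @ ?v" by (simp add: strand_nodes_def c)
  have L': "strand_nodes D' = ?L(c := Inl c # ?v @ ?u)"
    by (auto simp: fun_eq_iff strand_nodes_def word real)
  have st: "strands (labels D) ?L" "strands (labels D) (strand_nodes D')"
    using strands_nodes[OF wf(1)] strands_nodes[OF wf(2)] labels by simp_all
  note K = crossing_matrix_label[where y = c and D = D]
  have "word_det (labels D) (strand_nodes D') ?Z ?K = word_det (labels D) ?L ?Z ?K"
  proof (cases "?u @ ?v = []")
    case True
    then have "strand_nodes D' = ?L" unfolding L' using Lc by (auto simp: fun_eq_iff)
    then show ?thesis by simp
  next
    case False
    have "word_det (labels D) ?L ?Z ?K = word_det (labels D) (?L(c := [] @ ?u @ ?v)) ?Z ?K"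
      by (rule word_det_delete[OF st(1) cl Lc]) (use False K in auto)
    also have "\<dots> = word_det (labels D) ((?L(c := [] @ ?u @ ?v))(c := ?v @ ?u)) ?Z ?K"
      by (rule word_det_rotate[OF cl]) (use c in auto)
    also have "\<dots> = word_det (labels D) ((strand_nodes D')(c := [] @ ?v @ ?u)) ?Z ?K"
      by (simp add: L')
    also have "\<dots> = word_det (labels D) (strand_nodes D') ?Z ?K"
      by (rule word_det_delete[OF st(2) cl, of "[]" "Inl c" "?v @ ?u", symmetric])
         (use False K L' in auto)
    finally show ?thesis by simp
  qed
  moreover have "word_det (labels D) (strand_nodes D') ?Z (crossing_matrix D') = word_det (labels D) (strand_nodes D') ?Z ?K"
  proof (rule word_det_cong[OF st(2)])
    fix x y assume "x \<in> nodes (labels D) (strand_nodes D')"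
    then have x: "x \<in> nodes (labels D') (strand_nodes D')" using labels by simp
    show "crossing_matrix D' x y = ?K x y"
      by (rule crossing_matrix_sub[OF wf _ _ x]) (auto simp: word mark c split: if_splits)
  qed
  ultimately show ?thesis unfolding diagram_det_def labels by simp
qed

text \<open>\<open>rotate\<close> is the reason for fixing \<open>Z\<close> as the identity on the
  closed labels: moving the starting point is harmless only if the component is joined to itself.
  The other moves preserve the determinant for every \<open>Z\<close>.\<close>

lemma move_invariant:
  assumes "move D D'" and wf: "well_formed D" "well_formed D'"
  shows "opens D' = opens D \<and> closeds D' = closeds D \<and>
    diagram_det D' (Id_on (closeds D)) = diagram_det D (Id_on (closeds D))"
  using assms(1)
proof cases
  case (rename f)
  then show ?thesis using diagram_det_rename[OF wf] by blast
next
  case (rotate c u v)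
  then show ?thesis using diagram_det_rotate[OF wf] by simp
next
  case (R2 par s p q)
  then show ?thesis using diagram_det_R2[OF wf R2] local_move_labels[OF R2(1)] by simp
next
  case (R3 F o1 o2 o3 p q r i j)
  then show ?thesis using diagram_det_R3[OF wf R3] local_move_labels[OF R3(2)] by simp
next
  case (VR1 p s)
  have "diagram_det D' Z = diagram_det D Z" for Z
    by (rule local_move_virtual[OF wf VR1(1)]) (use VR1(2) in \<open>auto simp: is_real_def\<close>)
  then show ?thesis using local_move_labels[OF VR1(1)] by simp
next
  case (VR2 par s p q)
  have "diagram_det D' Z = diagram_det D Z" for Z
  proof (rule local_move_virtual[OF wf VR2(1)])
    show "map (filter (is_real D)) (bigon par s p q) = map (filter (is_real D)) [[], []]"
      using VR2(2,3) by (simp add: is_real_def bigon_def)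
  qed (simp_all add: nth_two_empty)
  then show ?thesis using local_move_labels[OF VR2(1)] by simp
next
  case (VR3 F o1 o2 o3 p q r)
  have "diagram_det D' Z = diagram_det D Z" for Z
  proof (rule diagram_det_one_real[OF wf VR3(1,2)])
    fix j :: nat assume j: "j < 3"
    show "\<exists>x\<in>set (F ! j). virtual D (fst x)"
      unfolding VR3(1) by (rule set_triangle[OF j, of o1 o2 o3 p q r]) (use VR3(3-5) in auto)
  qed
  then show ?thesis using local_move_labels[OF VR3(2)] by simp
next
  case (M F o1 o2 o3 p q r i c)
  have "diagram_det D' Z = diagram_det D Z" for Z
  proof (rule diagram_det_one_real[OF wf M(1,2)])
    fix j :: nat assume j: "j < 3"
    \<comment> \<open>Any two branches of a triangle share a crossing, so every branch meets one of
      the virtual crossings on branch \<open>i\<close>.\<close>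
    have "fst ` set (F ! i) \<inter> fst ` set (F ! j) \<noteq> {}"
      unfolding M(1) crossings_triangle[OF M(3)] crossings_triangle[OF j] by auto
    then obtain x y where "x \<in> set (F ! i)" "y \<in> set (F ! j)" "fst x = fst y" by blast
    then show "\<exists>x\<in>set (F ! j). virtual D (fst x)" using M(4) by metis
  qed
  then show ?thesis using local_move_labels[OF M(2)] by simp
next
  case (OC F o1 o2 o3 p q r i c)
  then show ?thesis using diagram_det_OC[OF wf OC] local_move_labels[OF OC(2)] by simp
next
  case (endpoint y p s)
  have lab: "labels D' = labels D" using endpoint by (simp add: labels_def)
  have cr: "crossings D' \<subseteq> crossings D - {p}"
    using endpoint(6) unfolding crossings_def lab by (auto simp: erase_def)
  have "diagram_det D' Z = diagram_det D Z" for Z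
  proof (rule diagram_det_sub[OF wf lab])
    show "set (word D' y) \<subseteq> set (word D y)" for y using endpoint(6) by (auto simp: erase_def)
    show "mark D' c = mark D c" if "c \<in> crossings D'" for c using that cr endpoint(7) by blast
    show "filter (is_real D) (word D' y) = filter (is_real D) (word D y)" for y
      using endpoint(3,6) by (auto simp: erase_def is_real_def intro!: filter_cong)
  qed
  then show ?thesis using endpoint by simp
qed

lemma equivalent_invariant:
  assumes "(D, D') \<in> equivalent"
  shows "opens D' = opens D \<and> closeds D' = closeds D \<and>
    diagram_det D' (Id_on (closeds D)) = diagram_det D (Id_on (closeds D))"
  using assms unfolding equivalent_def
proof (induction rule: rtrancl_induct)
  case (step D' D'')
  then have wf: "well_formed D'" "well_formed D''" by (auto simp: is_diagram_def)
  from step(2) consider "move D' D''" | "move D'' D'" by blast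
  then have "opens D'' = opens D' \<and> closeds D'' = closeds D' \<and>
    diagram_det D'' (Id_on (closeds D')) = diagram_det D' (Id_on (closeds D'))"
  proof cases
    case 1
    then show ?thesis using move_invariant[OF 1 wf] by blast
  next
    case 2
    then show ?thesis using move_invariant[OF 2 wf(2,1)] by auto
  qed
  then show ?case using step.IH by simp
qed simp

section \<open>The invariant of a tangle\<close>

lemma equiv_equivalent: "equiv UNIV equivalent"
  unfolding equivalent_def
  by (intro equivI refl_rtrancl trans_rtrancl sym_rtrancl) (auto simp: sym_def)

lemma equivalent_is_diagram: "(D, D') \<in> equivalent \<Longrightarrow> is_diagram D \<Longrightarrow> is_diagram D'"
  unfolding equivalent_def by (erule rtranclE) auto

lemma in_tangle_of [simp]: "D \<in> tangle_of D"
  using equiv_class_self[OF equiv_equivalent, of D] by (simp add: tangle_of_def)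

lemma tangle_of_eq: "D' \<in> tangle_of D \<Longrightarrow> tangle_of D' = tangle_of D"
  unfolding tangle_of_def using equiv_class_eq[OF equiv_equivalent] by blast

lemma tangle_of_move:
  assumes "is_diagram D" "is_diagram D'" "move D D'"
  shows "tangle_of D' = tangle_of D"
proof (rule tangle_of_eq)
  have "(D, D') \<in> equivalent" unfolding equivalent_def using assms by (intro r_into_rtrancl) simp
  then show "D' \<in> tangle_of D" by (simp add: tangle_of_def)
qed

lemma tangle_of_wtangles: "is_diagram D \<Longrightarrow> closeds D = {} \<Longrightarrow> tangle_of D \<in> wtangles (opens D)"
  unfolding wtangles_def wtangles_cl_def tangle_of_def by (rule quotientI) simp

lemma wtangles_clD:
  fixes T :: "'a::linorder diagram set"
  assumes "T \<in> wtangles_cl X C" "D \<in> T"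
  shows "is_diagram D" "opens D = X" "closeds D = C" "T = tangle_of D"
proof -
  obtain D0 where D0: "is_diagram D0" "opens D0 = X" "closeds D0 = C" "T = tangle_of D0"
    using assms(1) unfolding wtangles_cl_def tangle_of_def by (auto elim!: quotientE)
  have eq: "(D0, D) \<in> equivalent" using assms(2) D0(4) by (simp add: tangle_of_def)
  show "is_diagram D" by (rule equivalent_is_diagram[OF eq D0(1)])
  show "opens D = X" "closeds D = C" using equivalent_invariant[OF eq] D0 by simp_all
  show "T = tangle_of D" using tangle_of_eq[of D D0] assms(2) D0(4) by simp
qed

section \<open>Comparison of the two determinants under cutting\<close>

definition gamma_det :: "'a::linorder set \<Rightarrow> 'a gamma \<Rightarrow> ('a \<times> 'a) set \<Rightarrow> 'a ratfun" where
  "gamma_det Y g Z = fst g * closing_det Y (snd g) (\<lambda>i j. of_bool ((i, j) \<in> Z))"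

text \<open>Connecting heads to tails by \<open>cut_joints z y Z\<close> after cutting strand \<open>z\<close> into \<open>z\<close>, \<open>y\<close> amounts to
  connecting by \<open>Z\<close> before the cut.\<close>

definition cut_joints :: "'a \<Rightarrow> 'a \<Rightarrow> ('a \<times> 'a) set \<Rightarrow> ('a \<times> 'a) set" where
  "cut_joints z y Z = insert (z, y) ({(y, j) |j. (z, j) \<in> Z \<and> j \<noteq> y} \<union> {(k, j) \<in> Z. k \<noteq> z \<and> k \<noteq> y \<and> j \<noteq> y})"

lemma cut_joints_iff:
  assumes "z \<noteq> y" "k \<noteq> y" "j \<noteq> y"
  shows "((id(z := y)) k, j) \<in> cut_joints z y Z \<longleftrightarrow> (k, j) \<in> Z"
  using assms by (auto simp: cut_joints_def)

lemma cut_joints_unique: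
  assumes "z \<noteq> y"
  shows "(z, j) \<in> cut_joints z y Z \<longleftrightarrow> j = y" "(k, y) \<in> cut_joints z y Z \<longleftrightarrow> k = z"
  using assms by (auto simp: cut_joints_def)

text \<open>\<open>closing_det_stitch\<close> splits off the factor 1 - \<gamma>, which is precisely
  what Gamma-calculus multiplies into the scalar, and leaves the stitched matrix before its
  variables are identified. The joined strand keeps the name \<open>z\<close>, so only the variable
  of \<open>y\<close> changes.\<close>

lemma gamma_det_stitch:
  assumes "finite Y" "z \<in> Y" "y \<in> Y" "z \<noteq> y" and M: "M y z \<noteq> 1"
    and st: "is_gamma_stitch Y z y z (\<omega>, M) (\<omega>', M')"
  shows "subst_to (var(z := var z, y := var z)) (gamma_det Y (\<omega>, M) (cut_joints z y Z))
     (gamma_det (Y - {y}) (\<omega>', M') Z)"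
proof -
  let ?\<sigma> = "var(z := var z, y := var z)" and ?c = "id(z := y)"
  have Y': "insert z (Y - {z, y}) = Y - {y}" using assms by auto
  have id: "id(z := z) = id" by auto
  note st' = st[unfolded is_gamma_stitch_def prod.case Let_def Y' id id_apply]
  let ?N = "\<lambda>i j. M i (?c j) + M i z * M y (?c j) / (1 - M y z)"
  have "closing_det Y M (\<lambda>i j. of_bool ((i, j) \<in> cut_joints z y Z)) = (1 - M y z) *
     closing_det (Y - {y}) ?N (\<lambda>i j. of_bool ((?c i, j) \<in> cut_joints z y Z))"
    using assms(4) by (intro closing_det_stitch assms(1-4) M) (simp_all add: cut_joints_unique)
  also have "closing_det (Y - {y}) ?N (\<lambda>i j. of_bool ((?c i, j) \<in> cut_joints z y Z)) =
     closing_det (Y - {y}) ?N (\<lambda>i j. of_bool ((i, j) \<in> Z))"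
    by (rule closing_det_cong) (use assms(1,4) cut_joints_iff[of z y] in \<open>auto simp del: fun_upd_apply\<close>)
  finally have eq: "gamma_det Y (\<omega>, M) (cut_joints z y Z) =
      ((1 - M y z) * \<omega>) * closing_det (Y - {y}) ?N (\<lambda>i j. of_bool ((i, j) \<in> Z))"
    by (simp add: gamma_det_def)
  have sc: "subst_to ?\<sigma> ((1 - M y z) * \<omega>) \<omega>'" using st' by (elim conjE)
  have "\<forall>i\<in>Y - {y}. \<forall>j\<in>Y - {y}. subst_to ?\<sigma> (?N i j) (M' i j)"
    using st' unfolding id_def by (elim conjE)
  then have en: "subst_to ?\<sigma> (?N i j) (M' i j)" if "i \<in> Y - {y}" "j \<in> Y - {y}" for i j
    using that by (simp only: ball_simps)
  show ?thesis
    unfolding eq unfolding gamma_det_def fst_conv snd_conv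
    by (intro subst_to_mult sc subst_to_closing_det en subst_to_of_bool) (use assms(1) in simp)
qed

lemma word_det_words_cong:
  assumes "\<And>y. y \<in> Y \<Longrightarrow> L' y = L y"
  shows "word_det Y L' Z K = word_det Y L Z K"
proof -
  have "nodes Y L' = nodes Y L" using assms by (simp add: nodes_def)
  moreover have "{(last (L' y), hd (L' y')) |y y'. y \<in> Y \<and> y' \<in> Y \<and> (y, y') \<in> Z} =
      {(last (L y), hd (L y')) |y y'. y \<in> Y \<and> y' \<in> Y \<and> (y, y') \<in> Z}"
    using assms by (intro Collect_cong ex_cong1) auto
  then have "joints Y L' Z = joints Y L Z" unfolding joints_def using assms by simp
  ultimately show ?thesis by (simp add: word_det_def)
qed

lemma strands_subset:
  assumes "strands Y L" "\<And>y. y \<in> Y \<Longrightarrow> L' y \<noteq> [] \<and> distinct (L' y) \<and> set (L' y) \<subseteq> set (L y)"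
  shows "strands Y L'"
  unfolding strands_def
proof (intro conjI ballI impI)
  show "finite Y" using assms(1) by (simp add: strands_def)
  fix y assume y: "y \<in> Y"
  then show "L' y \<noteq> []" "distinct (L' y)" using assms(2) by auto
  fix y' assume "y' \<in> Y" "y \<noteq> y'"
  then have "set (L y) \<inter> set (L y') = {}" using assms(1) y by (simp add: strands_def)
  then show "set (L' y) \<inter> set (L' y') = {}" using assms(2)[OF y] assms(2)[OF \<open>y' \<in> Y\<close>] by blast
qed

lemma strands_join:
  assumes "strands Y L" "z \<in> Y" "y \<in> Y" "z \<noteq> y"
  shows "strands (Y - {y}) (L(z := L z @ L y))"
  unfolding strands_def
proof (intro conjI ballI impI)
  let ?L = "L(z := L z @ L y)"
  have disj: "set (L k) \<inter> set (L k') = {}" if "k \<in> Y" "k' \<in> Y" "k \<noteq> k'" for k k'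
    using assms(1) that by (simp add: strands_def)
  show "finite (Y - {y})" using assms(1) by (simp add: strands_def)
  fix k assume k: "k \<in> Y - {y}"
  show "?L k \<noteq> []" using k strandsD(1)[OF assms(1)] by auto
  show "distinct (?L k)" using k strandsD(2)[OF assms(1)] disj[OF assms(2-4)] assms(2,3) by auto
  fix k' assume k': "k' \<in> Y - {y}" "k \<noteq> k'"
  show "set (?L k) \<inter> set (?L k') = {}"
    using disj[of k k'] disj[of y k'] disj[of k y] k k' assms(3) by auto
qed

context
  fixes D :: "'a::{linorder,infinite} diagram" and z y u w
  assumes dia: "is_diagram D" and op: "closeds D = {}" and z: "z \<in> opens D" and y: "y \<notin> opens D"
    and word: "word D z = u @ w"
begin

lemma wf_cut: "well_formed D" "well_formed (cut_strand z y u w D)"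
  using dia cut_well_formed[OF _ op z y word] by (simp_all add: is_diagram_def)

text \<open>Joining the two pieces as prescribed by \<open>cut_joints\<close> and deleting the
  trivial node \<open>Inl y\<close> gives back the words of \<open>D\<close>. What differs is the
  variable of the over passages in \<open>w\<close>, and the substitution repairs this.\<close>

lemma diagram_det_cut:
  "subst_to (var(z := var z, y := var z)) (diagram_det (cut_strand z y u w D) (cut_joints z y Z)) (diagram_det D Z)"
proof -
  let ?E = "cut_strand z y u w D" and ?\<sigma> = "var(z := var z, y := var z)"
  note wf = wf_cut and S = cut_strand_simps[OF wf_cut(1) op z y word]
  let ?L = "strand_nodes ?E"
  have neq: "z \<noteq> y" using z y by auto
  have labD: "labels D = opens D" using op by (simp add: labels_def)
  have real: "is_real ?E = is_real D" by (simp add: fun_eq_iff is_real_def virtual_def S)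
  have over: "over ?E = over D" by (simp add: fun_eq_iff over_def S)
  have Lz: "?L z @ ?L y = (Inl z # map Inr (filter (is_real D) u)) @ [Inl y] @ map Inr (filter (is_real D) w)"
    using neq by (simp add: strand_nodes_def S real)
  have Y: "insert y (opens D) - {y} = opens D" using y by simp
  have st: "strands (insert y (opens D)) ?L" using strands_nodes[OF wf(2)] S(3) by simp
  have st_join: "strands (opens D) (?L(z := ?L z @ ?L y))"
    using strands_join[OF st, of z y] z neq Y by simp
  let ?K = "crossing_matrix ?E"
  note unit = crossing_matrix_label[where y = y and D = ?E]
  have "diagram_det ?E (cut_joints z y Z) = word_det (insert y (opens D) - {y}) (?L(z := ?L z @ ?L y)) Z ?K"
    unfolding diagram_det_def S(3)
    by (rule word_det_join[OF st]) (use z neq cut_joints_unique[OF neq] cut_joints_iff[OF neq] in \<open>auto simp del: fun_upd_apply\<close>)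
  also have "\<dots> = word_det (opens D) (?L(z := ?L z @ ?L y)) Z ?K"
    unfolding Y ..
  also have "\<dots> = word_det (opens D) ((?L(z := ?L z @ ?L y))
       (z := (Inl z # map Inr (filter (is_real D) u)) @ map Inr (filter (is_real D) w))) Z ?K"
    by (rule word_det_delete[OF st_join z, of _ "Inl y"]) (use Lz unit in auto)
  also have "\<dots> = word_det (opens D) (strand_nodes D) Z ?K"
    by (rule word_det_words_cong) (use y word in \<open>auto simp: strand_nodes_def S real\<close>)
  finally have eq: "diagram_det ?E (cut_joints z y Z) = word_det (opens D) (strand_nodes D) Z ?K" .
  have strand: "?\<sigma> (strand_of ?E (c, s)) = var (strand_of D (c, s))" if c: "c \<in> crossings D" for c s
  proof -
    have "c \<in> crossings ?E" using c crossings_cut[OF wf(1) op z y word] by simp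
    then obtain k where k: "(c, s) \<in> set (word ?E k)" using crossings_passage[OF wf(2)] by metis
    then have "(c, s) \<in> set (word D (if k = y then z else k))"
      using neq word by (auto simp: S split: if_splits)
    then show ?thesis using strand_of_eq[OF wf(2) k] strand_of_eq[OF wf(1)] by auto
  qed
  have weight: "subst_to ?\<sigma> (weight ?E c) (weight D c)" if c: "c \<in> crossings D" for c
  proof -
    have "subst_to ?\<sigma> (tvar (strand_of ?E (c, s))) (tvar (strand_of D (c, s)))" for s
      by (rule subst_to_tvar[where \<sigma> = ?\<sigma>, OF strand[OF c]])
    then show ?thesis
      unfolding weight_def S(4)
      by (cases "mark D c = Positive") (simp_all only: if_True if_False subst_to_inverse tvar_nonzero not_False_eq_True simp_thms)
  qed
  have K: "subst_to ?\<sigma> (?K m n) (crossing_matrix D m n)" if m: "m \<in> nodes (opens D) (strand_nodes D)" for m n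
  proof (cases "\<exists>p q. m = Inr p \<and> n = Inr q")
    case True
    then obtain p q where pq: "m = Inr p" "n = Inr q" by blast
    then obtain k where k: "p \<in> set (word D k)" using m[folded labD] unfolding pq Inr_in_nodes by blast
    have c: "fst p \<in> crossings D" by (rule in_crossings[OF wf(1) k])
    show ?thesis unfolding pq crossing_matrix.simps over
      using weight[OF c] by (auto simp del: fun_upd_apply)
  next
    case False
    then have "?K m n = of_bool (m = n)" "crossing_matrix D m n = of_bool (m = n)"
      by (cases m; cases n; simp)+
    then show ?thesis by simp
  qed
  have fin: "finite (nodes (opens D) (strand_nodes D))"
    using finite_nodes[OF strands_nodes[OF wf(1)]] labD by simp
  show ?thesis
    unfolding eq unfolding diagram_det_def word_det_def labD
    by (intro subst_to_closing_det fin K subst_to_of_bool)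
qed

text \<open>The connecting arc is the empty word, and no double points are created.\<close>

lemma stitch_cut: "stitch_diagram z y z (cut_strand z y u w D) D"
proof -
  note S = cut_strand_simps[OF wf_cut(1) op z y word]
  have neq: "z \<noteq> y" using z y by auto
  have new: "new_crossings (cut_strand z y u w D) D = {}"
    unfolding new_crossings_def crossings_cut[OF wf_cut(1) op z y word] by simp
  have erase: "erase {} v = v" for v by (simp add: erase_def)
  show ?thesis
    unfolding stitch_diagram_def Let_def new erase only_virtual_new_def S
  proof (intro conjI)
    show "opens D = insert z (insert y (opens D) - {z, y})" using z y by auto
    show "\<exists>u' v w'. word D z = u' @ v @ w' \<and> u' = ((word D)(z := u, y := w)) z \<and>
        w' = ((word D)(z := u, y := w)) y \<and> fst ` set v = {}"
      by (intro exI[of _ u] exI[of _ "[]"] exI[of _ w]) (use neq word in simp)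
  qed (auto simp: op)
qed

text \<open>By the hypothesis on the cut diagram, both sides are values of the same substitution at
  the same rational function, so uniqueness makes them equal.\<close>

lemma gamma_det_cut:
  assumes \<phi>: "gamma_invariant \<phi>" and ne: "u \<noteq> []" "w \<noteq> []"
    and IH: "\<And>Z. gamma_det (insert y (opens D)) (\<phi> (tangle_of (cut_strand z y u w D))) Z =
      diagram_det (cut_strand z y u w D) Z"
  shows "gamma_det (opens D) (\<phi> (tangle_of D)) Z = diagram_det D Z"
proof -
  let ?E = "cut_strand z y u w D" and ?Y = "insert y (opens D)"
  note S = cut_strand_simps[OF wf_cut(1) op z y word]
  have neq: "z \<noteq> y" using z y by auto
  have diaE: "is_diagram ?E" by (rule is_diagram_cut[OF dia op z y word ne])
  have TE: "tangle_of ?E \<in> wtangles ?Y" using tangle_of_wtangles[OF diaE S(2)] S(1) by simp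
  have Y': "insert z (?Y - {z, y}) = opens D" "?Y - {y} = opens D" using z y by auto
  have TD: "tangle_of D \<in> wtangles (insert z (?Y - {z, y}))"
    using tangle_of_wtangles[OF dia op] Y' by simp
  have fin: "finite ?Y" using wf_cut(1) op by (simp add: well_formed_def labels_def)
  have is_st: "is_stitch z y z (tangle_of ?E) (tangle_of D)"
    unfolding is_stitch_def using stitch_cut by (intro bexI[of _ ?E] bexI[of _ D]) auto
  obtain \<omega> M where E: "\<phi> (tangle_of ?E) = (\<omega>, M)" by (cases "\<phi> (tangle_of ?E)")
  obtain \<omega>' M' where D: "\<phi> (tangle_of D) = (\<omega>', M')" by (cases "\<phi> (tangle_of D)")
  have "\<forall>Y x y z. \<forall>T\<in>wtangles Y. \<forall>T'\<in>wtangles (insert z (Y - {x, y})).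
        x \<in> Y \<longrightarrow> y \<in> Y \<longrightarrow> x \<noteq> y \<longrightarrow> z \<notin> Y - {x, y} \<longrightarrow> is_stitch x y z T T' \<longrightarrow>
        is_gamma_stitch Y x y z (\<phi> T) (\<phi> T')"
    using \<phi> unfolding gamma_invariant_def by (elim conjE)
  from this[rule_format, OF TE TD _ _ neq _ is_st] have "is_gamma_stitch ?Y z y z (\<omega>, M) (\<omega>', M')"
    using z E D by simp
  moreover have "\<phi> (tangle_of ?E) \<in> gammas ?Y"
  proof -
    have "\<forall>Y. finite Y \<longrightarrow> (\<forall>T\<in>wtangles Y. \<phi> T \<in> gammas Y)"
      using \<phi> unfolding gamma_invariant_def by (elim conjE)
    then show ?thesis using fin TE by simp
  qed
  then have "\<forall>i\<in>?Y. \<forall>j\<in>?Y. M i j \<in> ratfuns ?Y \<and> subst_to (\<lambda>_. 1) (M i j) (if i = j then 1 else 0)"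
    unfolding E gammas_def by simp
  then have "subst_to (\<lambda>_. 1) (M y z) (if y = z then 1 else 0)" using z by simp
  \<comment> \<open>At t = 1 this off-diagonal entry becomes 0, while the constant 1 stays
    1.\<close>
  then have "M y z \<noteq> 1" using subst_to_unique[of "\<lambda>_. 1" 1 1 0] neq by auto
  ultimately have "subst_to (var(z := var z, y := var z)) (gamma_det ?Y (\<omega>, M) (cut_joints z y Z))
     (gamma_det (?Y - {y}) (\<omega>', M') Z)"
    using z neq fin by (intro gamma_det_stitch) auto
  then have "subst_to (var(z := var z, y := var z)) (diagram_det ?E (cut_joints z y Z)) (gamma_det (opens D) (\<omega>', M') Z)"
    using IH[of "cut_joints z y Z"] by (simp only: E Y')
  from subst_to_unique[OF this diagram_det_cut] show ?thesis by (simp only: D)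
qed

end

section \<open>Closing up strands\<close>

lemma fdet_unit_columns:
  fixes N :: "'n \<Rightarrow> 'n \<Rightarrow> 'f::field"
  assumes "finite V" "A \<subseteq> V" "\<And>i b. b \<in> V - A \<Longrightarrow> i \<in> V \<Longrightarrow> N i b = of_bool (i = b)"
  shows "fdet V N = fdet A N"
  using assms
proof (induction "card (V - A)" arbitrary: V)
  case 0
  then have "V = A" by auto
  then show ?case by simp
next
  case (Suc k)
  then obtain b where b: "b \<in> V - A" by (metis card_eq_0_iff all_not_in_conv nat.distinct(1))
  have "fdet V N = N b b * fdet (V - {b}) (\<lambda>i j. N i j - N i b * N b j / N b b)"
    by (rule fdet_schur) (use b Suc.prems in auto)
  also have "\<dots> = fdet (V - {b}) N"
    using b Suc.prems by (simp, intro fdet_cong) auto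
  also have "\<dots> = fdet A N"
  proof (rule Suc.hyps(1))
    have "V - A = insert b (V - {b} - A)" using b by auto
    then show "k = card (V - {b} - A)" using Suc.hyps(2) Suc.prems(1) by simp
  qed (use b Suc.prems in auto)
  finally show ?case .
qed

text \<open>Labels outside \<open>cs\<close> are joined to nothing, so I - M Z has unit columns
  there and its determinant is that of the block with rows and columns \<open>cs\<close>.\<close>

lemma closure_value_gamma_det:
  assumes "finite Y" "distinct cs" "set cs \<subseteq> Y"
  shows "closure_value cs g = gamma_det Y g (Id_on (set cs))"
proof -
  obtain \<omega> M where g: "g = (\<omega>, M)" by (cases g)
  let ?N = "\<lambda>i j. of_bool (i = j) - (if j \<in> set cs then M i j else 0)" and ?n = "length cs"
  have "(\<Sum>k\<in>Y. M i k * of_bool ((k, j) \<in> Id_on (set cs))) = (if j \<in> set cs then M i j else 0)" if "j \<in> Y" for i j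
  proof -
    have "(\<Sum>k\<in>Y. M i k * of_bool ((k, j) \<in> Id_on (set cs))) = (\<Sum>k\<in>Y. if k = j then (if j \<in> set cs then M i j else 0) else 0)"
      by (rule sum.cong) auto
    then show ?thesis using that assms(1) by simp
  qed
  then have "closing_det Y M (\<lambda>i j. of_bool ((i, j) \<in> Id_on (set cs))) = fdet Y ?N"
    unfolding closing_det_def using assms(1) by (intro fdet_cong) auto
  also have "\<dots> = fdet (set cs) ?N"
    by (rule fdet_unit_columns) (use assms in auto)
  also have "\<dots> = det (1\<^sub>m ?n - mat ?n ?n (\<lambda>(i, j). M (cs ! i) (cs ! j)))"
    unfolding fdet_list[OF assms(2) refl refl]
    by (rule arg_cong[of _ _ det], rule eq_matI) (use assms(2) in \<open>auto simp: nth_eq_iff_index_eq\<close>)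
  finally show ?thesis by (simp add: closure_value_def gamma_det_def g Let_def)
qed

text \<open>The open diagram arises from the closed one by erasing virtual passages, so
  \<open>diagram_det_sub\<close> applies with \<open>C\<close> as the larger diagram. The joining
  \<open>Z\<close> is independent of which components count as closed.\<close>

lemma diagram_det_close:
  assumes wf: "well_formed D" "well_formed C" and D: "closeds D = {}" "set cs \<subseteq> opens D"
    and close: "close_diagram cs D C"
  shows "diagram_det D Z = diagram_det C Z"
proof -
  let ?N = "new_crossings D C"
  note cl = close[unfolded close_diagram_def Let_def]
  have C: "opens C = opens D - set cs" "closeds C = closeds D \<union> set cs" "only_virtual_new D C"
    using cl by simp_all
  have ex: "\<exists>u v. (\<forall>c\<in>set cs. word C c = u c @ v c \<and> erase ?N (u c) = word D c) \<and>
             (\<Union>c\<in>set cs. fst ` set (v c)) = ?N"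
    using cl by (elim conjE)
  have rest: "\<forall>s\<in>labels D - set cs. erase ?N (word C s) = word D s"
    using cl by (elim conjE)
  obtain u v where uv: "\<And>c. c \<in> set cs \<Longrightarrow> word C c = u c @ v c" "\<And>c. c \<in> set cs \<Longrightarrow> erase ?N (u c) = word D c"
      "(\<Union>c\<in>set cs. fst ` set (v c)) = ?N"
    using ex by blast
  have virt: "\<not> is_real C p" if "fst p \<in> ?N" for p
    using C(3) that by (simp add: only_virtual_new_def is_real_def)
  have erase: "filter (is_real C) (erase ?N w) = filter (is_real C) w" for w
    unfolding erase_def filter_filter by (rule filter_cong[OF refl]) (use virt in blast)
  have lab: "labels D = labels C" using C D by (auto simp: labels_def)
  show ?thesis
  proof (rule diagram_det_sub[OF wf(2,1) lab])
    show "set (word D y) \<subseteq> set (word C y)" for y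
    proof (cases "y \<in> labels D")
      case True
      have erase_sub: "set (erase ?N w) \<subseteq> set w" for w by (auto simp: erase_def)
      show ?thesis
      proof (cases "y \<in> set cs")
        case cs: True
        then show ?thesis using erase_sub[of "u y"] by (simp add: uv(1)[OF cs] uv(2)[OF cs] le_supI1)
      next
        case False
        then have "word D y = erase ?N (word C y)" using rest True by simp
        then show ?thesis using erase_sub[of "word C y"] by simp
      qed
    next
      case False
      then show ?thesis using wf(1) by (simp add: well_formed_def)
    qed
    show "mark D c = mark C c" if "c \<in> crossings D" for c
      using C(3) that by (simp add: only_virtual_new_def)
    show "filter (is_real C) (word D y) = filter (is_real C) (word C y)" if "y \<in> labels C" for y
    proof (cases "y \<in> set cs")
      case True
      have "filter (is_real C) (v y) = []"
      proof -
        have "fst p \<in> ?N" if "p \<in> set (v y)" for p using that True uv(3) by blast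
        then show ?thesis using virt by (simp add: filter_empty_conv)
      qed
      then show ?thesis using erase[of "u y"] uv(1,2)[OF True] by simp
    next
      case False
      then show ?thesis using erase[of "word C y"] rest that lab by simp
    qed
  qed
qed

section \<open>Diagrams with at most one passage per strand\<close>

definition last_node :: "'a diagram \<Rightarrow> 'a \<Rightarrow> 'a + passage" where
  "last_node D y = last (strand_nodes D y)"

lemma last_node_mem: "last_node D y \<in> set (strand_nodes D y)"
  unfolding last_node_def by (rule last_in_set) (simp add: strand_nodes_def)

text \<open>The expected value of \<phi> when nothing is stitched: a direct sum of crossing matrices
  and trivial strands. A strand is represented by its real passage, or by its start node if there is
  none.\<close>

definition short_gamma :: "'a::linorder diagram \<Rightarrow> 'a gamma" where
  "short_gamma D =
     (1, \<lambda>i j. if i \<in> opens D \<and> j \<in> opens D then crossing_matrix D (last_node D i) (last_node D j) else 0)"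

text \<open>The start nodes are deleted strand by strand, \<open>A\<close> being the strands already
  treated. On a strand without a real passage the start node is the last node and stays.\<close>

lemma word_det_last_nodes:
  assumes wf: "well_formed D" and short: "\<And>y. length (word D y) \<le> 1"
  shows "word_det (labels D) (strand_nodes D) Z (crossing_matrix D) =
     word_det (labels D) (\<lambda>y. [last_node D y]) Z (crossing_matrix D)"
proof -
  let ?L = "\<lambda>A y. if y \<in> A then [last_node D y] else strand_nodes D y"
  have cases: "strand_nodes D y = [last_node D y] \<or> strand_nodes D y = [Inl y, last_node D y]" for y
    using short[of y] by (cases "word D y") (auto simp: strand_nodes_def last_node_def)
  have st: "strands (labels D) (?L A)" for A
  proof (rule strands_subset[OF strands_nodes[OF wf]])
    fix y assume "y \<in> labels D"
    then show "?L A y \<noteq> [] \<and> distinct (?L A y) \<and> set (?L A y) \<subseteq> set (strand_nodes D y)"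
      using strandsD[OF strands_nodes[OF wf], of y] cases[of y] by auto
  qed
  have "finite (labels D)" using wf by (simp add: well_formed_def)
  then have "word_det (labels D) (?L A) Z (crossing_matrix D) = word_det (labels D) (strand_nodes D) Z (crossing_matrix D)"
    if "A \<subseteq> labels D" for A
  proof -
    have "finite A" using that \<open>finite (labels D)\<close> by (rule finite_subset)
    then show ?thesis using that
    proof (induction A rule: finite_induct)
      case (insert z A)
      have eq: "?L (insert z A) = (?L A)(z := [last_node D z])" by auto
      have "word_det (labels D) (?L A) Z (crossing_matrix D) = word_det (labels D) ((?L A)(z := [last_node D z])) Z (crossing_matrix D)"
        using cases[of z]
      proof
        assume "strand_nodes D z = [last_node D z]"
        then have "(?L A)(z := [last_node D z]) = ?L A" by auto
        then show ?thesis by simp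
      next
        assume z: "strand_nodes D z = [Inl z, last_node D z]"
        have "?L A z = [] @ [Inl z] @ [last_node D z]" using z insert.hyps by simp
        from word_det_delete[OF st _ this, of "crossing_matrix D" Z] show ?thesis
          using insert.prems crossing_matrix_label[where y = z and D = D] by simp
      qed
      then show ?case using insert unfolding eq by simp
    qed simp
  qed
  from this[of "labels D"] have "word_det (labels D) (strand_nodes D) Z (crossing_matrix D) =
      word_det (labels D) (?L (labels D)) Z (crossing_matrix D)" by simp
  also have "\<dots> = word_det (labels D) (\<lambda>y. [last_node D y]) Z (crossing_matrix D)"
    by (rule word_det_words_cong) simp
  finally show ?thesis .
qed

lemma last_node_in_nodes: "y \<in> labels D \<Longrightarrow> last_node D y \<in> nodes (labels D) (strand_nodes D)"
  unfolding nodes_def by (rule UN_I, assumption, rule last_node_mem)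

text \<open>With one node left per strand, nodes correspond to labels and the only joints are those
  of \<open>Z\<close>, so \<open>word_det\<close> already has the form of
  \<open>gamma_det\<close>.\<close>

lemma gamma_det_short:
  assumes wf: "well_formed D" and op: "closeds D = {}" and short: "\<And>y. length (word D y) \<le> 1"
  shows "gamma_det (opens D) (short_gamma D) Z = diagram_det D Z"
proof -
  have lab: "labels D = opens D" using op by (simp add: labels_def)
  have fin: "finite (opens D)" using wf lab by (simp add: well_formed_def)
  have st: "strands (opens D) (\<lambda>y. [y])" using fin by (simp add: strands_def)
  have inj: "inj_on (last_node D) (opens D)"
  proof (rule inj_onI)
    fix x y assume xy: "x \<in> opens D" "y \<in> opens D" "last_node D x = last_node D y"
    show "x = y" using last_node_mem[of D x] last_node_mem[of D y] strands_unique[OF strands_nodes[OF wf], of x y "last_node D x"] xy lab by simp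
  qed
  have "diagram_det D Z = word_det (opens D) (\<lambda>y. [last_node D y]) Z (crossing_matrix D)"
    using word_det_last_nodes[OF wf short, of Z] by (simp only: diagram_det_def lab)
  also have "\<dots> = word_det (opens D) (\<lambda>y. [y]) Z (\<lambda>i j. crossing_matrix D (last_node D i) (last_node D j))"
    by (rule word_det_map[OF st]) (use inj in \<open>simp_all add: nodes_def\<close>)
  also have "\<dots> = closing_det (opens D) (snd (short_gamma D)) (\<lambda>i j. of_bool ((i, j) \<in> Z))"
    unfolding word_det_def
  proof -
    have nodes: "nodes (opens D) (\<lambda>y. [y]) = opens D" by (simp add: nodes_def)
    show "closing_det (nodes (opens D) (\<lambda>y. [y])) (\<lambda>i j. crossing_matrix D (last_node D i) (last_node D j))
        (\<lambda>i j. of_bool ((i, j) \<in> joints (opens D) (\<lambda>y. [y]) Z)) =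
      closing_det (opens D) (snd (short_gamma D)) (\<lambda>i j. of_bool ((i, j) \<in> Z))"
      unfolding nodes by (rule closing_det_cong[OF fin]) (simp_all add: short_gamma_def joints_def)
  qed
  finally show ?thesis by (simp add: gamma_det_def short_gamma_def)
qed

definition trivial_diagram :: "'a set \<Rightarrow> 'a diagram" where
  "trivial_diagram Y = \<lparr>opens = Y, closeds = {}, word = \<lambda>_. [], mark = \<lambda>_. Virtual\<rparr>"

lemma crossings_trivial [simp]: "crossings (trivial_diagram Y) = {}"
  by (simp add: crossings_def trivial_diagram_def)

lemma is_diagram_trivial: "finite Y \<Longrightarrow> is_diagram (trivial_diagram Y)"
proof (rule is_diagram_short_words)
  assume "finite Y"
  then show "well_formed (trivial_diagram Y)"
    unfolding well_formed_def crossings_trivial by (simp add: trivial_diagram_def labels_def)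
qed (simp_all add: trivial_diagram_def)

text \<open>\<open>crossing_diagram\<close> with a free crossing number: a crossing split off from a
  diagram keeps its number, so juxtaposing the two pieces gives back the very same diagram.\<close>

definition crossing_at :: "nat \<Rightarrow> mark \<Rightarrow> 'a \<Rightarrow> 'a \<Rightarrow> 'a diagram" where
  "crossing_at c m a b =
     (let s = (if m = Positive then East else North) in
      \<lparr>opens = {a, b}, closeds = {}, word = (\<lambda>_. [])(a := [(c, s)], b := [(c, opp s)]),
       mark = (\<lambda>_. Virtual)(c := m)\<rparr>)"

lemma crossing_at_simps:
  "opens (crossing_at c m a b) = {a, b}" "closeds (crossing_at c m a b) = {}" "labels (crossing_at c m a b) = {a, b}"
  "word (crossing_at c m a b) = (\<lambda>_. [])(a := [(c, if m = Positive then East else North)],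
     b := [(c, opp (if m = Positive then East else North))])"
  "mark (crossing_at c m a b) = (\<lambda>_. Virtual)(c := m)"
  by (simp_all add: crossing_at_def labels_def Let_def)

lemma crossings_crossing_at: "crossings (crossing_at c m a b) = {c}"
  unfolding crossings_def crossing_at_simps by auto

lemma is_diagram_crossing_at:
  assumes "a \<noteq> b"
  shows "is_diagram (crossing_at c m a b)"
proof (rule is_diagram_short_words)
  show "well_formed (crossing_at c m a b)"
    unfolding well_formed_iff crossings_crossing_at unfolding crossing_at_simps
  proof (intro conjI ballI allI impI)
    fix d s assume "d \<in> {c}"
    then show "\<exists>y\<in>{a, b}. (d, s) \<in> set (((\<lambda>_. [])(a := [(c, if m = Positive then East else North)],
         b := [(c, opp (if m = Positive then East else North))])) y)"
      using assms side_cases[of s "if m = Positive then East else North"] by auto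
  qed (use assms in \<open>auto split: if_splits\<close>)
qed (auto simp: crossing_at_simps)

lemma crossing_diagram_at: "crossing_diagram m a b = crossing_at 0 m a b"
  by (simp add: crossing_diagram_def crossing_at_def)

lemma tangle_of_crossing_at:
  assumes "a \<noteq> b"
  shows "tangle_of (crossing_at c m a b) = tangle_of (crossing_diagram m a b)"
  unfolding crossing_diagram_at
proof (rule tangle_of_move)
  show "move (crossing_at 0 m a b) (crossing_at c m a b)"
    by (rule move.rename[of "\<lambda>_. c"]) (auto simp: crossings_crossing_at crossing_at_simps)
qed (use assms in \<open>simp_all add: is_diagram_crossing_at\<close>)

context
  fixes \<phi> :: "'a::{linorder,infinite} diagram set \<Rightarrow> 'a gamma"
  assumes \<phi>: "gamma_invariant \<phi>"
begin

lemma phi_gammas: "finite Y \<Longrightarrow> T \<in> wtangles Y \<Longrightarrow> \<phi> T \<in> gammas Y"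
proof -
  have "\<forall>Y. finite Y \<longrightarrow> (\<forall>T\<in>wtangles Y. \<phi> T \<in> gammas Y)"
    using \<phi> unfolding gamma_invariant_def by (elim conjE)
  then show "finite Y \<Longrightarrow> T \<in> wtangles Y \<Longrightarrow> \<phi> T \<in> gammas Y" by simp
qed

lemma phi_crossing:
  assumes "m = Positive \<or> m = Negative" "a \<noteq> b"
  shows "\<phi> (tangle_of (crossing_diagram m a b)) = gamma_crossing m a b"
proof -
  have "\<forall>a b. \<forall>m\<in>{Positive, Negative}. a \<noteq> b \<longrightarrow> \<phi> (tangle_of (crossing_diagram m a b)) = gamma_crossing m a b"
    using \<phi> unfolding gamma_invariant_def by (elim conjE)
  then show ?thesis using assms by blast
qed

lemma phi_add:
  assumes "is_diagram D" "closeds D = {}" "x \<notin> opens D"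
  shows "\<phi> (tangle_of (add_strand x D)) = gamma_add x (\<phi> (tangle_of D))"
proof -
  have "\<forall>x D. is_diagram D \<longrightarrow> closeds D = {} \<longrightarrow> x \<notin> opens D \<longrightarrow>
        \<phi> (tangle_of (add_strand x D)) = gamma_add x (\<phi> (tangle_of D))"
    using \<phi> unfolding gamma_invariant_def by (elim conjE)
  then show ?thesis using assms by simp
qed

lemma phi_union:
  assumes D: "is_diagram D" "closeds D = {}" and E: "is_diagram E" "closeds E = {}"
    and disj: "opens D \<inter> opens E = {}" "crossings D \<inter> crossings E = {}"
    and J: "is_diagram (juxtapose D E)"
  shows "\<phi> (tangle_of (juxtapose D E)) = gamma_union (\<phi> (tangle_of D)) (\<phi> (tangle_of E))"
proof -
  have all: "\<forall>Y Z. \<forall>S\<in>wtangles Y. \<forall>T\<in>wtangles Z. \<forall>U\<in>wtangles (Y \<union> Z).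
        Y \<inter> Z = {} \<longrightarrow> is_union S T U \<longrightarrow> \<phi> U = gamma_union (\<phi> S) (\<phi> T)"
    using \<phi> unfolding gamma_invariant_def by (elim conjE)
  have "tangle_of (juxtapose D E) \<in> wtangles (opens D \<union> opens E)"
    using tangle_of_wtangles[OF J] D(2) E(2) by (simp add: juxtapose_def)
  moreover have "is_union (tangle_of D) (tangle_of E) (tangle_of (juxtapose D E))"
    unfolding is_union_def by (intro bexI[of _ D] bexI[of _ E]) (simp_all add: disj)
  ultimately show ?thesis
    using all tangle_of_wtangles[OF D] tangle_of_wtangles[OF E] disj(1) by blast
qed

text \<open>The properties of \<phi> do not name the empty tangle. Its scalar is found by adding it
  to a single crossing, whose scalar is 1; its matrix has no labels and is therefore zero.\<close>

lemma phi_empty: "\<phi> (tangle_of (trivial_diagram {})) = (1, \<lambda>i j. 0)"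
proof -
  obtain a :: 'a where True by blast
  obtain b :: 'a where b: "b \<notin> {a}" using ex_new_if_finite[OF infinite_UNIV, of "{a}"] by auto
  then have ab: "a \<noteq> b" by auto
  let ?E = "trivial_diagram {} :: 'a diagram" and ?C = "crossing_diagram Positive a b"
  have C: "is_diagram ?C" "closeds ?C = {}" "opens ?C = {a, b}"
    using is_diagram_crossing_at[OF ab] unfolding crossing_diagram_at crossing_at_simps by simp_all
  have E: "is_diagram ?E" "closeds ?E = {}" "opens ?E = {}"
    using is_diagram_trivial[of "{} :: 'a set"] by (simp_all add: trivial_diagram_def)
  have "labels ?E = {}" using E by (simp add: labels_def)
  then have J: "juxtapose ?E ?C = ?C"
    using E C by (simp add: juxtapose_def)
  obtain \<omega> M where phi: "\<phi> (tangle_of ?E) = (\<omega>, M)" by (cases "\<phi> (tangle_of ?E)")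
  have "gamma_crossing Positive a b = gamma_union (\<omega>, M) (gamma_crossing Positive a b)"
    using phi_union[OF E(1,2) C(1,2)] J C E phi phi_crossing[OF _ ab, of Positive] by simp
  then have "\<omega> = 1" by (simp add: gamma_crossing_def gamma_union_def Let_def)
  moreover have "(\<omega>, M) \<in> gammas {}"
    using phi_gammas[of "{}" "tangle_of ?E"] tangle_of_wtangles[OF E(1,2)] E(3) phi by simp
  then have "M = (\<lambda>i j. 0)" by (simp add: gammas_def fun_eq_iff)
  ultimately show ?thesis using phi by simp
qed

lemma phi_trivial:
  assumes "finite Y"
  shows "\<phi> (tangle_of (trivial_diagram Y)) = (1, \<lambda>i j. of_bool (i = j \<and> i \<in> Y))"
  using assms
proof (induction Y rule: finite_induct)
  case empty
  then show ?case using phi_empty by simp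
next
  case (insert x Y)
  have "add_strand x (trivial_diagram Y) = trivial_diagram (insert x Y)"
    by (simp add: add_strand_def trivial_diagram_def)
  then have "\<phi> (tangle_of (trivial_diagram (insert x Y))) = gamma_add x (\<phi> (tangle_of (trivial_diagram Y)))"
    using phi_add[OF is_diagram_trivial[OF insert.hyps(1)], of x] insert.hyps by (simp add: trivial_diagram_def)
  then show ?case
    unfolding insert.IH by (auto simp: gamma_add_def fun_eq_iff)
qed

text \<open>Induction on the number of double points. As every word has at most one passage, a real
  crossing together with its two strands is a disjoint summand, and a virtual one can be undone at
  an end point.\<close>

lemma phi_short:
  assumes "well_formed D" "closeds D = {}" "\<And>y. length (word D y) \<le> 1"
  shows "\<phi> (tangle_of D) = short_gamma D"
  using assms
proof (induction "card (crossings D)" arbitrary: D rule: less_induct)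
  case (less D)
  note wf = less.prems(1) and op = less.prems(2) and short = less.prems(3)
  have dia: "is_diagram D" by (rule is_diagram_short_words[OF less.prems])
  have lab: "labels D = opens D" using op by (simp add: labels_def)
  have fin: "finite (opens D)" using wf lab by (simp add: well_formed_def)
  have outside: "word D y = []" if "y \<notin> opens D" for y
    using wf that lab by (simp add: well_formed_def)
  have unmarked: "mark D c = Virtual" if "c \<notin> crossings D" for c
    using wf that by (simp add: well_formed_def)
  show ?case
  proof (cases "crossings D = {}")
    case True
    have w: "word D y = []" for y
    proof (cases "y \<in> opens D")
      case y: True
      then show ?thesis using True lab by (auto simp: crossings_def)
    qed (rule outside)
    have D: "D = trivial_diagram (opens D)"
      using op w unmarked True by (intro diagram.equality) (auto simp: trivial_diagram_def fun_eq_iff)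
    have "last_node D y = Inl y" for y by (simp add: last_node_def strand_nodes_def w)
    then show ?thesis
      using phi_trivial[OF fin] D by (auto simp: short_gamma_def fun_eq_iff)
  next
    case False
    then obtain c where c: "c \<in> crossings D" by blast
    \<comment> \<open>For a real crossing this is the over side. For a virtual one it only matters
      that the two sides are \<open>s\<close> and \<open>opp s\<close>.\<close>
    obtain s where s: "s = (if mark D c = Positive then East else North)" by blast
    obtain a where "a \<in> labels D" "(c, s) \<in> set (word D a)" by (rule crossings_passage[OF wf c])
    then have a: "a \<in> opens D" "word D a = [(c, s)]"
      using lab short[of a] by (cases "word D a"; auto)+
    obtain b where "b \<in> labels D" "(c, opp s) \<in> set (word D b)" by (rule crossings_passage[OF wf c])
    then have b: "b \<in> opens D" "word D b = [(c, opp s)]"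
      using lab short[of b] by (cases "word D b"; auto)+
    have ab: "a \<noteq> b" using a b by auto
    let ?w = "(word D)(a := [], b := [])"
    have other: "c \<notin> fst ` set (word D y)" if "y \<noteq> a" "y \<noteq> b" for y
    proof
      assume "c \<in> fst ` set (word D y)"
      then obtain t where t: "(c, t) \<in> set (word D y)" by auto
      have "t = s \<or> t = opp s" by (rule side_cases)
      then show False
        using passage_unique[OF wf t, of a] passage_unique[OF wf t, of b] a b that by auto
    qed
    have erase: "erase {c} (word D y) = ?w y" for y
    proof (cases "y = a \<or> y = b")
      case True
      then show ?thesis using a b by (auto simp: erase_def)
    next
      case False
      then show ?thesis using other[of y] by (auto simp: erase_def filter_id_conv)
    qed
    \<comment> \<open>What remains after the removal of \<open>c\<close>. If \<open>c\<close> is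
      virtual, the strands \<open>a\<close> and \<open>b\<close> stay without passages and
      \<open>Y\<close> is all of \<open>opens D\<close>; if it is real, they leave together with the
      crossing.\<close>
    define R where "R Y = D\<lparr>opens := Y, word := ?w, mark := (mark D)(c := Virtual)\<rparr>" for Y
    have R: "opens (R Y) = Y" "closeds (R Y) = {}" "word (R Y) = ?w" "mark (R Y) = (mark D)(c := Virtual)" "labels (R Y) = Y" for Y
      using op by (simp_all add: R_def labels_def)
    have cr: "crossings (R Y) = crossings D - {c}" if Y: "opens D - {a, b} \<subseteq> Y" "Y \<subseteq> opens D" for Y
    proof -
      have "(\<Union>y\<in>Y. fst ` set (?w y)) = (\<Union>y\<in>opens D. fst ` set (?w y))"
      proof (intro equalityI subsetI)
        fix d assume "d \<in> (\<Union>y\<in>opens D. fst ` set (?w y))"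
        then obtain k where k: "k \<in> opens D" "d \<in> fst ` set (?w k)" by blast
        then have "k \<noteq> a" "k \<noteq> b" by (auto split: if_splits)
        then show "d \<in> (\<Union>y\<in>Y. fst ` set (?w y))" using k Y by blast
      qed (use Y in blast)
      then have "crossings (R Y) = (\<Union>y\<in>opens D. fst ` set (?w y))"
        unfolding crossings_def R .
      also have "\<dots> = crossings D - {c}"
        unfolding crossings_def lab erase[symmetric] by (auto simp: erase_def)
      finally show ?thesis .
    qed
    have wfR: "well_formed (R Y)" if Y: "opens D - {a, b} \<subseteq> Y" "Y \<subseteq> opens D" for Y
      unfolding well_formed_iff cr[OF Y] R
    proof (intro conjI ballI allI impI)
      show "finite Y" by (rule finite_subset[OF Y(2) fin])
      fix y show "?w y = []" if "y \<notin> Y" using that outside[of y] Y by auto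
    next
      fix y assume "y \<in> Y"
      then show "distinct (?w y)" using wf Y lab unfolding well_formed_iff by auto
    next
      fix y y' assume yy: "y \<in> Y" "y' \<in> Y" "y \<noteq> y'"
      have "set (word D y) \<inter> set (word D y') = {}"
        using wf Y yy lab unfolding well_formed_iff by blast
      then show "set (?w y) \<inter> set (?w y') = {}" by auto
    next
      fix d t assume d: "d \<in> crossings D - {c}"
      then obtain y where y: "y \<in> labels D" "(d, t) \<in> set (word D y)"
        using crossings_passage[OF wf, of d t] by blast
      then have "y \<noteq> a" "y \<noteq> b" using a b d by auto
      then show "\<exists>y\<in>Y. (d, t) \<in> set (?w y)" using y Y lab by (intro bexI[of _ y]) auto
    next
      fix d assume "d \<notin> crossings D - {c}"
      then show "((mark D)(c := Virtual)) d = Virtual" using unmarked by auto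
    qed simp
    have shortR: "length (word (R Y) y) \<le> 1" for Y y
      unfolding R using short by simp
    have less: "card (crossings (R Y)) < card (crossings D)" if Y: "opens D - {a, b} \<subseteq> Y" "Y \<subseteq> opens D" for Y
      unfolding cr[OF Y] using c finite_crossings[OF wf] by (rule card_Diff1_less[rotated])
    have IH: "\<phi> (tangle_of (R Y)) = short_gamma (R Y)" if Y: "opens D - {a, b} \<subseteq> Y" "Y \<subseteq> opens D" for Y
      by (rule less.hyps[OF less[OF Y] wfR[OF Y] R(2) shortR])
    have diaR: "is_diagram (R Y)" if Y: "opens D - {a, b} \<subseteq> Y" "Y \<subseteq> opens D" for Y
      by (rule is_diagram_short_words[OF wfR[OF Y] R(2) shortR])
    have lastR: "last_node (R Y) y = (if y = a \<or> y = b then Inl y else last_node D y)" for Y y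
    proof -
      have "filter (is_real (R Y)) (word D y) = filter (is_real D) (word D y)" if "y \<noteq> a" "y \<noteq> b"
        by (rule filter_cong[OF refl]) (use other[OF that] in \<open>auto simp: is_real_def virtual_def R\<close>)
      then show ?thesis by (auto simp: last_node_def strand_nodes_def R)
    qed
    have KR: "crossing_matrix (R Y) (last_node (R Y) i) n = crossing_matrix D (last_node (R Y) i) n"
      if Y: "opens D - {a, b} \<subseteq> Y" "Y \<subseteq> opens D" and i: "i \<in> Y" for Y i n
    proof (rule crossing_matrix_sub[OF wf wfR[OF Y]])
      show "set (word (R Y) y) \<subseteq> set (word D y)" for y unfolding R by auto
      show "mark (R Y) d = mark D d" if "d \<in> crossings (R Y)" for d using that unfolding cr[OF Y] R by auto
      show "last_node (R Y) i \<in> nodes (labels (R Y)) (strand_nodes (R Y))"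
        by (rule last_node_in_nodes) (use i R in simp)
    qed
    show ?thesis
    proof (cases "mark D c = Virtual")
      case True
      let ?R = "R (opens D)"
      \<comment> \<open>A word with a single passage begins with it, so the end point of
        \<open>a\<close> can be pulled back through \<open>c\<close>; this erases \<open>c\<close>
        from strand \<open>b\<close> as well.\<close>
      have "move D ?R"
      proof (rule move.endpoint[OF a(1), of c s])
        show "(\<exists>w. word D a = w @ [(c, s)]) \<or> (\<exists>w. word D a = (c, s) # w)" using a(2) by simp
      qed (use True erase op R in \<open>auto simp: virtual_def\<close>)
      then have "tangle_of ?R = tangle_of D"
        by (intro tangle_of_move dia diaR) auto
      moreover have "last_node ?R y = last_node D y" for y
        unfolding lastR using a b True by (auto simp: last_node_def strand_nodes_def is_real_def virtual_def)
      then have "short_gamma ?R = short_gamma D"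
        using KR[of "opens D"] by (simp add: short_gamma_def R fun_eq_iff)
      ultimately show ?thesis using IH[of "opens D"] by simp
    next
      case False
      let ?Y = "opens D - {a, b}" and ?C = "crossing_at c (mark D c) a b"
      let ?R = "R ?Y"
      have Y: "opens D - {a, b} \<subseteq> ?Y" "?Y \<subseteq> opens D" by auto
      have m: "mark D c = Positive \<or> mark D c = Negative" using False by (cases "mark D c") auto
      have J: "juxtapose ?C ?R = D"
      proof (rule diagram.equality)
        show "word (juxtapose ?C ?R) = word D"
          using a b by (auto simp: juxtapose_def crossing_at_simps R fun_eq_iff s)
        show "mark (juxtapose ?C ?R) = mark D"
          by (auto simp: juxtapose_def crossing_at_simps crossings_crossing_at R fun_eq_iff)
      qed (use a b op in \<open>auto simp: juxtapose_def crossing_at_simps R\<close>)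
      have "\<phi> (tangle_of D) = gamma_union (gamma_crossing (mark D c) a b) (short_gamma ?R)"
        using phi_union[of ?C ?R, unfolded J] is_diagram_crossing_at[OF ab] diaR[OF Y] dia
          phi_crossing[OF m ab] tangle_of_crossing_at[OF ab] IH[OF Y]
        by (simp add: R crossing_at_simps crossings_crossing_at cr[OF Y])
      also have "\<dots> = short_gamma D"
      proof -
        have real: "is_real D (c, t)" for t using False by (simp add: is_real_def virtual_def)
        have nd: "last_node D a = Inr (c, s)" "last_node D b = Inr (c, opp s)"
          using a b real by (simp_all add: last_node_def strand_nodes_def)
        have ov: "over D (c, s)" using m s by (auto simp: over_def)
        have weight: "weight D c = (if mark D c = Positive then tvar a else inverse (tvar a))"
          using strand_of_eq[OF wf, of "(c, s)" a] a(2) s by (auto simp: weight_def)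
        have far: "last_node D y \<noteq> Inr (c, t)" if "y \<noteq> a" "y \<noteq> b" for y t
        proof
          assume "last_node D y = Inr (c, t)"
          then have "(c, t) \<in> set (word D y)" using last_node_mem[of D y] by (auto simp: strand_nodes_def)
          then show False using other[OF that] by force
        qed
        have "snd (gamma_union (gamma_crossing (mark D c) a b) (short_gamma ?R)) i j = snd (short_gamma D) i j" for i j
        proof -
          have K: "crossing_matrix D (last_node D i) (last_node D j) =
              (if i = a \<and> j = a then 1 else if i = a \<and> j = b then 1 - weight D c
               else if i = b \<and> j = b then weight D c else 0)" if "i \<in> {a, b} \<or> j \<in> {a, b}"
            using that ab over_row[OF ov, of "last_node D j"] far[of j s] far[of j "opp s"] far[of i s] far[of i "opp s"]
              other_column[of "last_node D i" c s D s] other_column[of "last_node D i" c s D "opp s"]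
            by (cases "i = a"; cases "i = b"; cases "j = a"; cases "j = b")
               (simp_all add: nd del: crossing_matrix.simps)
          show ?thesis
          proof (cases "i \<in> ?Y \<and> j \<in> ?Y")
            case True
            then have "snd (short_gamma ?R) i j = crossing_matrix D (last_node D i) (last_node D j)"
              using KR[OF Y, of i] by (simp add: short_gamma_def R lastR)
            then show ?thesis using True by (auto simp: gamma_union_def gamma_crossing_def short_gamma_def Let_def)
          next
            case no: False
            then have R0: "snd (short_gamma ?R) i j = 0" by (auto simp: short_gamma_def R)
            show ?thesis
            proof (cases "i \<in> opens D \<and> j \<in> opens D")
              case True
              then have "i \<in> {a, b} \<or> j \<in> {a, b}" using no by auto
              from K[OF this] show ?thesis
                using True R0 ab by (auto simp: gamma_union_def gamma_crossing_def short_gamma_def Let_def weight)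
            next
              case False
              then show ?thesis
                using R0 a b by (auto simp: gamma_union_def gamma_crossing_def short_gamma_def Let_def)
            qed
          qed
        qed
        then show ?thesis
          by (intro prod_eqI ext) (auto simp: gamma_union_def gamma_crossing_def short_gamma_def Let_def)
      qed
      finally show ?thesis .
    qed
  qed
qed

text \<open>A word with at least two passages is cut after its first one. The cut replaces
  \<open>Z\<close> by \<open>cut_joints z y Z\<close>, so the induction has to cover all
  \<open>Z\<close> at once.\<close>

lemma phi_diagram_det:
  assumes "is_diagram D" "closeds D = {}"
  shows "gamma_det (opens D) (\<phi> (tangle_of D)) Z = diagram_det D Z"
  using assms
proof (induction "\<Sum>y\<in>opens D. length (word D y) - 1" arbitrary: D Z rule: less_induct)
  case (less D)
  note dia = less.prems(1) and op = less.prems(2)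
  have wf: "well_formed D" using dia by (simp add: is_diagram_def)
  have fin: "finite (opens D)" using wf op by (simp add: well_formed_def labels_def)
  show ?case
  proof (cases "\<exists>z\<in>opens D. \<exists>p q v. word D z = p # q # v")
    case True
    then obtain z p q v where z: "z \<in> opens D" "word D z = [p] @ (q # v)" by auto
    obtain y where y: "y \<notin> opens D" using ex_new_if_finite[OF infinite_UNIV fin] by blast
    let ?E = "cut_strand z y [p] (q # v) D"
    note S = cut_strand_simps[OF wf op z(1) y z(2)]
    show ?thesis
    proof (rule gamma_det_cut[OF dia op z(1) y z(2) \<phi>])
      fix Z
      have "gamma_det (opens ?E) (\<phi> (tangle_of ?E)) Z = diagram_det ?E Z"
      proof (rule less.hyps)
        show "is_diagram ?E" by (rule is_diagram_cut[OF dia op z(1) y z(2)]) simp_all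
        show "(\<Sum>y\<in>opens ?E. length (word ?E y) - 1) < (\<Sum>y\<in>opens D. length (word D y) - 1)"
          by (rule cut_strand_shorter[OF wf op z(1) y z(2)[simplified]])
      qed (rule S(2))
      then show "gamma_det (insert y (opens D)) (\<phi> (tangle_of ?E)) Z = diagram_det ?E Z"
        by (simp only: S(1))
    qed simp_all
  next
    case False
    have "length (word D y) \<le> 1" for y
    proof (cases "y \<in> opens D")
      case y: True
      consider "word D y = []" | a where "word D y = [a]" | a b xs where "word D y = a # b # xs"
        by (metis list.exhaust)
      then show ?thesis using False y by cases auto
    next
      case False
      then show ?thesis using wf op by (simp add: well_formed_def labels_def)
    qed
    then show ?thesis
      using gamma_det_short[OF wf op, of Z] phi_short[OF wf op] by simp
  qed
qed

end

theorem proposition15: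
  fixes X :: "'a::{linorder,infinite} set" and cs :: "'a list"
    and \<phi> :: "'a diagram set \<Rightarrow> 'a gamma"
    and T T' U :: "'a diagram set"
  assumes "finite X" and "distinct cs" and "set cs \<inter> X = {}"
    and "gamma_invariant \<phi>"
    and "T \<in> wtangles (X \<union> set cs)" and "T' \<in> wtangles (X \<union> set cs)"
    and "U \<in> wtangles_cl X (set cs)"
    and "is_trace cs T U" and "is_trace cs T' U"
  shows "closure_value cs (\<phi> T) = closure_value cs (\<phi> T')"
proof -
  \<comment> \<open>The closed diagrams witnessing the two traces may differ. They belong to the
    same class \<open>U\<close>, and \<open>equivalent_invariant\<close> compares their
    determinants.\<close>
  have through_closure: "\<exists>C\<in>U. closure_value cs (\<phi> S) = diagram_det C (Id_on (set cs))"
    if S: "S \<in> wtangles (X \<union> set cs)" "is_trace cs S U" for S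
  proof -
    obtain D C where DC: "D \<in> S" "C \<in> U" "close_diagram cs D C"
      using S(2) unfolding is_trace_def by blast
    note D = wtangles_clD[OF S(1)[unfolded wtangles_def] DC(1)]
    have wf: "well_formed D" "well_formed C"
      using D(1) wtangles_clD(1)[OF assms(7) DC(2)] by (simp_all add: is_diagram_def)
    have "closure_value cs (\<phi> S) = gamma_det (opens D) (\<phi> S) (Id_on (set cs))"
      using assms(1,2) D(2) by (intro closure_value_gamma_det) simp_all
    also have "\<dots> = diagram_det D (Id_on (set cs))"
      unfolding D(4) by (rule phi_diagram_det[OF assms(4) D(1,3)])
    also have "\<dots> = diagram_det C (Id_on (set cs))"
      by (rule diagram_det_close[OF wf D(3) _ DC(3)]) (simp add: D(2))
    finally show ?thesis using DC(2) by blast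
  qed
  obtain C where C: "C \<in> U" "closure_value cs (\<phi> T) = diagram_det C (Id_on (set cs))"
    using through_closure[OF assms(5,8)] by blast
  obtain C' where C': "C' \<in> U" "closure_value cs (\<phi> T') = diagram_det C' (Id_on (set cs))"
    using through_closure[OF assms(6,9)] by blast
  have "C' \<in> tangle_of C" using C(1) C'(1) wtangles_clD(4)[OF assms(7)] by blast
  then have "(C, C') \<in> equivalent" by (simp add: tangle_of_def)
  then have "diagram_det C' (Id_on (closeds C)) = diagram_det C (Id_on (closeds C))"
    using equivalent_invariant by blast
  then show ?thesis using C C' wtangles_clD(3)[OF assms(7)] by simp
qed

end
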